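(* Let $A$ and $H$ be cocycle braided alternative bialgebras such that $(A,H)$ is a cocycle cross product system and a cycle cross coproduct system. Let $E=A\oplus H$ with multiplication $$(a+x)(b+y)=\big(ab+x\rightharpoonup b+a\leftharpoonup y+\sigma(x,y)\big)+\big(xy+x\triangleleft b+a\triangleright y+\theta(a,b)\big)$$ and comultiplication $$\Delta_E(a)=(\Delta_A+\phi+\psi+P)(a),\qquad \Delta_E(x)=(\Delta_H+\rho+\gamma+Q)(x)\qquad(a,b\in A,\ x,y\in H).$$ Then $E$ is an alternative bialgebra if and only if $(A,H)$ is a cocycle double matched pair.
   Context: All vector spaces are over a fixed field of characteristic zero. $\tau(u\otimes v)=v\otimes u$, $\tau_{12}(u\otimes v\otimes w)=v\otimes u\otimes w$, $\tau_{23}(u\otimes v\otimes w)=u\otimes w\otimes v$. An alternative algebra is a vector space with a bilinear multiplication such that $(ab)c-a(bc)+(ba)c-b(ac)=0$ and $(ab)c-a(bc)+(ac)b-a(cb)=0$. An alternative coalgebra is a vector space with a linear map $\Delta(a)=a_1\otimes a_2$ such that $D:=(\Delta\otimes\mathrm{id})\Delta-(\mathrm{id}\otimes\Delta)\Delta$ satisfies $D=-\tau_{12}D$ and $D=-\tau_{23}D$. An alternative bialgebra is an alternative algebra which is also an alternative coalgebra such that $\Delta(ab)=a_1b\otimes a_2+a_2b\otimes a_1-a_2\otimes ba_1+b_1\otimes ab_2+b_1\otimes b_2a-ab_1\otimes b_2$ and $\Delta(ba)+\tau\Delta(ba)=a_1\otimes ba_2+ba_2\otimes a_1+b_1a\otimes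 b_2+b_2\otimes b_1a$. DATA. $A,H$ are vector spaces, each with a bilinear multiplication (juxtaposition) and a linear comultiplication $\Delta_A(a)=a_1\otimes a_2$, $\Delta_H(x)=x_1\otimes x_2$ (no axioms a priori), and linear maps $\rightharpoonup:H\otimes A\to A$, $\leftharpoonup:A\otimes H\to A$, $\triangleright:A\otimes H\to H$, $\triangleleft:H\otimes A\to H$, $\sigma:H\otimes H\to A$, $\theta:A\otimes A\to H$, $\phi:A\to H\otimes A$, $\psi:A\to A\otimes H$, $\rho:H\to A\otimes H$, $\gamma:H\to H\otimes A$, $P:A\to H\otimes H$, $Q:H\to A\otimes A$, written $\phi(a)=a_{(-1)}\otimes a_{(0)}$, $\psi(a)=a_{(0)}\otimes a_{(1)}$, $\rho(x)=x_{[-1]}\otimes x_{[0]}$, $\gamma(x)=x_{[0]}\otimes x_{[1]}$, $P(a)=a_{<1>}\otimes a_{<2>}$, $Q(x)=x_{\{1\}}\otimes x_{\{2\}}$. All conditions below are for all $a,b,c\in A$, $x,y,z\in H$. COCYCLE CROSS PRODUCT SYSTEM. $\sigma$ is a cocycle on $H$: $\sigma(xy,z)+\sigma(x,y)\leftharpoonup z-x\rightharpoonup\sigma(y,z)-\sigma(x,yz)=-\sigma(y,x)\leftharpoonup z-\sigma(yx,z)+y\rightharpoonup\sigma(x,z)+\sigma(y,xz)$ and the same left side $=-\sigma(x,z)\leftharpoonup y-\sigma(xz,y)+x\rightharpoonup\sigma(z,y)+\sigma(x,zy)$. $\theta$ is a cocycle on $A$: $\theta(ab,c)+\theta(a,b)\triangleleft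 c-a\triangleright\theta(b,c)-\theta(a,bc)=-\theta(ba,c)-\theta(b,a)\triangleleft c+b\triangleright\theta(a,c)+\theta(b,ac)$ and the same left side $=-\theta(ac,b)-\theta(a,c)\triangleleft b+a\triangleright\theta(c,b)+\theta(a,cb)$. $(H,\sigma)$ is a cocycle $\sigma$-alternative algebra: $\sigma$ is a cocycle and $(xy)z+\sigma(x,y)\triangleright z-x(yz)-x\triangleleft\sigma(y,z)=-(yx)z-\sigma(y,x)\triangleright z+y(xz)+y\triangleleft\sigma(x,z)$ and the same left side $=-(xz)y-\sigma(x,z)\triangleright y+x(zy)+x\triangleleft\sigma(z,y)$. $(A,\theta)$ is a cocycle $\theta$-alternative algebra: $\theta$ is a cocycle and $(ab)c+\theta(a,b)\rightharpoonup c-a(bc)-a\leftharpoonup\theta(b,c)=-(ba)c-\theta(b,a)\rightharpoonup c+b(ac)+b\leftharpoonup\theta(a,c)$ and the same left side $=-(ac)b-\theta(a,c)\rightharpoonup b+a(cb)+a\leftharpoonup\theta(c,b)$. $(A,H)$ is a cocycle cross product system if $(A,\theta)$, $(H,\sigma)$ are such and (CP1) $(ab+ba)\leftharpoonup x+\sigma(\theta(a,b),x)+\sigma(\theta(b,a),x)=a(b\leftharpoonup x)+a\leftharpoonup(b\triangleright x)+b(a\leftharpoonup x)+b\leftharpoonup(a\triangleright x)$; (CP2) $x\rightharpoonup(ab)+a(x\rightharpoonup b)+a\leftharpoonup(x\triangleleft b)+\sigma(x,\theta(a,b))=(x\rightharpoonup a+a\leftharpoonup x)b+(x\triangleleft a+a\triangleright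 x)\rightharpoonup b$; (CP3) $a\leftharpoonup(xy)+a\sigma(x,y)+x\rightharpoonup(a\leftharpoonup y)+\sigma(x,a\triangleright y)=(a\leftharpoonup x+x\rightharpoonup a)\leftharpoonup y+\sigma(a\triangleright x,y)+\sigma(x\triangleleft a,y)$; (CP4) $(xy+yx)\rightharpoonup a+(\sigma(x,y)+\sigma(y,x))a=x\rightharpoonup(y\rightharpoonup a)+\sigma(x,y\triangleleft a)+y\rightharpoonup(x\rightharpoonup a)+\sigma(y,x\triangleleft a)$; (CP5) $(ab+ba)\triangleright x+(\theta(a,b)+\theta(b,a))x=a\triangleright(b\triangleright x)+\theta(a,b\leftharpoonup x)+b\triangleright(a\triangleright x)+\theta(b,a\leftharpoonup x)$; (CP6) $x\triangleleft(ab)+a\triangleright(x\triangleleft b)+\theta(a,x\rightharpoonup b)+x\theta(a,b)=(x\triangleleft a+a\triangleright x)\triangleleft b+\theta(x\rightharpoonup a,b)+\theta(a\leftharpoonup x,b)$; (CP7) $a\triangleright(xy)+x(a\triangleright y)+x\triangleleft(a\leftharpoonup y)+\theta(a,\sigma(x,y))=(a\triangleright x+x\triangleleft a)y+(a\leftharpoonup x+x\rightharpoonup a)\triangleright y$; (CP8) $(xy+yx)\triangleleft a+\theta(\sigma(x,y),a)+\theta(\sigma(y,x),a)=x\triangleleft(y\rightharpoonup a)+x(y\triangleleft a)+y\triangleleft(x\rightharpoonup a)+y(x\triangleleft a)$; (CP9) $x\rightharpoonup(ab+ba)+\sigma(x,\theta(a,b))+\sigma(x,\theta(b,a))=(x\rightharpoonup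 a)b+(x\triangleleft a)\rightharpoonup b+(x\rightharpoonup b)a+(x\triangleleft b)\rightharpoonup a$; (CP10) $(ab)\leftharpoonup x+(a\leftharpoonup x)b+(a\triangleright x)\rightharpoonup b+\sigma(\theta(a,b),x)=a(b\leftharpoonup x+x\rightharpoonup b)+a\leftharpoonup(b\triangleright x+x\triangleleft b)$; (CP11) $(xy)\rightharpoonup a+(x\rightharpoonup a)\leftharpoonup y+\sigma(x\triangleleft a,y)+\sigma(x,y)a=x\rightharpoonup(y\rightharpoonup a+a\leftharpoonup y)+\sigma(x,y\triangleleft a)+\sigma(x,a\triangleright y)$; (CP12) $a\leftharpoonup(xy+yx)+a(\sigma(x,y)+\sigma(y,x))=(a\leftharpoonup x)\leftharpoonup y+\sigma(a\triangleright x,y)+(a\leftharpoonup y)\leftharpoonup x+\sigma(a\triangleright y,x)$; (CP13) $x\triangleleft(ab+ba)+x(\theta(a,b)+\theta(b,a))=(x\triangleleft a)\triangleleft b+\theta(x\rightharpoonup a,b)+(x\triangleleft b)\triangleleft a+\theta(x\rightharpoonup b,a)$; (CP14) $(ab)\triangleright x+\theta(a,b)x+(a\triangleright x)\triangleleft b+\theta(a\leftharpoonup x,b)=a\triangleright(b\triangleright x+x\triangleleft b)+\theta(a,b\leftharpoonup x)+\theta(a,x\rightharpoonup b)$; (CP15) $(xy)\triangleleft a+(x\triangleleft a)y+(x\rightharpoonup a)\triangleright y+\theta(\sigma(x,y),a)=x(y\triangleleft a+a\triangleright y)+x\triangleleft(y\rightharpoonup a+a\leftharpoonup y)$; (CP16)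 $a\triangleright(xy+yx)+\theta(a,\sigma(x,y))+\theta(a,\sigma(y,x))=(a\triangleright x)y+(a\leftharpoonup x)\triangleright y+(a\triangleright y)x+(a\leftharpoonup y)\triangleright x$. CYCLE CROSS COPRODUCT SYSTEM. Put $\alpha_{AAA}=\Delta_A(a_1)\otimes a_2+Q(a_{(-1)})\otimes a_{(0)}-a_1\otimes\Delta_A(a_2)-a_{(0)}\otimes Q(a_{(1)})$, $\alpha_{HHH}=\Delta_H(a_{<1>})\otimes a_{<2>}+P(a_{(0)})\otimes a_{(1)}-a_{(-1)}\otimes P(a_{(0)})-a_{<1>}\otimes\Delta_H(a_{<2>})$, $\alpha_{HAA}=\phi(a_1)\otimes a_2+\gamma(a_{(-1)})\otimes a_{(0)}-a_{(-1)}\otimes\Delta_A(a_{(0)})-a_{<1>}\otimes Q(a_{<2>})$, $\alpha_{AHA}=\psi(a_1)\otimes a_2+\rho(a_{(-1)})\otimes a_{(0)}-a_1\otimes\phi(a_2)-a_{(0)}\otimes\gamma(a_{(1)})$, $\alpha_{AAH}=\Delta_A(a_{(0)})\otimes a_{(1)}+Q(a_{<1>})\otimes a_{<2>}-a_1\otimes\psi(a_2)-a_{(0)}\otimes\rho(a_{(1)})$, $\alpha_{HHA}=P(a_1)\otimes a_2+\Delta_H(a_{(-1)})\otimes a_{(0)}-a_{(-1)}\otimes\phi(a_{(0)})-a_{<1>}\otimes\gamma(a_{<2>})$, $\alpha_{HAH}=\phi(a_{(0)})\otimes a_{(1)}+\gamma(a_{<1>})\otimes a_{<2>}-a_{(-1)}\otimes\psi(a_{(0)})-a_{<1>}\otimes\rho(a_{<2>})$,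 $\alpha_{AHH}=\psi(a_{(0)})\otimes a_{(1)}+\rho(a_{<1>})\otimes a_{<2>}-a_1\otimes P(a_2)-a_{(0)}\otimes\Delta_H(a_{(1)})$, $\beta_{AAA}=\Delta_A(x_{\{1\}})\otimes x_{\{2\}}+Q(x_{[0]})\otimes x_{[1]}-x_{\{1\}}\otimes\Delta_A(x_{\{2\}})-x_{[-1]}\otimes Q(x_{[0]})$, $\beta_{HHH}=\Delta_H(x_1)\otimes x_2+P(x_{[-1]})\otimes x_{[0]}-x_1\otimes\Delta_H(x_2)-x_{[0]}\otimes P(x_{[1]})$, $\beta_{HAA}=\gamma(x_{[0]})\otimes x_{[1]}+\phi(x_{\{1\}})\otimes x_{\{2\}}-x_1\otimes Q(x_2)-x_{[0]}\otimes\Delta_A(x_{[1]})$, $\beta_{AHA}=\rho(x_{[0]})\otimes x_{[1]}+\psi(x_{\{1\}})\otimes x_{\{2\}}-x_{[-1]}\otimes\gamma(x_{[0]})-x_{\{1\}}\otimes\phi(x_{\{2\}})$, $\beta_{AAH}=Q(x_1)\otimes x_2+\Delta_A(x_{[-1]})\otimes x_{[0]}-x_{[-1]}\otimes\rho(x_{[0]})-x_{\{1\}}\otimes\psi(x_{\{2\}})$, $\beta_{HHA}=\Delta_H(x_{[0]})\otimes x_{[1]}+P(x_{\{1\}})\otimes x_{\{2\}}-x_1\otimes\gamma(x_2)-x_{[0]}\otimes\phi(x_{[1]})$, $\beta_{HAH}=\gamma(x_1)\otimes x_2+\phi(x_{[-1]})\otimes x_{[0]}-x_1\otimes\rho(x_2)-x_{[0]}\otimes\psi(x_{[1]})$,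 $\beta_{AHH}=\rho(x_1)\otimes x_2+\psi(x_{[-1]})\otimes x_{[0]}-x_{[-1]}\otimes\Delta_H(x_{[0]})-x_{\{1\}}\otimes P(x_{\{2\}})$. $P$ is a cycle on $A$ if $\alpha_{HHH}=-\tau_{12}\alpha_{HHH}=-\tau_{23}\alpha_{HHH}$; $Q$ is a cycle on $H$ if $\beta_{AAA}=-\tau_{12}\beta_{AAA}=-\tau_{23}\beta_{AAA}$. $(H,P)$ is a cycle $P$-alternative coalgebra if $P$ is a cycle and $\beta_{HHH}=-\tau_{12}\beta_{HHH}=-\tau_{23}\beta_{HHH}$; $(A,Q)$ is a cycle $Q$-alternative coalgebra if $Q$ is a cycle and $\alpha_{AAA}=-\tau_{12}\alpha_{AAA}=-\tau_{23}\alpha_{AAA}$. $(A,H)$ is a cycle cross coproduct system if $(A,Q)$ and $(H,P)$ are such and, for both $\kappa=\alpha$ and $\kappa=\beta$, $\kappa_{HAA}=-\tau_{12}\kappa_{AHA}$, $\kappa_{HHA}=-\tau_{12}\kappa_{HHA}$, $\kappa_{AAH}=-\tau_{12}\kappa_{AAH}$, $\kappa_{AHH}=-\tau_{12}\kappa_{HAH}$, $\kappa_{HAA}=-\tau_{23}\kappa_{HAA}$, $\kappa_{HHA}=-\tau_{23}\kappa_{HAH}$, $\kappa_{AAH}=-\tau_{23}\kappa_{AHA}$, $\kappa_{AHH}=-\tau_{23}\kappa_{AHH}$. COCYCLE BRAIDED ALTERNATIVE BIALGEBRAS. $A$ is a cocycle braided alternative bialgebra if $(A,\theta)$ is a cocycle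 $\theta$-alternative algebra, $(A,Q)$ a cycle $Q$-alternative coalgebra, and (CBB1) $\Delta_A(ab)+Q(\theta(a,b))=a_1b\otimes a_2+a_2b\otimes a_1-a_2\otimes ba_1+b_1\otimes ab_2+b_1\otimes b_2a-ab_1\otimes b_2+(a_{(-1)}\rightharpoonup b)\otimes a_{(0)}+(a_{(1)}\rightharpoonup b)\otimes a_{(0)}-a_{(0)}\otimes(b\leftharpoonup a_{(-1)})+b_{(0)}\otimes(a\leftharpoonup b_{(1)})+b_{(0)}\otimes(b_{(1)}\rightharpoonup a)-(a\leftharpoonup b_{(-1)})\otimes b_{(0)}$; (CBB2) $\Delta_A(ba)+Q(\theta(b,a))+\tau\Delta_A(ba)+\tau Q(\theta(b,a))=a_1\otimes ba_2+ba_2\otimes a_1+b_1a\otimes b_2+b_2\otimes b_1a+a_{(0)}\otimes(b\leftharpoonup a_{(1)})+(b\leftharpoonup a_{(1)})\otimes a_{(0)}+(b_{(-1)}\rightharpoonup a)\otimes b_{(0)}+b_{(0)}\otimes(b_{(-1)}\rightharpoonup a)$. $H$ is a cocycle braided alternative bialgebra if $(H,\sigma)$ is a cocycle $\sigma$-alternative algebra, $(H,P)$ a cycle $P$-alternative coalgebra, and (CBB3) $\Delta_H(xy)+P(\sigma(x,y))=x_1y\otimes x_2+x_2y\otimes x_1-x_2\otimes yx_1+y_1\otimes xy_2+y_1\otimes y_2x-xy_1\otimes y_2+(x_{[-1]}\triangleright y)\otimes x_{[0]}+(x_{[1]}\triangleright y)\otimes x_{[0]}-x_{[0]}\otimes(y\triangleleft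 x_{[-1]})+y_{[0]}\otimes(x\triangleleft y_{[1]})+y_{[0]}\otimes(y_{[1]}\triangleright x)-(x\triangleleft y_{[-1]})\otimes y_{[0]}$; (CBB4) $\Delta_H(yx)+P(\sigma(y,x))+\tau\Delta_H(yx)+\tau P(\sigma(y,x))=x_1\otimes yx_2+yx_2\otimes x_1+y_1x\otimes y_2+y_2\otimes y_1x+x_{[0]}\otimes(y\triangleleft x_{[1]})+(y\triangleleft x_{[1]})\otimes x_{[0]}+(y_{[-1]}\triangleright x)\otimes y_{[0]}+y_{[0]}\otimes(y_{[-1]}\triangleright x)$. COCYCLE DOUBLE MATCHED PAIR. $(A,H)$ is a cocycle double matched pair if: (CDM1) $\phi(ab)+\gamma(\theta(a,b))=-a_{(1)}\otimes ba_{(0)}+b_{(-1)}\otimes ab_{(0)}+b_{(-1)}\otimes b_{(0)}a+(a_{(-1)}\triangleleft b)\otimes a_{(0)}+(a_{(1)}\triangleleft b)\otimes a_{(0)}-(a\triangleright b_{(-1)})\otimes b_{(0)}+b_{<1>}\otimes(a\leftharpoonup b_{<2>})+b_{<1>}\otimes(b_{<2>}\rightharpoonup a)-a_{<2>}\otimes(b\leftharpoonup a_{<1>})+\theta(a_1,b)\otimes a_2+\theta(a_2,b)\otimes a_1-\theta(a,b_1)\otimes b_2$; (CDM2) $\psi(ab)+\rho(\theta(a,b))=a_{(0)}b\otimes a_{(1)}+a_{(0)}b\otimes a_{(-1)}-ab_{(0)}\otimes b_{(1)}-a_{(0)}\otimes(b\triangleright a_{(-1)})+b_{(0)}\otimes(a\triangleright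 b_{(1)})+b_{(0)}\otimes(b_{(1)}\triangleleft a)+(a_{<1>}\rightharpoonup b)\otimes a_{<2>}+(a_{<2>}\rightharpoonup b)\otimes a_{<1>}-(a\leftharpoonup b_{<1>})\otimes b_{<2>}+b_1\otimes\theta(a,b_2)+b_1\otimes\theta(b_2,a)-a_2\otimes\theta(b,a_1)$; (CDM3) $\rho(xy)+\psi(\sigma(x,y))=(x_{[1]}\leftharpoonup y)\otimes x_{[0]}+(x_{[-1]}\leftharpoonup y)\otimes x_{[0]}-x_{[1]}\otimes yx_{[0]}-(x\rightharpoonup y_{[-1]})\otimes y_{[0]}+y_{[-1]}\otimes xy_{[0]}+y_{[-1]}\otimes y_{[0]}x+\sigma(x_1,y)\otimes x_2+\sigma(x_2,y)\otimes x_1-\sigma(x,y_1)\otimes y_2+y_{\{1\}}\otimes(y_{\{2\}}\triangleright x)+y_{\{1\}}\otimes(x\triangleleft y_{\{2\}})-x_{\{2\}}\otimes(y\triangleleft x_{\{1\}})$; (CDM4) $\gamma(xy)+\phi(\sigma(x,y))=x_{[0]}y\otimes x_{[1]}+x_{[0]}y\otimes x_{[-1]}-x_{[0]}\otimes(y\rightharpoonup x_{[-1]})-xy_{[0]}\otimes y_{[1]}+y_{[0]}\otimes(x\rightharpoonup y_{[1]})+y_{[0]}\otimes(y_{[1]}\leftharpoonup x)+(x_{\{1\}}\triangleright y)\otimes x_{\{2\}}+(x_{\{2\}}\triangleright y)\otimes x_{\{1\}}-x_2\otimes\sigma(y,x_1)+y_1\otimes\sigma(x,y_2)+y_1\otimes\sigma(y_2,x)-(x\triangleleft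 y_{\{1\}})\otimes y_{\{2\}}$; (CDM5) $\Delta_A(x\rightharpoonup b)+Q(x\triangleleft b)=(x_{[0]}\rightharpoonup b)\otimes x_{[1]}+(x_{[0]}\rightharpoonup b)\otimes x_{[-1]}-x_{[1]}\otimes(b\leftharpoonup x_{[0]})-(x\rightharpoonup b_1)\otimes b_2+b_1\otimes(x\rightharpoonup b_2)+b_1\otimes(b_2\leftharpoonup x)+b_{(0)}\otimes\sigma(x,b_{(1)})+b_{(0)}\otimes\sigma(b_{(1)},x)-\sigma(x,b_{(-1)})\otimes b_{(0)}+x_{\{1\}}b\otimes x_{\{2\}}+x_{\{2\}}b\otimes x_{\{1\}}-x_{\{2\}}\otimes bx_{\{1\}}$; (CDM6) $\Delta_A(a\leftharpoonup y)+Q(a\triangleright y)=(a_1\leftharpoonup y)\otimes a_2+(a_2\leftharpoonup y)\otimes a_1-a_2\otimes(y\rightharpoonup a_1)-(a\leftharpoonup y_{[0]})\otimes y_{[1]}+y_{[-1]}\otimes(a\leftharpoonup y_{[0]})+y_{[-1]}\otimes(y_{[0]}\rightharpoonup a)+\sigma(a_{(-1)},y)\otimes a_{(0)}+\sigma(a_{(1)},y)\otimes a_{(0)}-a_{(0)}\otimes\sigma(y,a_{(-1)})+y_{\{1\}}\otimes ay_{\{2\}}+y_{\{1\}}\otimes y_{\{2\}}a-ay_{\{1\}}\otimes y_{\{2\}}$; (CDM7) $\Delta_H(a\triangleright y)+P(a\leftharpoonup y)=(a_{(0)}\triangleright y)\otimes a_{(1)}+(a_{(0)}\triangleright y)\otimes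 a_{(-1)}-a_{(1)}\otimes(y\triangleleft a_{(0)})+y_1\otimes(a\triangleright y_2)+y_1\otimes(y_2\triangleleft a)-(a\triangleright y_1)\otimes y_2+y_{[0]}\otimes\theta(a,y_{[1]})+y_{[0]}\otimes\theta(y_{[1]},a)-\theta(a,y_{[-1]})\otimes y_{[0]}+a_{<1>}y\otimes a_{<2>}+a_{<2>}y\otimes a_{<1>}-a_{<2>}\otimes ya_{<1>}$; (CDM8) $\Delta_H(x\triangleleft b)+P(x\rightharpoonup b)=(x_1\triangleleft b)\otimes x_2+(x_2\triangleleft b)\otimes x_1-x_2\otimes(b\triangleright x_1)+b_{(-1)}\otimes(x\triangleleft b_{(0)})+b_{(-1)}\otimes(b_{(0)}\triangleright x)-(x\triangleleft b_{(0)})\otimes b_{(1)}+\theta(x_{[-1]},b)\otimes x_{[0]}+\theta(x_{[1]},b)\otimes x_{[0]}-x_{[0]}\otimes\theta(b,x_{[-1]})+b_{<1>}\otimes xb_{<2>}+b_{<1>}\otimes b_{<2>}x-xb_{<1>}\otimes b_{<2>}$; (CDM9) $\Delta_H(\theta(a,b))+P(ab)=\theta(a_{(0)},b)\otimes a_{(1)}+\theta(a_{(0)},b)\otimes a_{(-1)}-\theta(a,b_{(0)})\otimes b_{(1)}+b_{(-1)}\otimes\theta(a,b_{(0)})+b_{(-1)}\otimes\theta(b_{(0)},a)-a_{(1)}\otimes\theta(b,a_{(0)})+(a_{<1>}\triangleleft b)\otimes a_{<2>}+(a_{<2>}\triangleleft b)\otimes a_{<1>}-(a\triangleright b_{<1>})\otimes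 b_{<2>}+b_{<1>}\otimes(a\triangleright b_{<2>})+b_{<1>}\otimes(b_{<2>}\triangleleft a)-a_{<2>}\otimes(b\triangleright a_{<1>})$; (CDM10) $\Delta_A(\sigma(x,y))+Q(xy)=\sigma(x_{[0]},y)\otimes x_{[1]}+\sigma(x_{[0]},y)\otimes x_{[-1]}-\sigma(x,y_{[0]})\otimes y_{[1]}+y_{[-1]}\otimes\sigma(x,y_{[0]})+y_{[-1]}\otimes\sigma(y_{[0]},x)-x_{[1]}\otimes\sigma(y,x_{[0]})+(x_{\{1\}}\leftharpoonup y)\otimes x_{\{2\}}+(x_{\{2\}}\leftharpoonup y)\otimes x_{\{1\}}-x_{\{2\}}\otimes(y\rightharpoonup x_{\{1\}})+y_{\{1\}}\otimes(x\rightharpoonup y_{\{2\}})+y_{\{1\}}\otimes(y_{\{2\}}\leftharpoonup x)-(x\rightharpoonup y_{\{1\}})\otimes y_{\{2\}}$; (CDM11) $\phi(x\rightharpoonup b)+\gamma(x\triangleleft b)=(x_{[0]}\triangleleft b)\otimes x_{[1]}+(x_{[0]}\triangleleft b)\otimes x_{[-1]}-x_2\otimes(b\leftharpoonup x_1)-x_{[0]}\otimes bx_{[-1]}+b_{(-1)}\otimes(x\rightharpoonup b_{(0)})-(x\triangleleft b_1)\otimes b_2+b_{(-1)}\otimes(b_{(0)}\leftharpoonup x)-xb_{(-1)}\otimes b_{(0)}+\theta(x_{\{1\}},b)\otimes x_{\{2\}}+\theta(x_{\{2\}},b)\otimes x_{\{1\}}+b_{<1>}\otimes\sigma(x,b_{<2>})+b_{<1>}\otimes\sigma(b_{<2>},x)$;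 (CDM12) $\psi(a\leftharpoonup y)+\rho(a\triangleright y)=(a_{(0)}\leftharpoonup y)\otimes a_{(1)}+(a_{(0)}\leftharpoonup y)\otimes a_{(-1)}-a_2\otimes(y\triangleleft a_1)-a_{(0)}\otimes ya_{(-1)}+y_{[-1]}\otimes(a\triangleright y_{[0]})-(a\leftharpoonup y_1)\otimes y_2+y_{[-1]}\otimes(y_{[0]}\triangleleft a)-ay_{[-1]}\otimes y_{[0]}+\sigma(a_{<1>},y)\otimes a_{<2>}+\sigma(a_{<2>},y)\otimes a_{<1>}+y_{\{1\}}\otimes\theta(a,y_{\{2\}})+y_{\{1\}}\otimes\theta(y_{\{2\}},a)$; (CDM13) $\psi(x\rightharpoonup b)+\rho(x\triangleleft b)=(x_1\rightharpoonup b)\otimes x_2+x_{[-1]}b\otimes x_{[0]}+(x_2\rightharpoonup b)\otimes x_1+x_{[1]}b\otimes x_{[0]}-x_{[1]}\otimes(b\triangleright x_{[0]})+b_1\otimes(x\triangleleft b_2)+b_{(0)}\otimes xb_{(1)}+b_1\otimes(b_2\triangleright x)+b_{(0)}\otimes b_{(1)}x-(x\rightharpoonup b_{(0)})\otimes b_{(1)}-x_{\{2\}}\otimes\theta(b,x_{\{1\}})-\sigma(x,b_{<1>})\otimes b_{<2>}$; (CDM14) $\phi(a\leftharpoonup y)+\gamma(a\triangleright y)=(a_1\triangleright y)\otimes a_2+a_{(-1)}y\otimes a_{(0)}+(a_2\triangleright y)\otimes a_1+a_{(1)}y\otimes a_{(0)}-a_{(1)}\otimes(y\rightharpoonup a_{(0)})+y_1\otimes(a\leftharpoonup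 y_2)+y_{[0]}\otimes ay_{[1]}+y_1\otimes(y_2\rightharpoonup a)+y_{[0]}\otimes y_{[1]}a-(a\triangleright y_{[0]})\otimes y_{[1]}-\theta(a,y_{\{1\}})\otimes y_{\{2\}}-a_{<2>}\otimes\sigma(y,a_{<1>})$; (CDM15) $\phi(ba)+\gamma(\theta(b,a))+\tau\psi(ba)+\tau\rho(\theta(b,a))=a_{(-1)}\otimes ba_{(0)}+(b\triangleright a_{(1)})\otimes a_{(0)}+(b_{(-1)}\triangleleft a)\otimes b_{(0)}+b_{(1)}\otimes b_{(0)}a+a_{<1>}\otimes(b\leftharpoonup a_{<2>})+b_{<2>}\otimes(b_{<1>}\rightharpoonup a)+\theta(b,a_2)\otimes a_1+\theta(b_1,a)\otimes b_2$; (CDM16) $\psi(ba)+\rho(\theta(b,a))+\tau\phi(ba)+\tau\gamma(\theta(b,a))=a_{(0)}\otimes(b\triangleright a_{(1)})+ba_{(0)}\otimes a_{(-1)}+b_{(0)}a\otimes b_{(1)}+b_{(0)}\otimes(b_{(-1)}\triangleleft a)+a_1\otimes\theta(b,a_2)+b_2\otimes\theta(b_1,a)+(b\leftharpoonup a_{<2>})\otimes a_{<1>}+(b_{<1>}\rightharpoonup a)\otimes b_{<2>}$; (CDM17) $\rho(yx)+\psi(\sigma(y,x))+\tau\gamma(yx)+\tau\phi(\sigma(y,x))=x_{[-1]}\otimes yx_{[0]}+(y\rightharpoonup x_{[1]})\otimes x_{[0]}+(y_{[-1]}\leftharpoonup x)\otimes y_{[0]}+y_{[1]}\otimes y_{[0]}x+x_{\{1\}}\otimes(y\triangleleft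 x_{\{2\}})+y_{\{2\}}\otimes(y_{\{1\}}\triangleright x)+\sigma(y,x_2)\otimes x_1+\sigma(y_1,x)\otimes y_2$; (CDM18) $\gamma(yx)+\phi(\sigma(y,x))+\tau\rho(yx)+\tau\psi(\sigma(y,x))=yx_{[0]}\otimes x_{[-1]}+y_{[0]}x\otimes y_{[1]}+y_{[0]}\otimes(y_{[-1]}\leftharpoonup x)+x_{[0]}\otimes(y\rightharpoonup x_{[1]})+x_1\otimes\sigma(y,x_2)+y_2\otimes\sigma(y_1,x)+(y\triangleleft x_{\{2\}})\otimes x_{\{1\}}+(y_{\{1\}}\triangleright x)\otimes y_{\{2\}}$; (CDM19) $\Delta_A(b\leftharpoonup x)+Q(b\triangleright x)+\tau\Delta_A(b\leftharpoonup x)+\tau Q(b\triangleright x)=x_{[-1]}\otimes(b\leftharpoonup x_{[0]})+(b\leftharpoonup x_{[0]})\otimes x_{[-1]}+(b_1\leftharpoonup x)\otimes b_2+b_2\otimes(b_1\leftharpoonup x)+x_{\{1\}}\otimes bx_{\{2\}}+bx_{\{2\}}\otimes x_{\{1\}}+\sigma(b_{(-1)},x)\otimes b_{(0)}+b_{(0)}\otimes\sigma(b_{(-1)},x)$; (CDM20) $\Delta_A(y\rightharpoonup a)+Q(y\triangleleft a)+\tau\Delta_A(y\rightharpoonup a)+\tau Q(y\triangleleft a)=a_1\otimes(y\rightharpoonup a_2)+(y\rightharpoonup a_2)\otimes a_1+(y_{[0]}\rightharpoonup a)\otimes y_{[1]}+y_{[1]}\otimes(y_{[0]}\rightharpoonup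 a)+a_{(0)}\otimes\sigma(y,a_{(1)})+\sigma(y,a_{(1)})\otimes a_{(0)}+y_{\{1\}}a\otimes y_{\{2\}}+y_{\{2\}}\otimes y_{\{1\}}a$; (CDM21) $\Delta_H(y\triangleleft a)+P(y\rightharpoonup a)+\tau\Delta_H(y\triangleleft a)+\tau P(y\rightharpoonup a)=a_{(-1)}\otimes(y\triangleleft a_{(0)})+(y\triangleleft a_{(0)})\otimes a_{(-1)}+(y_1\triangleleft a)\otimes y_2+y_2\otimes(y_1\triangleleft a)+a_{<1>}\otimes ya_{<2>}+ya_{<2>}\otimes a_{<1>}+\theta(y_{[-1]},a)\otimes y_{[0]}+y_{[0]}\otimes\theta(y_{[-1]},a)$; (CDM22) $\Delta_H(b\triangleright x)+P(b\leftharpoonup x)+\tau\Delta_H(b\triangleright x)+\tau P(b\leftharpoonup x)=x_1\otimes(b\triangleright x_2)+(b\triangleright x_2)\otimes x_1+(b_{(0)}\triangleright x)\otimes b_{(1)}+b_{(1)}\otimes(b_{(0)}\triangleright x)+x_{[0]}\otimes\theta(b,x_{[1]})+\theta(b,x_{[1]})\otimes x_{[0]}+b_{<1>}x\otimes b_{<2>}+b_{<2>}\otimes b_{<1>}x$; (CDM23) $\phi(y\rightharpoonup a)+\tau\psi(y\rightharpoonup a)+\gamma(y\triangleleft a)+\tau\rho(y\triangleleft a)=a_{(-1)}\otimes(y\rightharpoonup a_{(0)})+(y\triangleleft a_2)\otimes a_1+ya_{(1)}\otimes a_{(0)}+(y_{[0]}\triangleleft a)\otimes y_{[1]}+y_2\otimes(y_1\rightharpoonup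 a)+y_{[0]}\otimes y_{[-1]}a+a_{<1>}\otimes\sigma(y,a_{<2>})+\theta(y_{\{1\}},a)\otimes y_{\{2\}}$; (CDM24) $\phi(b\leftharpoonup x)+\tau\psi(b\leftharpoonup x)+\gamma(b\triangleright x)+\tau\rho(b\triangleright x)=x_1\otimes(b\leftharpoonup x_2)+x_{[0]}\otimes bx_{[1]}+(b\triangleright x_{[0]})\otimes x_{[-1]}+(b_1\triangleright x)\otimes b_2+b_{(-1)}x\otimes b_{(0)}+b_{(1)}\otimes(b_{(0)}\leftharpoonup x)+\theta(b,x_{\{2\}})\otimes x_{\{1\}}+b_{<2>}\otimes\sigma(b_{<1>},x)$; (CDM25) $\psi(y\rightharpoonup a)+\tau\phi(y\rightharpoonup a)+\rho(y\triangleleft a)+\tau\gamma(y\triangleleft a)=a_1\otimes(y\triangleleft a_2)+a_{(0)}\otimes ya_{(1)}+(y\rightharpoonup a_{(0)})\otimes a_{(-1)}+(y_1\rightharpoonup a)\otimes y_2+y_{[-1]}a\otimes y_{[0]}+y_{[1]}\otimes(y_{[0]}\triangleleft a)+\sigma(y,a_{<2>})\otimes a_{<1>}+y_{\{2\}}\otimes\theta(y_{\{1\}},a)$; (CDM26) $\psi(b\leftharpoonup x)+\tau\phi(b\leftharpoonup x)+\rho(b\triangleright x)+\tau\gamma(b\triangleright x)=x_{[-1]}\otimes(b\triangleright x_{[0]})+(b\leftharpoonup x_2)\otimes x_1+bx_{[1]}\otimes x_{[0]}+(b_{(0)}\leftharpoonup x)\otimes b_{(1)}+b_2\otimes(b_1\triangleright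 x)+b_{(0)}\otimes b_{(-1)}x+x_{\{1\}}\otimes\theta(b,x_{\{2\}})+\sigma(b_{<1>},x)\otimes b_{<2>}$; (CDM27) $\Delta_A(\sigma(y,x))+Q(yx)+\tau\Delta_A(\sigma(y,x))+\tau Q(yx)=x_{[-1]}\otimes\sigma(y,x_{[0]})+\sigma(y,x_{[0]})\otimes x_{[-1]}+x_{\{1\}}\otimes(y\rightharpoonup x_{\{2\}})+(y\rightharpoonup x_{\{2\}})\otimes x_{\{1\}}+\sigma(y_{[0]},x)\otimes y_{[1]}+y_{[1]}\otimes\sigma(y_{[0]},x)+(y_{\{1\}}\leftharpoonup x)\otimes y_{\{2\}}+y_{\{2\}}\otimes(y_{\{1\}}\leftharpoonup x)$; (CDM28) $P(ba)+\Delta_H(\theta(b,a))+\tau P(ba)+\tau\Delta_H(\theta(b,a))=a_{(-1)}\otimes\theta(b,a_{(0)})+\theta(b,a_{(0)})\otimes a_{(-1)}+a_{<1>}\otimes(b\triangleright a_{<2>})+(b\triangleright a_{<2>})\otimes a_{<1>}+\theta(b_{(0)},a)\otimes b_{(1)}+b_{(1)}\otimes\theta(b_{(0)},a)+(b_{<1>}\triangleleft a)\otimes b_{<2>}+b_{<2>}\otimes(b_{<1>}\triangleleft a)$. *)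

theory Defs
  imports "HOL.Vector_Spaces" "HOL-Library.Function_Algebras" "HOL-Library.Product_Plus"
begin

text \<open>
  Vector spaces are whole types carrying an explicit scalar multiplication
  \<open>s :: 'k \<Rightarrow> 'v \<Rightarrow> 'v\<close> over a common field \<open>'k\<close>, in the sense of the locale \<open>vector_space\<close>.
\<close>

section \<open>Tensor products\<close>

text \<open>
  The tensor product of \<open>V\<close> and \<open>W\<close> is realised as the space of functionals on bilinear forms
  \<open>V \<times> W \<rightarrow> k\<close> spanned by the evaluations \<open>B \<mapsto> B u v\<close>. The values at functions that are not bilinear
  are set to 0, so that equality of tensors is plain equality. The universal property is proved in
  \<open>tensor_universal\<close> below. Addition of tensors is the pointwise one.
\<close>

definition bilinear_map ::
  "('k::field \<Rightarrow> 'a::ab_group_add \<Rightarrow> 'a) \<Rightarrow> ('k \<Rightarrow> 'b::ab_group_add \<Rightarrow> 'b) \<Rightarrow>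
   ('k \<Rightarrow> 'c::ab_group_add \<Rightarrow> 'c) \<Rightarrow> ('a \<Rightarrow> 'b \<Rightarrow> 'c) \<Rightarrow> bool" where
  "bilinear_map sa sb sc f \<longleftrightarrow>
     (\<forall>v. Vector_Spaces.linear sa sc (\<lambda>u. f u v)) \<and>
     (\<forall>u. Vector_Spaces.linear sb sc (\<lambda>v. f u v))"

definition trilinear_map ::
  "('k::field \<Rightarrow> 'a::ab_group_add \<Rightarrow> 'a) \<Rightarrow> ('k \<Rightarrow> 'b::ab_group_add \<Rightarrow> 'b) \<Rightarrow>
   ('k \<Rightarrow> 'c::ab_group_add \<Rightarrow> 'c) \<Rightarrow> ('k \<Rightarrow> 'd::ab_group_add \<Rightarrow> 'd) \<Rightarrow> ('a \<Rightarrow> 'b \<Rightarrow> 'c \<Rightarrow> 'd) \<Rightarrow> bool" where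
  "trilinear_map sa sb sc sd f \<longleftrightarrow>
     (\<forall>v w. Vector_Spaces.linear sa sd (\<lambda>u. f u v w)) \<and>
     (\<forall>u w. Vector_Spaces.linear sb sd (\<lambda>v. f u v w)) \<and>
     (\<forall>u v. Vector_Spaces.linear sc sd (\<lambda>w. f u v w))"

type_synonym ('k, 'a, 'b) tensor = "('a \<Rightarrow> 'b \<Rightarrow> 'k) \<Rightarrow> 'k"
type_synonym ('k, 'a, 'b, 'c) tensor3 = "('a \<Rightarrow> 'b \<Rightarrow> 'c \<Rightarrow> 'k) \<Rightarrow> 'k"

definition tscale :: "'k::field \<Rightarrow> ('x \<Rightarrow> 'k) \<Rightarrow> ('x \<Rightarrow> 'k)" where
  "tscale c t = (\<lambda>B. c * t B)"

definition ten ::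
  "('k::field \<Rightarrow> 'a::ab_group_add \<Rightarrow> 'a) \<Rightarrow> ('k \<Rightarrow> 'b::ab_group_add \<Rightarrow> 'b) \<Rightarrow>
   'a \<Rightarrow> 'b \<Rightarrow> ('k, 'a, 'b) tensor" where
  "ten sa sb u v = (\<lambda>B. if bilinear_map sa sb (*) B then B u v else 0)"

definition ten3 ::
  "('k::field \<Rightarrow> 'a::ab_group_add \<Rightarrow> 'a) \<Rightarrow> ('k \<Rightarrow> 'b::ab_group_add \<Rightarrow> 'b) \<Rightarrow>
   ('k \<Rightarrow> 'c::ab_group_add \<Rightarrow> 'c) \<Rightarrow> 'a \<Rightarrow> 'b \<Rightarrow> 'c \<Rightarrow> ('k, 'a, 'b, 'c) tensor3" where
  "ten3 sa sb sc u v w = (\<lambda>C. if trilinear_map sa sb sc (*) C then C u v w else 0)"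

definition tensor_space ::
  "('k::field \<Rightarrow> 'a::ab_group_add \<Rightarrow> 'a) \<Rightarrow> ('k \<Rightarrow> 'b::ab_group_add \<Rightarrow> 'b) \<Rightarrow>
   ('k, 'a, 'b) tensor set" where
  "tensor_space sa sb = module.span tscale (range (\<lambda>(u, v). ten sa sb u v))"

definition tensor3_space ::
  "('k::field \<Rightarrow> 'a::ab_group_add \<Rightarrow> 'a) \<Rightarrow> ('k \<Rightarrow> 'b::ab_group_add \<Rightarrow> 'b) \<Rightarrow>
   ('k \<Rightarrow> 'c::ab_group_add \<Rightarrow> 'c) \<Rightarrow> ('k, 'a, 'b, 'c) tensor3 set" where
  "tensor3_space sa sb sc = module.span tscale (range (\<lambda>(u, v, w). ten3 sa sb sc u v w))"

definition linear_to_tensor ::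
  "('k::field \<Rightarrow> 'v::ab_group_add \<Rightarrow> 'v) \<Rightarrow> ('k \<Rightarrow> 'a::ab_group_add \<Rightarrow> 'a) \<Rightarrow>
   ('k \<Rightarrow> 'b::ab_group_add \<Rightarrow> 'b) \<Rightarrow> ('v \<Rightarrow> ('k, 'a, 'b) tensor) \<Rightarrow> bool" where
  "linear_to_tensor s sa sb f \<longleftrightarrow>
     Vector_Spaces.linear s tscale f \<and> (\<forall>v. f v \<in> tensor_space sa sb)"

text \<open>
  Sweedler notation: for a tensor \<open>t = \<Sum> t\<^sub>1 \<otimes> t\<^sub>2\<close> and \<open>F\<close> bilinear with values in tensors,
  \<open>t \<bind> (\<lambda>t1 t2. F t1 t2)\<close> is \<open>\<Sum> F t\<^sub>1 t\<^sub>2\<close>, i.e. the value at \<open>t\<close> of the linear map induced by \<open>F\<close>;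
  see \<open>sweedler_ten\<close> and \<open>linear_sweedler\<close>.
\<close>

definition sweedler :: "('k, 'a, 'b) tensor \<Rightarrow> ('a \<Rightarrow> 'b \<Rightarrow> ('x \<Rightarrow> 'k)) \<Rightarrow> ('x \<Rightarrow> 'k)"
    (infixl "\<bind>" 70) where
  "t \<bind> F = (\<lambda>B. t (\<lambda>u v. F u v B))"

definition tflip :: "('k, 'a, 'b) tensor \<Rightarrow> ('k, 'b, 'a) tensor" ("\<tau>") where
  "\<tau> t = (\<lambda>B. t (\<lambda>u v. B v u))"

definition tflip12 :: "('k, 'a, 'b, 'c) tensor3 \<Rightarrow> ('k, 'b, 'a, 'c) tensor3" ("\<tau>\<^sub>1\<^sub>2") where
  "\<tau>\<^sub>1\<^sub>2 t = (\<lambda>C. t (\<lambda>u v w. C v u w))"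

definition tflip23 :: "('k, 'a, 'b, 'c) tensor3 \<Rightarrow> ('k, 'a, 'c, 'b) tensor3" ("\<tau>\<^sub>2\<^sub>3") where
  "\<tau>\<^sub>2\<^sub>3 t = (\<lambda>C. t (\<lambda>u v w. C u w v))"

lemma vector_space_tscale: "vector_space (tscale :: 'k::field \<Rightarrow> ('x \<Rightarrow> 'k) \<Rightarrow> _)"
  by standard (auto simp: tscale_def fun_eq_iff algebra_simps)

lemma vector_space_field: "vector_space ((*) :: 'k::field \<Rightarrow> 'k \<Rightarrow> 'k)"
  by standard (auto simp: algebra_simps)

lemma linear_eval: "Vector_Spaces.linear tscale (*) (\<lambda>t :: 'x \<Rightarrow> 'k::field. t B)"
  by (auto simp: Vector_Spaces.linear_iff vector_space_tscale vector_space_field tscale_def)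

lemma separate_points:
  fixes s :: "'k::field \<Rightarrow> 'v::ab_group_add \<Rightarrow> 'v"
  assumes "vector_space s" and "\<And>l. Vector_Spaces.linear s (*) l \<Longrightarrow> l u = l v"
  shows "u = v"
proof (rule ccontr)
  assume "u \<noteq> v"
  interpret vector_space_pair s "(*) :: 'k \<Rightarrow> 'k \<Rightarrow> 'k"
    using assms(1) vector_space_field by (simp add: vector_space_pair_def)
  have "vs1.independent {u - v}"
    using \<open>u \<noteq> v\<close> by (simp add: vs1.dependent_single)
  from linear_independent_extend[OF this, of "\<lambda>_. 1"]
  obtain l where l: "Vector_Spaces.linear s (*) l" "l (u - v) = 1" by auto
  have "l (u - v) = l u - l v" using l(1) by (rule linear_diff)
  with l assms(2)[OF l(1)] show False by simp
qed

lemma evaluation_span_universal: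
  fixes e :: "'i \<Rightarrow> 'x \<Rightarrow> 'k::field" and s :: "'k \<Rightarrow> 'v::ab_group_add \<Rightarrow> 'v"
  assumes s: "vector_space s"
    and B: "\<And>l. Vector_Spaces.linear s (*) l \<Longrightarrow> \<exists>B. \<forall>i. e i B = l (f i)"
  shows "\<exists>g. Vector_Spaces.linear tscale s g \<and> (\<forall>i. g (e i) = f i)"
proof -
  interpret vector_space_pair "tscale :: 'k \<Rightarrow> ('x \<Rightarrow> 'k) \<Rightarrow> _" s
    using s vector_space_tscale by (simp add: vector_space_pair_def)
  obtain X where X: "X \<subseteq> range e" "vs1.independent X" "range e \<subseteq> vs1.span X"
    using vs1.maximal_independent_subset by metis
  from linear_independent_extend[OF X(2), of "\<lambda>t. f (SOME i. e i = t)"]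
  obtain g where g: "Vector_Spaces.linear tscale s g" "\<forall>t\<in>X. g t = f (SOME i. e i = t)" by auto
  have "g (e i) = f i" for i
  proof (rule separate_points[OF s])
    fix l assume l: "Vector_Spaces.linear s (*) l"
    obtain B where B: "\<And>i. e i B = l (f i)" using assms(2)[OF l] by auto
    interpret ev: vector_space_pair "tscale :: 'k \<Rightarrow> ('x \<Rightarrow> 'k) \<Rightarrow> _" "(*) :: 'k \<Rightarrow> 'k \<Rightarrow> 'k"
      using vector_space_field vector_space_tscale by (simp add: vector_space_pair_def)
    have lg: "Vector_Spaces.linear tscale (*) (\<lambda>t. l (g t))"
      using Vector_Spaces.linear_compose[OF g(1) l] by (simp add: o_def)
    have "l (g t) = t B" if t: "t \<in> X" for t
    proof -
      have "e (SOME i. e i = t) = t" using X(1) t by (metis (mono_tags, lifting) imageE someI subsetD)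
      then show ?thesis using g(2) t B by metis
    qed
    then have "l (g (e i)) = e i B"
      using ev.linear_eq_on_span[OF lg linear_eval] X(3) by blast
    then show "l (g (e i)) = l (f i)" using B by simp
  qed
  with g show ?thesis by blast
qed

lemma linear_compose_functional:
  assumes "Vector_Spaces.linear s1 s2 f" and "Vector_Spaces.linear s2 (*) l"
  shows "Vector_Spaces.linear s1 (*) (\<lambda>u. l (f u))"
  using Vector_Spaces.linear_compose[OF assms] by (simp add: o_def)

theorem tensor_universal:
  fixes sa :: "'k::field \<Rightarrow> 'a::ab_group_add \<Rightarrow> 'a" and sb :: "'k \<Rightarrow> 'b::ab_group_add \<Rightarrow> 'b"
    and sc :: "'k \<Rightarrow> 'c::ab_group_add \<Rightarrow> 'c"
  assumes "vector_space sc" and "bilinear_map sa sb sc f"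
  shows "\<exists>g. Vector_Spaces.linear tscale sc g \<and> (\<forall>u v. g (ten sa sb u v) = f u v)"
    and "\<lbrakk>Vector_Spaces.linear tscale sc g; Vector_Spaces.linear tscale sc h;
          \<And>u v. g (ten sa sb u v) = f u v; \<And>u v. h (ten sa sb u v) = f u v;
          t \<in> tensor_space sa sb\<rbrakk> \<Longrightarrow> g t = h t"
proof -
  have "\<exists>g. Vector_Spaces.linear tscale sc g \<and> (\<forall>i. g (case i of (u, v) \<Rightarrow> ten sa sb u v) = (case i of (u, v) \<Rightarrow> f u v))"
  proof (rule evaluation_span_universal[OF assms(1)])
    fix l assume "Vector_Spaces.linear sc (*) l"
    then have "bilinear_map sa sb (*) (\<lambda>u v. l (f u v))"
      using assms(2) by (auto simp: bilinear_map_def intro: linear_compose_functional)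
    then show "\<exists>B. \<forall>i. (case i of (u, v) \<Rightarrow> ten sa sb u v) B = l (case i of (u, v) \<Rightarrow> f u v)"
      by (intro exI[of _ "\<lambda>u v. l (f u v)"]) (auto simp: ten_def)
  qed
  then show "\<exists>g. Vector_Spaces.linear tscale sc g \<and> (\<forall>u v. g (ten sa sb u v) = f u v)" by auto
next
  assume g: "Vector_Spaces.linear tscale sc g" "\<And>u v. g (ten sa sb u v) = f u v"
    and h: "Vector_Spaces.linear tscale sc h" "\<And>u v. h (ten sa sb u v) = f u v"
    and t: "t \<in> tensor_space sa sb"
  interpret vector_space_pair "tscale :: 'k \<Rightarrow> (('a \<Rightarrow> 'b \<Rightarrow> 'k) \<Rightarrow> 'k) \<Rightarrow> _" sc
    using assms(1) vector_space_tscale by (simp add: vector_space_pair_def)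
  show "g t = h t"
    by (rule linear_eq_on_span[OF g(1) h(1) _ t[unfolded tensor_space_def]]) (auto simp: g h)
qed

theorem tensor3_universal:
  fixes sa :: "'k::field \<Rightarrow> 'a::ab_group_add \<Rightarrow> 'a" and sb :: "'k \<Rightarrow> 'b::ab_group_add \<Rightarrow> 'b"
    and sc :: "'k \<Rightarrow> 'c::ab_group_add \<Rightarrow> 'c" and sd :: "'k \<Rightarrow> 'd::ab_group_add \<Rightarrow> 'd"
  assumes "vector_space sd" and "trilinear_map sa sb sc sd f"
  shows "\<exists>g. Vector_Spaces.linear tscale sd g \<and> (\<forall>u v w. g (ten3 sa sb sc u v w) = f u v w)"
    and "\<lbrakk>Vector_Spaces.linear tscale sd g; Vector_Spaces.linear tscale sd h;
          \<And>u v w. g (ten3 sa sb sc u v w) = f u v w; \<And>u v w. h (ten3 sa sb sc u v w) = f u v w;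
          t \<in> tensor3_space sa sb sc\<rbrakk> \<Longrightarrow> g t = h t"
proof -
  have "\<exists>g. Vector_Spaces.linear tscale sd g \<and>
      (\<forall>i. g (case i of (u, v, w) \<Rightarrow> ten3 sa sb sc u v w) = (case i of (u, v, w) \<Rightarrow> f u v w))"
  proof (rule evaluation_span_universal[OF assms(1)])
    fix l assume "Vector_Spaces.linear sd (*) l"
    then have "trilinear_map sa sb sc (*) (\<lambda>u v w. l (f u v w))"
      using assms(2) by (auto simp: trilinear_map_def intro!: linear_compose_functional[of _ sd _ l])
    then show "\<exists>B. \<forall>i. (case i of (u, v, w) \<Rightarrow> ten3 sa sb sc u v w) B = l (case i of (u, v, w) \<Rightarrow> f u v w)"
      by (intro exI[of _ "\<lambda>u v w. l (f u v w)"]) (auto simp: ten3_def)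
  qed
  then show "\<exists>g. Vector_Spaces.linear tscale sd g \<and> (\<forall>u v w. g (ten3 sa sb sc u v w) = f u v w)" by auto
next
  assume g: "Vector_Spaces.linear tscale sd g" "\<And>u v w. g (ten3 sa sb sc u v w) = f u v w"
    and h: "Vector_Spaces.linear tscale sd h" "\<And>u v w. h (ten3 sa sb sc u v w) = f u v w"
    and t: "t \<in> tensor3_space sa sb sc"
  interpret vector_space_pair "tscale :: 'k \<Rightarrow> (('a \<Rightarrow> 'b \<Rightarrow> 'c \<Rightarrow> 'k) \<Rightarrow> 'k) \<Rightarrow> _" sd
    using assms(1) vector_space_tscale by (simp add: vector_space_pair_def)
  show "g t = h t"
    by (rule linear_eq_on_span[OF g(1) h(1) _ t[unfolded tensor3_space_def]]) (auto simp: g h)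
qed

lemma linear_sweedler: "Vector_Spaces.linear tscale tscale (\<lambda>t :: ('k::field, 'a, 'b) tensor. t \<bind> F)"
  by (auto simp: Vector_Spaces.linear_iff vector_space_tscale tscale_def sweedler_def fun_eq_iff)

lemma linear_apply:
  assumes "Vector_Spaces.linear s tscale f"
  shows "Vector_Spaces.linear s (*) (\<lambda>u. f u B)"
  using linear_compose_functional[OF assms linear_eval] .

lemma sweedler_ten:
  assumes "bilinear_map sa sb tscale F"
  shows "ten sa sb u v \<bind> F = F u v"
proof
  fix B
  have "Vector_Spaces.linear sa (*) (\<lambda>u. F u v B)" "Vector_Spaces.linear sb (*) (\<lambda>v. F u v B)" for u v
    using assms linear_apply[of sa "\<lambda>u. F u v"] linear_apply[of sb "F u"]
    by (auto simp: bilinear_map_def)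
  then show "(ten sa sb u v \<bind> F) B = F u v B"
    by (auto simp: sweedler_def ten_def bilinear_map_def)
qed

lemma tflip_ten: "\<tau> (ten sa sb u v) = ten sb sa v u"
  by (auto simp: tflip_def ten_def bilinear_map_def fun_eq_iff)

lemma tflip12_ten3: "\<tau>\<^sub>1\<^sub>2 (ten3 sa sb sc u v w) = ten3 sb sa sc v u w"
  by (auto simp: tflip12_def ten3_def trilinear_map_def fun_eq_iff)

lemma tflip23_ten3: "\<tau>\<^sub>2\<^sub>3 (ten3 sa sb sc u v w) = ten3 sa sc sb u w v"
  by (auto simp: tflip23_def ten3_def trilinear_map_def fun_eq_iff)


section \<open>Alternative algebras, coalgebras and bialgebras\<close>

definition alternative_algebra ::
  "('k::field \<Rightarrow> 'v::ab_group_add \<Rightarrow> 'v) \<Rightarrow> ('v \<Rightarrow> 'v \<Rightarrow> 'v) \<Rightarrow> bool" where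
  "alternative_algebra s m \<longleftrightarrow>
     vector_space s \<and> bilinear_map s s s m \<and>
     (\<forall>a b c. m (m a b) c - m a (m b c) + m (m b a) c - m b (m a c) = 0) \<and>
     (\<forall>a b c. m (m a b) c - m a (m b c) + m (m a c) b - m a (m c b) = 0)"

definition coassociator ::
  "('k::field \<Rightarrow> 'v::ab_group_add \<Rightarrow> 'v) \<Rightarrow> ('v \<Rightarrow> ('k, 'v, 'v) tensor) \<Rightarrow>
   'v \<Rightarrow> ('k, 'v, 'v, 'v) tensor3" where
  "coassociator s \<Delta> a =
     (\<Delta> a \<bind> (\<lambda>a1 a2. \<Delta> a1 \<bind> (\<lambda>u v. ten3 s s s u v a2)))
   - (\<Delta> a \<bind> (\<lambda>a1 a2. \<Delta> a2 \<bind> (\<lambda>u v. ten3 s s s a1 u v)))"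

definition alternative_coalgebra ::
  "('k::field \<Rightarrow> 'v::ab_group_add \<Rightarrow> 'v) \<Rightarrow> ('v \<Rightarrow> ('k, 'v, 'v) tensor) \<Rightarrow> bool" where
  "alternative_coalgebra s \<Delta> \<longleftrightarrow>
     vector_space s \<and> linear_to_tensor s s s \<Delta> \<and>
     (\<forall>a. coassociator s \<Delta> a = - \<tau>\<^sub>1\<^sub>2 (coassociator s \<Delta> a)) \<and>
     (\<forall>a. coassociator s \<Delta> a = - \<tau>\<^sub>2\<^sub>3 (coassociator s \<Delta> a))"

definition alternative_bialgebra ::
  "('k::field \<Rightarrow> 'v::ab_group_add \<Rightarrow> 'v) \<Rightarrow> ('v \<Rightarrow> 'v \<Rightarrow> 'v) \<Rightarrow> ('v \<Rightarrow> ('k, 'v, 'v) tensor) \<Rightarrow> bool" where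
  "alternative_bialgebra s m \<Delta> \<longleftrightarrow>
     alternative_algebra s m \<and> alternative_coalgebra s \<Delta> \<and>
     (\<forall>a b. \<Delta> (m a b) =
         (\<Delta> a \<bind> (\<lambda>a1 a2. ten s s (m a1 b) a2))
       + (\<Delta> a \<bind> (\<lambda>a1 a2. ten s s (m a2 b) a1))
       - (\<Delta> a \<bind> (\<lambda>a1 a2. ten s s a2 (m b a1)))
       + (\<Delta> b \<bind> (\<lambda>b1 b2. ten s s b1 (m a b2)))
       + (\<Delta> b \<bind> (\<lambda>b1 b2. ten s s b1 (m b2 a)))
       - (\<Delta> b \<bind> (\<lambda>b1 b2. ten s s (m a b1) b2))) \<and>
     (\<forall>a b. \<Delta> (m b a) + \<tau> (\<Delta> (m b a)) =
         (\<Delta> a \<bind> (\<lambda>a1 a2. ten s s a1 (m b a2)))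
       + (\<Delta> a \<bind> (\<lambda>a1 a2. ten s s (m b a2) a1))
       + (\<Delta> b \<bind> (\<lambda>b1 b2. ten s s (m b1 a) b2))
       + (\<Delta> b \<bind> (\<lambda>b1 b2. ten s s b2 (m b1 a))))"


section \<open>The data\<close>

record ('k, 'a, 'h) cross_data =
  scale_A :: "'k \<Rightarrow> 'a \<Rightarrow> 'a"
  scale_H :: "'k \<Rightarrow> 'h \<Rightarrow> 'h"
  mult_A :: "'a \<Rightarrow> 'a \<Rightarrow> 'a"
  mult_H :: "'h \<Rightarrow> 'h \<Rightarrow> 'h"
  comult_A :: "'a \<Rightarrow> ('k, 'a, 'a) tensor"
  comult_H :: "'h \<Rightarrow> ('k, 'h, 'h) tensor"
  lact_A :: "'h \<Rightarrow> 'a \<Rightarrow> 'a"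
  ract_A :: "'a \<Rightarrow> 'h \<Rightarrow> 'a"
  lact_H :: "'a \<Rightarrow> 'h \<Rightarrow> 'h"
  ract_H :: "'h \<Rightarrow> 'a \<Rightarrow> 'h"
  cocyc_H :: "'h \<Rightarrow> 'h \<Rightarrow> 'a"
  cocyc_A :: "'a \<Rightarrow> 'a \<Rightarrow> 'h"
  lcoact_A :: "'a \<Rightarrow> ('k, 'h, 'a) tensor"
  rcoact_A :: "'a \<Rightarrow> ('k, 'a, 'h) tensor"
  lcoact_H :: "'h \<Rightarrow> ('k, 'a, 'h) tensor"
  rcoact_H :: "'h \<Rightarrow> ('k, 'h, 'a) tensor"
  cyc_A :: "'a \<Rightarrow> ('k, 'h, 'h) tensor"
  cyc_H :: "'h \<Rightarrow> ('k, 'a, 'a) tensor"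

text \<open>
  A linear map out of a tensor product is given by the corresponding curried bilinear map.
\<close>

locale cross_datum =
  fixes D :: "('k::field_char_0, 'a::ab_group_add, 'h::ab_group_add) cross_data"
  assumes vs_A: "vector_space (scale_A D)"
    and vs_H: "vector_space (scale_H D)"
    and bil_mult_A: "bilinear_map (scale_A D) (scale_A D) (scale_A D) (mult_A D)"
    and bil_mult_H: "bilinear_map (scale_H D) (scale_H D) (scale_H D) (mult_H D)"
    and lin_comult_A: "linear_to_tensor (scale_A D) (scale_A D) (scale_A D) (comult_A D)"
    and lin_comult_H: "linear_to_tensor (scale_H D) (scale_H D) (scale_H D) (comult_H D)"
    and bil_lact_A: "bilinear_map (scale_H D) (scale_A D) (scale_A D) (lact_A D)"
    and bil_ract_A: "bilinear_map (scale_A D) (scale_H D) (scale_A D) (ract_A D)"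
    and bil_lact_H: "bilinear_map (scale_A D) (scale_H D) (scale_H D) (lact_H D)"
    and bil_ract_H: "bilinear_map (scale_H D) (scale_A D) (scale_H D) (ract_H D)"
    and bil_cocyc_H: "bilinear_map (scale_H D) (scale_H D) (scale_A D) (cocyc_H D)"
    and bil_cocyc_A: "bilinear_map (scale_A D) (scale_A D) (scale_H D) (cocyc_A D)"
    and lin_lcoact_A: "linear_to_tensor (scale_A D) (scale_H D) (scale_A D) (lcoact_A D)"
    and lin_rcoact_A: "linear_to_tensor (scale_A D) (scale_A D) (scale_H D) (rcoact_A D)"
    and lin_lcoact_H: "linear_to_tensor (scale_H D) (scale_A D) (scale_H D) (lcoact_H D)"
    and lin_rcoact_H: "linear_to_tensor (scale_H D) (scale_H D) (scale_A D) (rcoact_H D)"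
    and lin_cyc_A: "linear_to_tensor (scale_A D) (scale_H D) (scale_H D) (cyc_A D)"
    and lin_cyc_H: "linear_to_tensor (scale_H D) (scale_A D) (scale_A D) (cyc_H D)"
begin

abbreviation "sA \<equiv> scale_A D"
abbreviation "sH \<equiv> scale_H D"
abbreviation mulA (infixl "\<cdot>\<^sub>A" 75) where "a \<cdot>\<^sub>A b \<equiv> mult_A D a b"
abbreviation mulH (infixl "\<cdot>\<^sub>H" 75) where "x \<cdot>\<^sub>H y \<equiv> mult_H D x y"
abbreviation lactA (infixl "\<rightharpoonup>" 73) where "x \<rightharpoonup> b \<equiv> lact_A D x b"
abbreviation ractA (infixl "\<leftharpoonup>" 73) where "a \<leftharpoonup> y \<equiv> ract_A D a y"
abbreviation lactH (infixl "\<triangleright>" 73) where "a \<triangleright> y \<equiv> lact_H D a y"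
abbreviation ractH (infixl "\<triangleleft>" 73) where "x \<triangleleft> b \<equiv> ract_H D x b"
abbreviation "\<sigma> \<equiv> cocyc_H D"
abbreviation "\<theta> \<equiv> cocyc_A D"
abbreviation "\<Delta>\<^sub>A \<equiv> comult_A D"
abbreviation "\<Delta>\<^sub>H \<equiv> comult_H D"
abbreviation "\<phi> \<equiv> lcoact_A D"
abbreviation "\<psi> \<equiv> rcoact_A D"
abbreviation "\<rho> \<equiv> lcoact_H D"
abbreviation "\<gamma> \<equiv> rcoact_H D"
abbreviation "P \<equiv> cyc_A D"
abbreviation "Q \<equiv> cyc_H D"
abbreviation tenAA (infix "\<otimes>\<^sub>A\<^sub>A" 67) where "u \<otimes>\<^sub>A\<^sub>A v \<equiv> ten sA sA u v"
abbreviation tenAH (infix "\<otimes>\<^sub>A\<^sub>H" 67) where "u \<otimes>\<^sub>A\<^sub>H v \<equiv> ten sA sH u v"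
abbreviation tenHA (infix "\<otimes>\<^sub>H\<^sub>A" 67) where "u \<otimes>\<^sub>H\<^sub>A v \<equiv> ten sH sA u v"
abbreviation tenHH (infix "\<otimes>\<^sub>H\<^sub>H" 67) where "u \<otimes>\<^sub>H\<^sub>H v \<equiv> ten sH sH u v"

text \<open>
  Sweedler legs are named by their index, with \<open>m\<close> for \<open>-1\<close> and \<open>p\<close> for \<open>+1\<close> in the coactions:
  \<open>\<phi>(a) = am \<otimes> a0\<close>, \<open>\<psi>(a) = a0 \<otimes> ap\<close>, \<open>\<rho>(x) = xm \<otimes> x0\<close>, \<open>\<gamma>(x) = x0 \<otimes> xp\<close>,
  and \<open>a1 \<otimes> a2\<close> for \<open>\<Delta>\<close>, \<open>P\<close> and \<open>Q\<close>; the map to the left of \<open>\<bind>\<close> tells which is meant.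
\<close>

subsection \<open>Cocycle cross product systems\<close>

definition cocycle_on_H :: bool where
  "cocycle_on_H \<longleftrightarrow>
      (\<forall>x y z.
       (\<sigma> (x \<cdot>\<^sub>H y) z) + ((\<sigma> x y) \<leftharpoonup> z) - (x \<rightharpoonup> (\<sigma> y z)) - (\<sigma> x (y \<cdot>\<^sub>H z))
     = - ((\<sigma> y x) \<leftharpoonup> z) - (\<sigma> (y \<cdot>\<^sub>H x) z) + (y \<rightharpoonup> (\<sigma> x z)) + (\<sigma> y (x \<cdot>\<^sub>H z)))
    \<and> (\<forall>x y z.
       (\<sigma> (x \<cdot>\<^sub>H y) z) + ((\<sigma> x y) \<leftharpoonup> z) - (x \<rightharpoonup> (\<sigma> y z)) - (\<sigma> x (y \<cdot>\<^sub>H z))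
     = - ((\<sigma> x z) \<leftharpoonup> y) - (\<sigma> (x \<cdot>\<^sub>H z) y) + (x \<rightharpoonup> (\<sigma> z y)) + (\<sigma> x (z \<cdot>\<^sub>H y)))"

definition cocycle_on_A :: bool where
  "cocycle_on_A \<longleftrightarrow>
      (\<forall>a b c.
       (\<theta> (a \<cdot>\<^sub>A b) c) + ((\<theta> a b) \<triangleleft> c) - (a \<triangleright> (\<theta> b c)) - (\<theta> a (b \<cdot>\<^sub>A c))
     = - (\<theta> (b \<cdot>\<^sub>A a) c) - ((\<theta> b a) \<triangleleft> c) + (b \<triangleright> (\<theta> a c)) + (\<theta> b (a \<cdot>\<^sub>A c)))
    \<and> (\<forall>a b c.
       (\<theta> (a \<cdot>\<^sub>A b) c) + ((\<theta> a b) \<triangleleft> c) - (a \<triangleright> (\<theta> b c)) - (\<theta> a (b \<cdot>\<^sub>A c))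
     = - (\<theta> (a \<cdot>\<^sub>A c) b) - ((\<theta> a c) \<triangleleft> b) + (a \<triangleright> (\<theta> c b)) + (\<theta> a (c \<cdot>\<^sub>A b)))"

definition cocycle_alternative_algebra_H :: bool where
  "cocycle_alternative_algebra_H \<longleftrightarrow>
      cocycle_on_H
    \<and> (\<forall>x y z.
       ((x \<cdot>\<^sub>H y) \<cdot>\<^sub>H z) + ((\<sigma> x y) \<triangleright> z) - (x \<cdot>\<^sub>H (y \<cdot>\<^sub>H z)) - (x \<triangleleft> (\<sigma> y z))
     = - ((y \<cdot>\<^sub>H x) \<cdot>\<^sub>H z) - ((\<sigma> y x) \<triangleright> z) + (y \<cdot>\<^sub>H (x \<cdot>\<^sub>H z)) + (y \<triangleleft> (\<sigma> x z)))
    \<and> (\<forall>x y z.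
       ((x \<cdot>\<^sub>H y) \<cdot>\<^sub>H z) + ((\<sigma> x y) \<triangleright> z) - (x \<cdot>\<^sub>H (y \<cdot>\<^sub>H z)) - (x \<triangleleft> (\<sigma> y z))
     = - ((x \<cdot>\<^sub>H z) \<cdot>\<^sub>H y) - ((\<sigma> x z) \<triangleright> y) + (x \<cdot>\<^sub>H (z \<cdot>\<^sub>H y)) + (x \<triangleleft> (\<sigma> z y)))"

definition cocycle_alternative_algebra_A :: bool where
  "cocycle_alternative_algebra_A \<longleftrightarrow>
      cocycle_on_A
    \<and> (\<forall>a b c.
       ((a \<cdot>\<^sub>A b) \<cdot>\<^sub>A c) + ((\<theta> a b) \<rightharpoonup> c) - (a \<cdot>\<^sub>A (b \<cdot>\<^sub>A c)) - (a \<leftharpoonup> (\<theta> b c))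
     = - ((b \<cdot>\<^sub>A a) \<cdot>\<^sub>A c) - ((\<theta> b a) \<rightharpoonup> c) + (b \<cdot>\<^sub>A (a \<cdot>\<^sub>A c)) + (b \<leftharpoonup> (\<theta> a c)))
    \<and> (\<forall>a b c.
       ((a \<cdot>\<^sub>A b) \<cdot>\<^sub>A c) + ((\<theta> a b) \<rightharpoonup> c) - (a \<cdot>\<^sub>A (b \<cdot>\<^sub>A c)) - (a \<leftharpoonup> (\<theta> b c))
     = - ((a \<cdot>\<^sub>A c) \<cdot>\<^sub>A b) - ((\<theta> a c) \<rightharpoonup> b) + (a \<cdot>\<^sub>A (c \<cdot>\<^sub>A b)) + (a \<leftharpoonup> (\<theta> c b)))"

definition CP1 :: bool where
  "CP1 \<longleftrightarrow>
      (\<forall>a b x.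
       (((a \<cdot>\<^sub>A b) + (b \<cdot>\<^sub>A a)) \<leftharpoonup> x) + (\<sigma> (\<theta> a b) x) + (\<sigma> (\<theta> b a) x)
     = (a \<cdot>\<^sub>A (b \<leftharpoonup> x)) + (a \<leftharpoonup> (b \<triangleright> x)) + (b \<cdot>\<^sub>A (a \<leftharpoonup> x)) + (b \<leftharpoonup> (a \<triangleright> x)))"

definition CP2 :: bool where
  "CP2 \<longleftrightarrow>
      (\<forall>a b x.
       (x \<rightharpoonup> (a \<cdot>\<^sub>A b)) + (a \<cdot>\<^sub>A (x \<rightharpoonup> b)) + (a \<leftharpoonup> (x \<triangleleft> b)) + (\<sigma> x (\<theta> a b))
     = (((x \<rightharpoonup> a) + (a \<leftharpoonup> x)) \<cdot>\<^sub>A b) + (((x \<triangleleft> a) + (a \<triangleright> x)) \<rightharpoonup> b))"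

definition CP3 :: bool where
  "CP3 \<longleftrightarrow>
      (\<forall>a x y.
       (a \<leftharpoonup> (x \<cdot>\<^sub>H y)) + (a \<cdot>\<^sub>A (\<sigma> x y)) + (x \<rightharpoonup> (a \<leftharpoonup> y)) + (\<sigma> x (a \<triangleright> y))
     = (((a \<leftharpoonup> x) + (x \<rightharpoonup> a)) \<leftharpoonup> y) + (\<sigma> (a \<triangleright> x) y) + (\<sigma> (x \<triangleleft> a) y))"

definition CP4 :: bool where
  "CP4 \<longleftrightarrow>
      (\<forall>a x y.
       (((x \<cdot>\<^sub>H y) + (y \<cdot>\<^sub>H x)) \<rightharpoonup> a) + (((\<sigma> x y) + (\<sigma> y x)) \<cdot>\<^sub>A a)
     = (x \<rightharpoonup> (y \<rightharpoonup> a)) + (\<sigma> x (y \<triangleleft> a)) + (y \<rightharpoonup> (x \<rightharpoonup> a)) + (\<sigma> y (x \<triangleleft> a)))"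

definition CP5 :: bool where
  "CP5 \<longleftrightarrow>
      (\<forall>a b x.
       (((a \<cdot>\<^sub>A b) + (b \<cdot>\<^sub>A a)) \<triangleright> x) + (((\<theta> a b) + (\<theta> b a)) \<cdot>\<^sub>H x)
     = (a \<triangleright> (b \<triangleright> x)) + (\<theta> a (b \<leftharpoonup> x)) + (b \<triangleright> (a \<triangleright> x)) + (\<theta> b (a \<leftharpoonup> x)))"

definition CP6 :: bool where
  "CP6 \<longleftrightarrow>
      (\<forall>a b x.
       (x \<triangleleft> (a \<cdot>\<^sub>A b)) + (a \<triangleright> (x \<triangleleft> b)) + (\<theta> a (x \<rightharpoonup> b)) + (x \<cdot>\<^sub>H (\<theta> a b))
     = (((x \<triangleleft> a) + (a \<triangleright> x)) \<triangleleft> b) + (\<theta> (x \<rightharpoonup> a) b) + (\<theta> (a \<leftharpoonup> x) b))"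

definition CP7 :: bool where
  "CP7 \<longleftrightarrow>
      (\<forall>a x y.
       (a \<triangleright> (x \<cdot>\<^sub>H y)) + (x \<cdot>\<^sub>H (a \<triangleright> y)) + (x \<triangleleft> (a \<leftharpoonup> y)) + (\<theta> a (\<sigma> x y))
     = (((a \<triangleright> x) + (x \<triangleleft> a)) \<cdot>\<^sub>H y) + (((a \<leftharpoonup> x) + (x \<rightharpoonup> a)) \<triangleright> y))"

definition CP8 :: bool where
  "CP8 \<longleftrightarrow>
      (\<forall>a x y.
       (((x \<cdot>\<^sub>H y) + (y \<cdot>\<^sub>H x)) \<triangleleft> a) + (\<theta> (\<sigma> x y) a) + (\<theta> (\<sigma> y x) a)
     = (x \<triangleleft> (y \<rightharpoonup> a)) + (x \<cdot>\<^sub>H (y \<triangleleft> a)) + (y \<triangleleft> (x \<rightharpoonup> a)) + (y \<cdot>\<^sub>H (x \<triangleleft> a)))"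

definition CP9 :: bool where
  "CP9 \<longleftrightarrow>
      (\<forall>a b x.
       (x \<rightharpoonup> ((a \<cdot>\<^sub>A b) + (b \<cdot>\<^sub>A a))) + (\<sigma> x (\<theta> a b)) + (\<sigma> x (\<theta> b a))
     = ((x \<rightharpoonup> a) \<cdot>\<^sub>A b) + ((x \<triangleleft> a) \<rightharpoonup> b) + ((x \<rightharpoonup> b) \<cdot>\<^sub>A a) + ((x \<triangleleft> b) \<rightharpoonup> a))"

definition CP10 :: bool where
  "CP10 \<longleftrightarrow>
      (\<forall>a b x.
       ((a \<cdot>\<^sub>A b) \<leftharpoonup> x) + ((a \<leftharpoonup> x) \<cdot>\<^sub>A b) + ((a \<triangleright> x) \<rightharpoonup> b) + (\<sigma> (\<theta> a b) x)
     = (a \<cdot>\<^sub>A ((b \<leftharpoonup> x) + (x \<rightharpoonup> b))) + (a \<leftharpoonup> ((b \<triangleright> x) + (x \<triangleleft> b))))"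

definition CP11 :: bool where
  "CP11 \<longleftrightarrow>
      (\<forall>a x y.
       ((x \<cdot>\<^sub>H y) \<rightharpoonup> a) + ((x \<rightharpoonup> a) \<leftharpoonup> y) + (\<sigma> (x \<triangleleft> a) y) + ((\<sigma> x y) \<cdot>\<^sub>A a)
     = (x \<rightharpoonup> ((y \<rightharpoonup> a) + (a \<leftharpoonup> y))) + (\<sigma> x (y \<triangleleft> a)) + (\<sigma> x (a \<triangleright> y)))"

definition CP12 :: bool where
  "CP12 \<longleftrightarrow>
      (\<forall>a x y.
       (a \<leftharpoonup> ((x \<cdot>\<^sub>H y) + (y \<cdot>\<^sub>H x))) + (a \<cdot>\<^sub>A ((\<sigma> x y) + (\<sigma> y x)))
     = ((a \<leftharpoonup> x) \<leftharpoonup> y) + (\<sigma> (a \<triangleright> x) y) + ((a \<leftharpoonup> y) \<leftharpoonup> x) + (\<sigma> (a \<triangleright> y) x))"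

definition CP13 :: bool where
  "CP13 \<longleftrightarrow>
      (\<forall>a b x.
       (x \<triangleleft> ((a \<cdot>\<^sub>A b) + (b \<cdot>\<^sub>A a))) + (x \<cdot>\<^sub>H ((\<theta> a b) + (\<theta> b a)))
     = ((x \<triangleleft> a) \<triangleleft> b) + (\<theta> (x \<rightharpoonup> a) b) + ((x \<triangleleft> b) \<triangleleft> a) + (\<theta> (x \<rightharpoonup> b) a))"

definition CP14 :: bool where
  "CP14 \<longleftrightarrow>
      (\<forall>a b x.
       ((a \<cdot>\<^sub>A b) \<triangleright> x) + ((\<theta> a b) \<cdot>\<^sub>H x) + ((a \<triangleright> x) \<triangleleft> b) + (\<theta> (a \<leftharpoonup> x) b)
     = (a \<triangleright> ((b \<triangleright> x) + (x \<triangleleft> b))) + (\<theta> a (b \<leftharpoonup> x)) + (\<theta> a (x \<rightharpoonup> b)))"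

definition CP15 :: bool where
  "CP15 \<longleftrightarrow>
      (\<forall>a x y.
       ((x \<cdot>\<^sub>H y) \<triangleleft> a) + ((x \<triangleleft> a) \<cdot>\<^sub>H y) + ((x \<rightharpoonup> a) \<triangleright> y) + (\<theta> (\<sigma> x y) a)
     = (x \<cdot>\<^sub>H ((y \<triangleleft> a) + (a \<triangleright> y))) + (x \<triangleleft> ((y \<rightharpoonup> a) + (a \<leftharpoonup> y))))"

definition CP16 :: bool where
  "CP16 \<longleftrightarrow>
      (\<forall>a x y.
       (a \<triangleright> ((x \<cdot>\<^sub>H y) + (y \<cdot>\<^sub>H x))) + (\<theta> a (\<sigma> x y)) + (\<theta> a (\<sigma> y x))
     = ((a \<triangleright> x) \<cdot>\<^sub>H y) + ((a \<leftharpoonup> x) \<triangleright> y) + ((a \<triangleright> y) \<cdot>\<^sub>H x) + ((a \<leftharpoonup> y) \<triangleright> x))"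

definition cocycle_cross_product_system :: bool where
  "cocycle_cross_product_system \<longleftrightarrow>
      cocycle_alternative_algebra_A
    \<and> cocycle_alternative_algebra_H
    \<and> CP1
    \<and> CP2
    \<and> CP3
    \<and> CP4
    \<and> CP5
    \<and> CP6
    \<and> CP7
    \<and> CP8
    \<and> CP9
    \<and> CP10
    \<and> CP11
    \<and> CP12
    \<and> CP13
    \<and> CP14
    \<and> CP15
    \<and> CP16"


subsection \<open>Cycle cross coproduct systems\<close>

definition "\<alpha>\<^sub>A\<^sub>A\<^sub>A a =
     (\<Delta>\<^sub>A a \<bind> (\<lambda>a1 a2. \<Delta>\<^sub>A a1 \<bind> (\<lambda>u v. ten3 sA sA sA u v a2)))
   + (\<phi> a \<bind> (\<lambda>am a0. Q am \<bind> (\<lambda>u v. ten3 sA sA sA u v a0)))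
   - (\<Delta>\<^sub>A a \<bind> (\<lambda>a1 a2. \<Delta>\<^sub>A a2 \<bind> (\<lambda>u v. ten3 sA sA sA a1 u v)))
   - (\<psi> a \<bind> (\<lambda>a0 ap. Q ap \<bind> (\<lambda>u v. ten3 sA sA sA a0 u v)))"

definition "\<alpha>\<^sub>H\<^sub>H\<^sub>H a =
     (P a \<bind> (\<lambda>a1 a2. \<Delta>\<^sub>H a1 \<bind> (\<lambda>u v. ten3 sH sH sH u v a2)))
   + (\<psi> a \<bind> (\<lambda>a0 ap. P a0 \<bind> (\<lambda>u v. ten3 sH sH sH u v ap)))
   - (\<phi> a \<bind> (\<lambda>am a0. P a0 \<bind> (\<lambda>u v. ten3 sH sH sH am u v)))
   - (P a \<bind> (\<lambda>a1 a2. \<Delta>\<^sub>H a2 \<bind> (\<lambda>u v. ten3 sH sH sH a1 u v)))"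

definition "\<alpha>\<^sub>H\<^sub>A\<^sub>A a =
     (\<Delta>\<^sub>A a \<bind> (\<lambda>a1 a2. \<phi> a1 \<bind> (\<lambda>u v. ten3 sH sA sA u v a2)))
   + (\<phi> a \<bind> (\<lambda>am a0. \<gamma> am \<bind> (\<lambda>u v. ten3 sH sA sA u v a0)))
   - (\<phi> a \<bind> (\<lambda>am a0. \<Delta>\<^sub>A a0 \<bind> (\<lambda>u v. ten3 sH sA sA am u v)))
   - (P a \<bind> (\<lambda>a1 a2. Q a2 \<bind> (\<lambda>u v. ten3 sH sA sA a1 u v)))"

definition "\<alpha>\<^sub>A\<^sub>H\<^sub>A a =
     (\<Delta>\<^sub>A a \<bind> (\<lambda>a1 a2. \<psi> a1 \<bind> (\<lambda>u v. ten3 sA sH sA u v a2)))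
   + (\<phi> a \<bind> (\<lambda>am a0. \<rho> am \<bind> (\<lambda>u v. ten3 sA sH sA u v a0)))
   - (\<Delta>\<^sub>A a \<bind> (\<lambda>a1 a2. \<phi> a2 \<bind> (\<lambda>u v. ten3 sA sH sA a1 u v)))
   - (\<psi> a \<bind> (\<lambda>a0 ap. \<gamma> ap \<bind> (\<lambda>u v. ten3 sA sH sA a0 u v)))"

definition "\<alpha>\<^sub>A\<^sub>A\<^sub>H a =
     (\<psi> a \<bind> (\<lambda>a0 ap. \<Delta>\<^sub>A a0 \<bind> (\<lambda>u v. ten3 sA sA sH u v ap)))
   + (P a \<bind> (\<lambda>a1 a2. Q a1 \<bind> (\<lambda>u v. ten3 sA sA sH u v a2)))
   - (\<Delta>\<^sub>A a \<bind> (\<lambda>a1 a2. \<psi> a2 \<bind> (\<lambda>u v. ten3 sA sA sH a1 u v)))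
   - (\<psi> a \<bind> (\<lambda>a0 ap. \<rho> ap \<bind> (\<lambda>u v. ten3 sA sA sH a0 u v)))"

definition "\<alpha>\<^sub>H\<^sub>H\<^sub>A a =
     (\<Delta>\<^sub>A a \<bind> (\<lambda>a1 a2. P a1 \<bind> (\<lambda>u v. ten3 sH sH sA u v a2)))
   + (\<phi> a \<bind> (\<lambda>am a0. \<Delta>\<^sub>H am \<bind> (\<lambda>u v. ten3 sH sH sA u v a0)))
   - (\<phi> a \<bind> (\<lambda>am a0. \<phi> a0 \<bind> (\<lambda>u v. ten3 sH sH sA am u v)))
   - (P a \<bind> (\<lambda>a1 a2. \<gamma> a2 \<bind> (\<lambda>u v. ten3 sH sH sA a1 u v)))"

definition "\<alpha>\<^sub>H\<^sub>A\<^sub>H a =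
     (\<psi> a \<bind> (\<lambda>a0 ap. \<phi> a0 \<bind> (\<lambda>u v. ten3 sH sA sH u v ap)))
   + (P a \<bind> (\<lambda>a1 a2. \<gamma> a1 \<bind> (\<lambda>u v. ten3 sH sA sH u v a2)))
   - (\<phi> a \<bind> (\<lambda>am a0. \<psi> a0 \<bind> (\<lambda>u v. ten3 sH sA sH am u v)))
   - (P a \<bind> (\<lambda>a1 a2. \<rho> a2 \<bind> (\<lambda>u v. ten3 sH sA sH a1 u v)))"

definition "\<alpha>\<^sub>A\<^sub>H\<^sub>H a =
     (\<psi> a \<bind> (\<lambda>a0 ap. \<psi> a0 \<bind> (\<lambda>u v. ten3 sA sH sH u v ap)))
   + (P a \<bind> (\<lambda>a1 a2. \<rho> a1 \<bind> (\<lambda>u v. ten3 sA sH sH u v a2)))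
   - (\<Delta>\<^sub>A a \<bind> (\<lambda>a1 a2. P a2 \<bind> (\<lambda>u v. ten3 sA sH sH a1 u v)))
   - (\<psi> a \<bind> (\<lambda>a0 ap. \<Delta>\<^sub>H ap \<bind> (\<lambda>u v. ten3 sA sH sH a0 u v)))"

definition "\<beta>\<^sub>A\<^sub>A\<^sub>A x =
     (Q x \<bind> (\<lambda>x1 x2. \<Delta>\<^sub>A x1 \<bind> (\<lambda>u v. ten3 sA sA sA u v x2)))
   + (\<gamma> x \<bind> (\<lambda>x0 xp. Q x0 \<bind> (\<lambda>u v. ten3 sA sA sA u v xp)))
   - (Q x \<bind> (\<lambda>x1 x2. \<Delta>\<^sub>A x2 \<bind> (\<lambda>u v. ten3 sA sA sA x1 u v)))
   - (\<rho> x \<bind> (\<lambda>xm x0. Q x0 \<bind> (\<lambda>u v. ten3 sA sA sA xm u v)))"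

definition "\<beta>\<^sub>H\<^sub>H\<^sub>H x =
     (\<Delta>\<^sub>H x \<bind> (\<lambda>x1 x2. \<Delta>\<^sub>H x1 \<bind> (\<lambda>u v. ten3 sH sH sH u v x2)))
   + (\<rho> x \<bind> (\<lambda>xm x0. P xm \<bind> (\<lambda>u v. ten3 sH sH sH u v x0)))
   - (\<Delta>\<^sub>H x \<bind> (\<lambda>x1 x2. \<Delta>\<^sub>H x2 \<bind> (\<lambda>u v. ten3 sH sH sH x1 u v)))
   - (\<gamma> x \<bind> (\<lambda>x0 xp. P xp \<bind> (\<lambda>u v. ten3 sH sH sH x0 u v)))"

definition "\<beta>\<^sub>H\<^sub>A\<^sub>A x =
     (\<gamma> x \<bind> (\<lambda>x0 xp. \<gamma> x0 \<bind> (\<lambda>u v. ten3 sH sA sA u v xp)))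
   + (Q x \<bind> (\<lambda>x1 x2. \<phi> x1 \<bind> (\<lambda>u v. ten3 sH sA sA u v x2)))
   - (\<Delta>\<^sub>H x \<bind> (\<lambda>x1 x2. Q x2 \<bind> (\<lambda>u v. ten3 sH sA sA x1 u v)))
   - (\<gamma> x \<bind> (\<lambda>x0 xp. \<Delta>\<^sub>A xp \<bind> (\<lambda>u v. ten3 sH sA sA x0 u v)))"

definition "\<beta>\<^sub>A\<^sub>H\<^sub>A x =
     (\<gamma> x \<bind> (\<lambda>x0 xp. \<rho> x0 \<bind> (\<lambda>u v. ten3 sA sH sA u v xp)))
   + (Q x \<bind> (\<lambda>x1 x2. \<psi> x1 \<bind> (\<lambda>u v. ten3 sA sH sA u v x2)))
   - (\<rho> x \<bind> (\<lambda>xm x0. \<gamma> x0 \<bind> (\<lambda>u v. ten3 sA sH sA xm u v)))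
   - (Q x \<bind> (\<lambda>x1 x2. \<phi> x2 \<bind> (\<lambda>u v. ten3 sA sH sA x1 u v)))"

definition "\<beta>\<^sub>A\<^sub>A\<^sub>H x =
     (\<Delta>\<^sub>H x \<bind> (\<lambda>x1 x2. Q x1 \<bind> (\<lambda>u v. ten3 sA sA sH u v x2)))
   + (\<rho> x \<bind> (\<lambda>xm x0. \<Delta>\<^sub>A xm \<bind> (\<lambda>u v. ten3 sA sA sH u v x0)))
   - (\<rho> x \<bind> (\<lambda>xm x0. \<rho> x0 \<bind> (\<lambda>u v. ten3 sA sA sH xm u v)))
   - (Q x \<bind> (\<lambda>x1 x2. \<psi> x2 \<bind> (\<lambda>u v. ten3 sA sA sH x1 u v)))"

definition "\<beta>\<^sub>H\<^sub>H\<^sub>A x =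
     (\<gamma> x \<bind> (\<lambda>x0 xp. \<Delta>\<^sub>H x0 \<bind> (\<lambda>u v. ten3 sH sH sA u v xp)))
   + (Q x \<bind> (\<lambda>x1 x2. P x1 \<bind> (\<lambda>u v. ten3 sH sH sA u v x2)))
   - (\<Delta>\<^sub>H x \<bind> (\<lambda>x1 x2. \<gamma> x2 \<bind> (\<lambda>u v. ten3 sH sH sA x1 u v)))
   - (\<gamma> x \<bind> (\<lambda>x0 xp. \<phi> xp \<bind> (\<lambda>u v. ten3 sH sH sA x0 u v)))"

definition "\<beta>\<^sub>H\<^sub>A\<^sub>H x =
     (\<Delta>\<^sub>H x \<bind> (\<lambda>x1 x2. \<gamma> x1 \<bind> (\<lambda>u v. ten3 sH sA sH u v x2)))
   + (\<rho> x \<bind> (\<lambda>xm x0. \<phi> xm \<bind> (\<lambda>u v. ten3 sH sA sH u v x0)))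
   - (\<Delta>\<^sub>H x \<bind> (\<lambda>x1 x2. \<rho> x2 \<bind> (\<lambda>u v. ten3 sH sA sH x1 u v)))
   - (\<gamma> x \<bind> (\<lambda>x0 xp. \<psi> xp \<bind> (\<lambda>u v. ten3 sH sA sH x0 u v)))"

definition "\<beta>\<^sub>A\<^sub>H\<^sub>H x =
     (\<Delta>\<^sub>H x \<bind> (\<lambda>x1 x2. \<rho> x1 \<bind> (\<lambda>u v. ten3 sA sH sH u v x2)))
   + (\<rho> x \<bind> (\<lambda>xm x0. \<psi> xm \<bind> (\<lambda>u v. ten3 sA sH sH u v x0)))
   - (\<rho> x \<bind> (\<lambda>xm x0. \<Delta>\<^sub>H x0 \<bind> (\<lambda>u v. ten3 sA sH sH xm u v)))
   - (Q x \<bind> (\<lambda>x1 x2. P x2 \<bind> (\<lambda>u v. ten3 sA sH sH x1 u v)))"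

definition cycle_on_A :: bool where
  "cycle_on_A \<longleftrightarrow>
      (\<forall>a. \<alpha>\<^sub>H\<^sub>H\<^sub>H a = - \<tau>\<^sub>1\<^sub>2 (\<alpha>\<^sub>H\<^sub>H\<^sub>H a))
    \<and> (\<forall>a. \<alpha>\<^sub>H\<^sub>H\<^sub>H a = - \<tau>\<^sub>2\<^sub>3 (\<alpha>\<^sub>H\<^sub>H\<^sub>H a))"

definition cycle_on_H :: bool where
  "cycle_on_H \<longleftrightarrow>
      (\<forall>x. \<beta>\<^sub>A\<^sub>A\<^sub>A x = - \<tau>\<^sub>1\<^sub>2 (\<beta>\<^sub>A\<^sub>A\<^sub>A x))
    \<and> (\<forall>x. \<beta>\<^sub>A\<^sub>A\<^sub>A x = - \<tau>\<^sub>2\<^sub>3 (\<beta>\<^sub>A\<^sub>A\<^sub>A x))"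

definition cycle_alternative_coalgebra_H :: bool where
  "cycle_alternative_coalgebra_H \<longleftrightarrow>
      cycle_on_A
    \<and> (\<forall>x. \<beta>\<^sub>H\<^sub>H\<^sub>H x = - \<tau>\<^sub>1\<^sub>2 (\<beta>\<^sub>H\<^sub>H\<^sub>H x))
    \<and> (\<forall>x. \<beta>\<^sub>H\<^sub>H\<^sub>H x = - \<tau>\<^sub>2\<^sub>3 (\<beta>\<^sub>H\<^sub>H\<^sub>H x))"

definition cycle_alternative_coalgebra_A :: bool where
  "cycle_alternative_coalgebra_A \<longleftrightarrow>
      cycle_on_H
    \<and> (\<forall>a. \<alpha>\<^sub>A\<^sub>A\<^sub>A a = - \<tau>\<^sub>1\<^sub>2 (\<alpha>\<^sub>A\<^sub>A\<^sub>A a))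
    \<and> (\<forall>a. \<alpha>\<^sub>A\<^sub>A\<^sub>A a = - \<tau>\<^sub>2\<^sub>3 (\<alpha>\<^sub>A\<^sub>A\<^sub>A a))"

definition cycle_cross_coproduct_system :: bool where
  "cycle_cross_coproduct_system \<longleftrightarrow>
      cycle_alternative_coalgebra_A
    \<and> cycle_alternative_coalgebra_H
    \<and> (\<forall>a. \<alpha>\<^sub>H\<^sub>A\<^sub>A a = - \<tau>\<^sub>1\<^sub>2 (\<alpha>\<^sub>A\<^sub>H\<^sub>A a))
    \<and> (\<forall>a. \<alpha>\<^sub>H\<^sub>H\<^sub>A a = - \<tau>\<^sub>1\<^sub>2 (\<alpha>\<^sub>H\<^sub>H\<^sub>A a))
    \<and> (\<forall>a. \<alpha>\<^sub>A\<^sub>A\<^sub>H a = - \<tau>\<^sub>1\<^sub>2 (\<alpha>\<^sub>A\<^sub>A\<^sub>H a))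
    \<and> (\<forall>a. \<alpha>\<^sub>A\<^sub>H\<^sub>H a = - \<tau>\<^sub>1\<^sub>2 (\<alpha>\<^sub>H\<^sub>A\<^sub>H a))
    \<and> (\<forall>a. \<alpha>\<^sub>H\<^sub>A\<^sub>A a = - \<tau>\<^sub>2\<^sub>3 (\<alpha>\<^sub>H\<^sub>A\<^sub>A a))
    \<and> (\<forall>a. \<alpha>\<^sub>H\<^sub>H\<^sub>A a = - \<tau>\<^sub>2\<^sub>3 (\<alpha>\<^sub>H\<^sub>A\<^sub>H a))
    \<and> (\<forall>a. \<alpha>\<^sub>A\<^sub>A\<^sub>H a = - \<tau>\<^sub>2\<^sub>3 (\<alpha>\<^sub>A\<^sub>H\<^sub>A a))
    \<and> (\<forall>a. \<alpha>\<^sub>A\<^sub>H\<^sub>H a = - \<tau>\<^sub>2\<^sub>3 (\<alpha>\<^sub>A\<^sub>H\<^sub>H a))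
    \<and> (\<forall>x. \<beta>\<^sub>H\<^sub>A\<^sub>A x = - \<tau>\<^sub>1\<^sub>2 (\<beta>\<^sub>A\<^sub>H\<^sub>A x))
    \<and> (\<forall>x. \<beta>\<^sub>H\<^sub>H\<^sub>A x = - \<tau>\<^sub>1\<^sub>2 (\<beta>\<^sub>H\<^sub>H\<^sub>A x))
    \<and> (\<forall>x. \<beta>\<^sub>A\<^sub>A\<^sub>H x = - \<tau>\<^sub>1\<^sub>2 (\<beta>\<^sub>A\<^sub>A\<^sub>H x))
    \<and> (\<forall>x. \<beta>\<^sub>A\<^sub>H\<^sub>H x = - \<tau>\<^sub>1\<^sub>2 (\<beta>\<^sub>H\<^sub>A\<^sub>H x))
    \<and> (\<forall>x. \<beta>\<^sub>H\<^sub>A\<^sub>A x = - \<tau>\<^sub>2\<^sub>3 (\<beta>\<^sub>H\<^sub>A\<^sub>A x))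
    \<and> (\<forall>x. \<beta>\<^sub>H\<^sub>H\<^sub>A x = - \<tau>\<^sub>2\<^sub>3 (\<beta>\<^sub>H\<^sub>A\<^sub>H x))
    \<and> (\<forall>x. \<beta>\<^sub>A\<^sub>A\<^sub>H x = - \<tau>\<^sub>2\<^sub>3 (\<beta>\<^sub>A\<^sub>H\<^sub>A x))
    \<and> (\<forall>x. \<beta>\<^sub>A\<^sub>H\<^sub>H x = - \<tau>\<^sub>2\<^sub>3 (\<beta>\<^sub>A\<^sub>H\<^sub>H x))"


subsection \<open>Cocycle braided alternative bialgebras\<close>

definition CBB1 :: bool where
  "CBB1 \<longleftrightarrow>
      (\<forall>a b.
       \<Delta>\<^sub>A (a \<cdot>\<^sub>A b) + Q (\<theta> a b)
     = (\<Delta>\<^sub>A a \<bind> (\<lambda>a1 a2. (a1 \<cdot>\<^sub>A b) \<otimes>\<^sub>A\<^sub>A a2))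
       + (\<Delta>\<^sub>A a \<bind> (\<lambda>a1 a2. (a2 \<cdot>\<^sub>A b) \<otimes>\<^sub>A\<^sub>A a1))
       - (\<Delta>\<^sub>A a \<bind> (\<lambda>a1 a2. a2 \<otimes>\<^sub>A\<^sub>A (b \<cdot>\<^sub>A a1)))
       + (\<Delta>\<^sub>A b \<bind> (\<lambda>b1 b2. b1 \<otimes>\<^sub>A\<^sub>A (a \<cdot>\<^sub>A b2)))
       + (\<Delta>\<^sub>A b \<bind> (\<lambda>b1 b2. b1 \<otimes>\<^sub>A\<^sub>A (b2 \<cdot>\<^sub>A a)))
       - (\<Delta>\<^sub>A b \<bind> (\<lambda>b1 b2. (a \<cdot>\<^sub>A b1) \<otimes>\<^sub>A\<^sub>A b2))
       + (\<phi> a \<bind> (\<lambda>am a0. (am \<rightharpoonup> b) \<otimes>\<^sub>A\<^sub>A a0))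
       + (\<psi> a \<bind> (\<lambda>a0 ap. (ap \<rightharpoonup> b) \<otimes>\<^sub>A\<^sub>A a0))
       - (\<phi> a \<bind> (\<lambda>am a0. a0 \<otimes>\<^sub>A\<^sub>A (b \<leftharpoonup> am)))
       + (\<psi> b \<bind> (\<lambda>b0 bp. b0 \<otimes>\<^sub>A\<^sub>A (a \<leftharpoonup> bp)))
       + (\<psi> b \<bind> (\<lambda>b0 bp. b0 \<otimes>\<^sub>A\<^sub>A (bp \<rightharpoonup> a)))
       - (\<phi> b \<bind> (\<lambda>bm b0. (a \<leftharpoonup> bm) \<otimes>\<^sub>A\<^sub>A b0)))"

definition CBB2 :: bool where
  "CBB2 \<longleftrightarrow>
      (\<forall>a b.
       \<Delta>\<^sub>A (b \<cdot>\<^sub>A a) + Q (\<theta> b a) + \<tau> (\<Delta>\<^sub>A (b \<cdot>\<^sub>A a)) + \<tau> (Q (\<theta> b a))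
     = (\<Delta>\<^sub>A a \<bind> (\<lambda>a1 a2. a1 \<otimes>\<^sub>A\<^sub>A (b \<cdot>\<^sub>A a2)))
       + (\<Delta>\<^sub>A a \<bind> (\<lambda>a1 a2. (b \<cdot>\<^sub>A a2) \<otimes>\<^sub>A\<^sub>A a1))
       + (\<Delta>\<^sub>A b \<bind> (\<lambda>b1 b2. (b1 \<cdot>\<^sub>A a) \<otimes>\<^sub>A\<^sub>A b2))
       + (\<Delta>\<^sub>A b \<bind> (\<lambda>b1 b2. b2 \<otimes>\<^sub>A\<^sub>A (b1 \<cdot>\<^sub>A a)))
       + (\<psi> a \<bind> (\<lambda>a0 ap. a0 \<otimes>\<^sub>A\<^sub>A (b \<leftharpoonup> ap)))
       + (\<psi> a \<bind> (\<lambda>a0 ap. (b \<leftharpoonup> ap) \<otimes>\<^sub>A\<^sub>A a0))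
       + (\<phi> b \<bind> (\<lambda>bm b0. (bm \<rightharpoonup> a) \<otimes>\<^sub>A\<^sub>A b0))
       + (\<phi> b \<bind> (\<lambda>bm b0. b0 \<otimes>\<^sub>A\<^sub>A (bm \<rightharpoonup> a))))"

definition CBB3 :: bool where
  "CBB3 \<longleftrightarrow>
      (\<forall>x y.
       \<Delta>\<^sub>H (x \<cdot>\<^sub>H y) + P (\<sigma> x y)
     = (\<Delta>\<^sub>H x \<bind> (\<lambda>x1 x2. (x1 \<cdot>\<^sub>H y) \<otimes>\<^sub>H\<^sub>H x2))
       + (\<Delta>\<^sub>H x \<bind> (\<lambda>x1 x2. (x2 \<cdot>\<^sub>H y) \<otimes>\<^sub>H\<^sub>H x1))
       - (\<Delta>\<^sub>H x \<bind> (\<lambda>x1 x2. x2 \<otimes>\<^sub>H\<^sub>H (y \<cdot>\<^sub>H x1)))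
       + (\<Delta>\<^sub>H y \<bind> (\<lambda>y1 y2. y1 \<otimes>\<^sub>H\<^sub>H (x \<cdot>\<^sub>H y2)))
       + (\<Delta>\<^sub>H y \<bind> (\<lambda>y1 y2. y1 \<otimes>\<^sub>H\<^sub>H (y2 \<cdot>\<^sub>H x)))
       - (\<Delta>\<^sub>H y \<bind> (\<lambda>y1 y2. (x \<cdot>\<^sub>H y1) \<otimes>\<^sub>H\<^sub>H y2))
       + (\<rho> x \<bind> (\<lambda>xm x0. (xm \<triangleright> y) \<otimes>\<^sub>H\<^sub>H x0))
       + (\<gamma> x \<bind> (\<lambda>x0 xp. (xp \<triangleright> y) \<otimes>\<^sub>H\<^sub>H x0))
       - (\<rho> x \<bind> (\<lambda>xm x0. x0 \<otimes>\<^sub>H\<^sub>H (y \<triangleleft> xm)))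
       + (\<gamma> y \<bind> (\<lambda>y0 yp. y0 \<otimes>\<^sub>H\<^sub>H (x \<triangleleft> yp)))
       + (\<gamma> y \<bind> (\<lambda>y0 yp. y0 \<otimes>\<^sub>H\<^sub>H (yp \<triangleright> x)))
       - (\<rho> y \<bind> (\<lambda>ym y0. (x \<triangleleft> ym) \<otimes>\<^sub>H\<^sub>H y0)))"

definition CBB4 :: bool where
  "CBB4 \<longleftrightarrow>
      (\<forall>x y.
       \<Delta>\<^sub>H (y \<cdot>\<^sub>H x) + P (\<sigma> y x) + \<tau> (\<Delta>\<^sub>H (y \<cdot>\<^sub>H x)) + \<tau> (P (\<sigma> y x))
     = (\<Delta>\<^sub>H x \<bind> (\<lambda>x1 x2. x1 \<otimes>\<^sub>H\<^sub>H (y \<cdot>\<^sub>H x2)))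
       + (\<Delta>\<^sub>H x \<bind> (\<lambda>x1 x2. (y \<cdot>\<^sub>H x2) \<otimes>\<^sub>H\<^sub>H x1))
       + (\<Delta>\<^sub>H y \<bind> (\<lambda>y1 y2. (y1 \<cdot>\<^sub>H x) \<otimes>\<^sub>H\<^sub>H y2))
       + (\<Delta>\<^sub>H y \<bind> (\<lambda>y1 y2. y2 \<otimes>\<^sub>H\<^sub>H (y1 \<cdot>\<^sub>H x)))
       + (\<gamma> x \<bind> (\<lambda>x0 xp. x0 \<otimes>\<^sub>H\<^sub>H (y \<triangleleft> xp)))
       + (\<gamma> x \<bind> (\<lambda>x0 xp. (y \<triangleleft> xp) \<otimes>\<^sub>H\<^sub>H x0))
       + (\<rho> y \<bind> (\<lambda>ym y0. (ym \<triangleright> x) \<otimes>\<^sub>H\<^sub>H y0))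
       + (\<rho> y \<bind> (\<lambda>ym y0. y0 \<otimes>\<^sub>H\<^sub>H (ym \<triangleright> x))))"

definition cocycle_braided_alternative_bialgebra_A :: bool where
  "cocycle_braided_alternative_bialgebra_A \<longleftrightarrow>
      cocycle_alternative_algebra_A
    \<and> cycle_alternative_coalgebra_A
    \<and> CBB1
    \<and> CBB2"

definition cocycle_braided_alternative_bialgebra_H :: bool where
  "cocycle_braided_alternative_bialgebra_H \<longleftrightarrow>
      cocycle_alternative_algebra_H
    \<and> cycle_alternative_coalgebra_H
    \<and> CBB3
    \<and> CBB4"


subsection \<open>Cocycle double matched pairs\<close>

definition CDM1 :: bool where
  "CDM1 \<longleftrightarrow>
      (\<forall>a b.
       \<phi> (a \<cdot>\<^sub>A b) + \<gamma> (\<theta> a b)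
     = - (\<psi> a \<bind> (\<lambda>a0 ap. ap \<otimes>\<^sub>H\<^sub>A (b \<cdot>\<^sub>A a0)))
       + (\<phi> b \<bind> (\<lambda>bm b0. bm \<otimes>\<^sub>H\<^sub>A (a \<cdot>\<^sub>A b0)))
       + (\<phi> b \<bind> (\<lambda>bm b0. bm \<otimes>\<^sub>H\<^sub>A (b0 \<cdot>\<^sub>A a)))
       + (\<phi> a \<bind> (\<lambda>am a0. (am \<triangleleft> b) \<otimes>\<^sub>H\<^sub>A a0))
       + (\<psi> a \<bind> (\<lambda>a0 ap. (ap \<triangleleft> b) \<otimes>\<^sub>H\<^sub>A a0))
       - (\<phi> b \<bind> (\<lambda>bm b0. (a \<triangleright> bm) \<otimes>\<^sub>H\<^sub>A b0))
       + (P b \<bind> (\<lambda>b1 b2. b1 \<otimes>\<^sub>H\<^sub>A (a \<leftharpoonup> b2)))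
       + (P b \<bind> (\<lambda>b1 b2. b1 \<otimes>\<^sub>H\<^sub>A (b2 \<rightharpoonup> a)))
       - (P a \<bind> (\<lambda>a1 a2. a2 \<otimes>\<^sub>H\<^sub>A (b \<leftharpoonup> a1)))
       + (\<Delta>\<^sub>A a \<bind> (\<lambda>a1 a2. (\<theta> a1 b) \<otimes>\<^sub>H\<^sub>A a2))
       + (\<Delta>\<^sub>A a \<bind> (\<lambda>a1 a2. (\<theta> a2 b) \<otimes>\<^sub>H\<^sub>A a1))
       - (\<Delta>\<^sub>A b \<bind> (\<lambda>b1 b2. (\<theta> a b1) \<otimes>\<^sub>H\<^sub>A b2)))"

definition CDM2 :: bool where
  "CDM2 \<longleftrightarrow>
      (\<forall>a b.
       \<psi> (a \<cdot>\<^sub>A b) + \<rho> (\<theta> a b)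
     = (\<psi> a \<bind> (\<lambda>a0 ap. (a0 \<cdot>\<^sub>A b) \<otimes>\<^sub>A\<^sub>H ap))
       + (\<phi> a \<bind> (\<lambda>am a0. (a0 \<cdot>\<^sub>A b) \<otimes>\<^sub>A\<^sub>H am))
       - (\<psi> b \<bind> (\<lambda>b0 bp. (a \<cdot>\<^sub>A b0) \<otimes>\<^sub>A\<^sub>H bp))
       - (\<phi> a \<bind> (\<lambda>am a0. a0 \<otimes>\<^sub>A\<^sub>H (b \<triangleright> am)))
       + (\<psi> b \<bind> (\<lambda>b0 bp. b0 \<otimes>\<^sub>A\<^sub>H (a \<triangleright> bp)))
       + (\<psi> b \<bind> (\<lambda>b0 bp. b0 \<otimes>\<^sub>A\<^sub>H (bp \<triangleleft> a)))
       + (P a \<bind> (\<lambda>a1 a2. (a1 \<rightharpoonup> b) \<otimes>\<^sub>A\<^sub>H a2))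
       + (P a \<bind> (\<lambda>a1 a2. (a2 \<rightharpoonup> b) \<otimes>\<^sub>A\<^sub>H a1))
       - (P b \<bind> (\<lambda>b1 b2. (a \<leftharpoonup> b1) \<otimes>\<^sub>A\<^sub>H b2))
       + (\<Delta>\<^sub>A b \<bind> (\<lambda>b1 b2. b1 \<otimes>\<^sub>A\<^sub>H (\<theta> a b2)))
       + (\<Delta>\<^sub>A b \<bind> (\<lambda>b1 b2. b1 \<otimes>\<^sub>A\<^sub>H (\<theta> b2 a)))
       - (\<Delta>\<^sub>A a \<bind> (\<lambda>a1 a2. a2 \<otimes>\<^sub>A\<^sub>H (\<theta> b a1))))"

definition CDM3 :: bool where
  "CDM3 \<longleftrightarrow>
      (\<forall>x y.
       \<rho> (x \<cdot>\<^sub>H y) + \<psi> (\<sigma> x y)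
     = (\<gamma> x \<bind> (\<lambda>x0 xp. (xp \<leftharpoonup> y) \<otimes>\<^sub>A\<^sub>H x0))
       + (\<rho> x \<bind> (\<lambda>xm x0. (xm \<leftharpoonup> y) \<otimes>\<^sub>A\<^sub>H x0))
       - (\<gamma> x \<bind> (\<lambda>x0 xp. xp \<otimes>\<^sub>A\<^sub>H (y \<cdot>\<^sub>H x0)))
       - (\<rho> y \<bind> (\<lambda>ym y0. (x \<rightharpoonup> ym) \<otimes>\<^sub>A\<^sub>H y0))
       + (\<rho> y \<bind> (\<lambda>ym y0. ym \<otimes>\<^sub>A\<^sub>H (x \<cdot>\<^sub>H y0)))
       + (\<rho> y \<bind> (\<lambda>ym y0. ym \<otimes>\<^sub>A\<^sub>H (y0 \<cdot>\<^sub>H x)))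
       + (\<Delta>\<^sub>H x \<bind> (\<lambda>x1 x2. (\<sigma> x1 y) \<otimes>\<^sub>A\<^sub>H x2))
       + (\<Delta>\<^sub>H x \<bind> (\<lambda>x1 x2. (\<sigma> x2 y) \<otimes>\<^sub>A\<^sub>H x1))
       - (\<Delta>\<^sub>H y \<bind> (\<lambda>y1 y2. (\<sigma> x y1) \<otimes>\<^sub>A\<^sub>H y2))
       + (Q y \<bind> (\<lambda>y1 y2. y1 \<otimes>\<^sub>A\<^sub>H (y2 \<triangleright> x)))
       + (Q y \<bind> (\<lambda>y1 y2. y1 \<otimes>\<^sub>A\<^sub>H (x \<triangleleft> y2)))
       - (Q x \<bind> (\<lambda>x1 x2. x2 \<otimes>\<^sub>A\<^sub>H (y \<triangleleft> x1))))"

definition CDM4 :: bool where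
  "CDM4 \<longleftrightarrow>
      (\<forall>x y.
       \<gamma> (x \<cdot>\<^sub>H y) + \<phi> (\<sigma> x y)
     = (\<gamma> x \<bind> (\<lambda>x0 xp. (x0 \<cdot>\<^sub>H y) \<otimes>\<^sub>H\<^sub>A xp))
       + (\<rho> x \<bind> (\<lambda>xm x0. (x0 \<cdot>\<^sub>H y) \<otimes>\<^sub>H\<^sub>A xm))
       - (\<rho> x \<bind> (\<lambda>xm x0. x0 \<otimes>\<^sub>H\<^sub>A (y \<rightharpoonup> xm)))
       - (\<gamma> y \<bind> (\<lambda>y0 yp. (x \<cdot>\<^sub>H y0) \<otimes>\<^sub>H\<^sub>A yp))
       + (\<gamma> y \<bind> (\<lambda>y0 yp. y0 \<otimes>\<^sub>H\<^sub>A (x \<rightharpoonup> yp)))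
       + (\<gamma> y \<bind> (\<lambda>y0 yp. y0 \<otimes>\<^sub>H\<^sub>A (yp \<leftharpoonup> x)))
       + (Q x \<bind> (\<lambda>x1 x2. (x1 \<triangleright> y) \<otimes>\<^sub>H\<^sub>A x2))
       + (Q x \<bind> (\<lambda>x1 x2. (x2 \<triangleright> y) \<otimes>\<^sub>H\<^sub>A x1))
       - (\<Delta>\<^sub>H x \<bind> (\<lambda>x1 x2. x2 \<otimes>\<^sub>H\<^sub>A (\<sigma> y x1)))
       + (\<Delta>\<^sub>H y \<bind> (\<lambda>y1 y2. y1 \<otimes>\<^sub>H\<^sub>A (\<sigma> x y2)))
       + (\<Delta>\<^sub>H y \<bind> (\<lambda>y1 y2. y1 \<otimes>\<^sub>H\<^sub>A (\<sigma> y2 x)))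
       - (Q y \<bind> (\<lambda>y1 y2. (x \<triangleleft> y1) \<otimes>\<^sub>H\<^sub>A y2)))"

definition CDM5 :: bool where
  "CDM5 \<longleftrightarrow>
      (\<forall>b x.
       \<Delta>\<^sub>A (x \<rightharpoonup> b) + Q (x \<triangleleft> b)
     = (\<gamma> x \<bind> (\<lambda>x0 xp. (x0 \<rightharpoonup> b) \<otimes>\<^sub>A\<^sub>A xp))
       + (\<rho> x \<bind> (\<lambda>xm x0. (x0 \<rightharpoonup> b) \<otimes>\<^sub>A\<^sub>A xm))
       - (\<gamma> x \<bind> (\<lambda>x0 xp. xp \<otimes>\<^sub>A\<^sub>A (b \<leftharpoonup> x0)))
       - (\<Delta>\<^sub>A b \<bind> (\<lambda>b1 b2. (x \<rightharpoonup> b1) \<otimes>\<^sub>A\<^sub>A b2))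
       + (\<Delta>\<^sub>A b \<bind> (\<lambda>b1 b2. b1 \<otimes>\<^sub>A\<^sub>A (x \<rightharpoonup> b2)))
       + (\<Delta>\<^sub>A b \<bind> (\<lambda>b1 b2. b1 \<otimes>\<^sub>A\<^sub>A (b2 \<leftharpoonup> x)))
       + (\<psi> b \<bind> (\<lambda>b0 bp. b0 \<otimes>\<^sub>A\<^sub>A (\<sigma> x bp)))
       + (\<psi> b \<bind> (\<lambda>b0 bp. b0 \<otimes>\<^sub>A\<^sub>A (\<sigma> bp x)))
       - (\<phi> b \<bind> (\<lambda>bm b0. (\<sigma> x bm) \<otimes>\<^sub>A\<^sub>A b0))
       + (Q x \<bind> (\<lambda>x1 x2. (x1 \<cdot>\<^sub>A b) \<otimes>\<^sub>A\<^sub>A x2))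
       + (Q x \<bind> (\<lambda>x1 x2. (x2 \<cdot>\<^sub>A b) \<otimes>\<^sub>A\<^sub>A x1))
       - (Q x \<bind> (\<lambda>x1 x2. x2 \<otimes>\<^sub>A\<^sub>A (b \<cdot>\<^sub>A x1))))"

definition CDM6 :: bool where
  "CDM6 \<longleftrightarrow>
      (\<forall>a y.
       \<Delta>\<^sub>A (a \<leftharpoonup> y) + Q (a \<triangleright> y)
     = (\<Delta>\<^sub>A a \<bind> (\<lambda>a1 a2. (a1 \<leftharpoonup> y) \<otimes>\<^sub>A\<^sub>A a2))
       + (\<Delta>\<^sub>A a \<bind> (\<lambda>a1 a2. (a2 \<leftharpoonup> y) \<otimes>\<^sub>A\<^sub>A a1))
       - (\<Delta>\<^sub>A a \<bind> (\<lambda>a1 a2. a2 \<otimes>\<^sub>A\<^sub>A (y \<rightharpoonup> a1)))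
       - (\<gamma> y \<bind> (\<lambda>y0 yp. (a \<leftharpoonup> y0) \<otimes>\<^sub>A\<^sub>A yp))
       + (\<rho> y \<bind> (\<lambda>ym y0. ym \<otimes>\<^sub>A\<^sub>A (a \<leftharpoonup> y0)))
       + (\<rho> y \<bind> (\<lambda>ym y0. ym \<otimes>\<^sub>A\<^sub>A (y0 \<rightharpoonup> a)))
       + (\<phi> a \<bind> (\<lambda>am a0. (\<sigma> am y) \<otimes>\<^sub>A\<^sub>A a0))
       + (\<psi> a \<bind> (\<lambda>a0 ap. (\<sigma> ap y) \<otimes>\<^sub>A\<^sub>A a0))
       - (\<phi> a \<bind> (\<lambda>am a0. a0 \<otimes>\<^sub>A\<^sub>A (\<sigma> y am)))
       + (Q y \<bind> (\<lambda>y1 y2. y1 \<otimes>\<^sub>A\<^sub>A (a \<cdot>\<^sub>A y2)))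
       + (Q y \<bind> (\<lambda>y1 y2. y1 \<otimes>\<^sub>A\<^sub>A (y2 \<cdot>\<^sub>A a)))
       - (Q y \<bind> (\<lambda>y1 y2. (a \<cdot>\<^sub>A y1) \<otimes>\<^sub>A\<^sub>A y2)))"

definition CDM7 :: bool where
  "CDM7 \<longleftrightarrow>
      (\<forall>a y.
       \<Delta>\<^sub>H (a \<triangleright> y) + P (a \<leftharpoonup> y)
     = (\<psi> a \<bind> (\<lambda>a0 ap. (a0 \<triangleright> y) \<otimes>\<^sub>H\<^sub>H ap))
       + (\<phi> a \<bind> (\<lambda>am a0. (a0 \<triangleright> y) \<otimes>\<^sub>H\<^sub>H am))
       - (\<psi> a \<bind> (\<lambda>a0 ap. ap \<otimes>\<^sub>H\<^sub>H (y \<triangleleft> a0)))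
       + (\<Delta>\<^sub>H y \<bind> (\<lambda>y1 y2. y1 \<otimes>\<^sub>H\<^sub>H (a \<triangleright> y2)))
       + (\<Delta>\<^sub>H y \<bind> (\<lambda>y1 y2. y1 \<otimes>\<^sub>H\<^sub>H (y2 \<triangleleft> a)))
       - (\<Delta>\<^sub>H y \<bind> (\<lambda>y1 y2. (a \<triangleright> y1) \<otimes>\<^sub>H\<^sub>H y2))
       + (\<gamma> y \<bind> (\<lambda>y0 yp. y0 \<otimes>\<^sub>H\<^sub>H (\<theta> a yp)))
       + (\<gamma> y \<bind> (\<lambda>y0 yp. y0 \<otimes>\<^sub>H\<^sub>H (\<theta> yp a)))
       - (\<rho> y \<bind> (\<lambda>ym y0. (\<theta> a ym) \<otimes>\<^sub>H\<^sub>H y0))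
       + (P a \<bind> (\<lambda>a1 a2. (a1 \<cdot>\<^sub>H y) \<otimes>\<^sub>H\<^sub>H a2))
       + (P a \<bind> (\<lambda>a1 a2. (a2 \<cdot>\<^sub>H y) \<otimes>\<^sub>H\<^sub>H a1))
       - (P a \<bind> (\<lambda>a1 a2. a2 \<otimes>\<^sub>H\<^sub>H (y \<cdot>\<^sub>H a1))))"

definition CDM8 :: bool where
  "CDM8 \<longleftrightarrow>
      (\<forall>b x.
       \<Delta>\<^sub>H (x \<triangleleft> b) + P (x \<rightharpoonup> b)
     = (\<Delta>\<^sub>H x \<bind> (\<lambda>x1 x2. (x1 \<triangleleft> b) \<otimes>\<^sub>H\<^sub>H x2))
       + (\<Delta>\<^sub>H x \<bind> (\<lambda>x1 x2. (x2 \<triangleleft> b) \<otimes>\<^sub>H\<^sub>H x1))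
       - (\<Delta>\<^sub>H x \<bind> (\<lambda>x1 x2. x2 \<otimes>\<^sub>H\<^sub>H (b \<triangleright> x1)))
       + (\<phi> b \<bind> (\<lambda>bm b0. bm \<otimes>\<^sub>H\<^sub>H (x \<triangleleft> b0)))
       + (\<phi> b \<bind> (\<lambda>bm b0. bm \<otimes>\<^sub>H\<^sub>H (b0 \<triangleright> x)))
       - (\<psi> b \<bind> (\<lambda>b0 bp. (x \<triangleleft> b0) \<otimes>\<^sub>H\<^sub>H bp))
       + (\<rho> x \<bind> (\<lambda>xm x0. (\<theta> xm b) \<otimes>\<^sub>H\<^sub>H x0))
       + (\<gamma> x \<bind> (\<lambda>x0 xp. (\<theta> xp b) \<otimes>\<^sub>H\<^sub>H x0))
       - (\<rho> x \<bind> (\<lambda>xm x0. x0 \<otimes>\<^sub>H\<^sub>H (\<theta> b xm)))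
       + (P b \<bind> (\<lambda>b1 b2. b1 \<otimes>\<^sub>H\<^sub>H (x \<cdot>\<^sub>H b2)))
       + (P b \<bind> (\<lambda>b1 b2. b1 \<otimes>\<^sub>H\<^sub>H (b2 \<cdot>\<^sub>H x)))
       - (P b \<bind> (\<lambda>b1 b2. (x \<cdot>\<^sub>H b1) \<otimes>\<^sub>H\<^sub>H b2)))"

definition CDM9 :: bool where
  "CDM9 \<longleftrightarrow>
      (\<forall>a b.
       \<Delta>\<^sub>H (\<theta> a b) + P (a \<cdot>\<^sub>A b)
     = (\<psi> a \<bind> (\<lambda>a0 ap. (\<theta> a0 b) \<otimes>\<^sub>H\<^sub>H ap))
       + (\<phi> a \<bind> (\<lambda>am a0. (\<theta> a0 b) \<otimes>\<^sub>H\<^sub>H am))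
       - (\<psi> b \<bind> (\<lambda>b0 bp. (\<theta> a b0) \<otimes>\<^sub>H\<^sub>H bp))
       + (\<phi> b \<bind> (\<lambda>bm b0. bm \<otimes>\<^sub>H\<^sub>H (\<theta> a b0)))
       + (\<phi> b \<bind> (\<lambda>bm b0. bm \<otimes>\<^sub>H\<^sub>H (\<theta> b0 a)))
       - (\<psi> a \<bind> (\<lambda>a0 ap. ap \<otimes>\<^sub>H\<^sub>H (\<theta> b a0)))
       + (P a \<bind> (\<lambda>a1 a2. (a1 \<triangleleft> b) \<otimes>\<^sub>H\<^sub>H a2))
       + (P a \<bind> (\<lambda>a1 a2. (a2 \<triangleleft> b) \<otimes>\<^sub>H\<^sub>H a1))
       - (P b \<bind> (\<lambda>b1 b2. (a \<triangleright> b1) \<otimes>\<^sub>H\<^sub>H b2))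
       + (P b \<bind> (\<lambda>b1 b2. b1 \<otimes>\<^sub>H\<^sub>H (a \<triangleright> b2)))
       + (P b \<bind> (\<lambda>b1 b2. b1 \<otimes>\<^sub>H\<^sub>H (b2 \<triangleleft> a)))
       - (P a \<bind> (\<lambda>a1 a2. a2 \<otimes>\<^sub>H\<^sub>H (b \<triangleright> a1))))"

definition CDM10 :: bool where
  "CDM10 \<longleftrightarrow>
      (\<forall>x y.
       \<Delta>\<^sub>A (\<sigma> x y) + Q (x \<cdot>\<^sub>H y)
     = (\<gamma> x \<bind> (\<lambda>x0 xp. (\<sigma> x0 y) \<otimes>\<^sub>A\<^sub>A xp))
       + (\<rho> x \<bind> (\<lambda>xm x0. (\<sigma> x0 y) \<otimes>\<^sub>A\<^sub>A xm))
       - (\<gamma> y \<bind> (\<lambda>y0 yp. (\<sigma> x y0) \<otimes>\<^sub>A\<^sub>A yp))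
       + (\<rho> y \<bind> (\<lambda>ym y0. ym \<otimes>\<^sub>A\<^sub>A (\<sigma> x y0)))
       + (\<rho> y \<bind> (\<lambda>ym y0. ym \<otimes>\<^sub>A\<^sub>A (\<sigma> y0 x)))
       - (\<gamma> x \<bind> (\<lambda>x0 xp. xp \<otimes>\<^sub>A\<^sub>A (\<sigma> y x0)))
       + (Q x \<bind> (\<lambda>x1 x2. (x1 \<leftharpoonup> y) \<otimes>\<^sub>A\<^sub>A x2))
       + (Q x \<bind> (\<lambda>x1 x2. (x2 \<leftharpoonup> y) \<otimes>\<^sub>A\<^sub>A x1))
       - (Q x \<bind> (\<lambda>x1 x2. x2 \<otimes>\<^sub>A\<^sub>A (y \<rightharpoonup> x1)))
       + (Q y \<bind> (\<lambda>y1 y2. y1 \<otimes>\<^sub>A\<^sub>A (x \<rightharpoonup> y2)))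
       + (Q y \<bind> (\<lambda>y1 y2. y1 \<otimes>\<^sub>A\<^sub>A (y2 \<leftharpoonup> x)))
       - (Q y \<bind> (\<lambda>y1 y2. (x \<rightharpoonup> y1) \<otimes>\<^sub>A\<^sub>A y2)))"

definition CDM11 :: bool where
  "CDM11 \<longleftrightarrow>
      (\<forall>b x.
       \<phi> (x \<rightharpoonup> b) + \<gamma> (x \<triangleleft> b)
     = (\<gamma> x \<bind> (\<lambda>x0 xp. (x0 \<triangleleft> b) \<otimes>\<^sub>H\<^sub>A xp))
       + (\<rho> x \<bind> (\<lambda>xm x0. (x0 \<triangleleft> b) \<otimes>\<^sub>H\<^sub>A xm))
       - (\<Delta>\<^sub>H x \<bind> (\<lambda>x1 x2. x2 \<otimes>\<^sub>H\<^sub>A (b \<leftharpoonup> x1)))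
       - (\<rho> x \<bind> (\<lambda>xm x0. x0 \<otimes>\<^sub>H\<^sub>A (b \<cdot>\<^sub>A xm)))
       + (\<phi> b \<bind> (\<lambda>bm b0. bm \<otimes>\<^sub>H\<^sub>A (x \<rightharpoonup> b0)))
       - (\<Delta>\<^sub>A b \<bind> (\<lambda>b1 b2. (x \<triangleleft> b1) \<otimes>\<^sub>H\<^sub>A b2))
       + (\<phi> b \<bind> (\<lambda>bm b0. bm \<otimes>\<^sub>H\<^sub>A (b0 \<leftharpoonup> x)))
       - (\<phi> b \<bind> (\<lambda>bm b0. (x \<cdot>\<^sub>H bm) \<otimes>\<^sub>H\<^sub>A b0))
       + (Q x \<bind> (\<lambda>x1 x2. (\<theta> x1 b) \<otimes>\<^sub>H\<^sub>A x2))
       + (Q x \<bind> (\<lambda>x1 x2. (\<theta> x2 b) \<otimes>\<^sub>H\<^sub>A x1))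
       + (P b \<bind> (\<lambda>b1 b2. b1 \<otimes>\<^sub>H\<^sub>A (\<sigma> x b2)))
       + (P b \<bind> (\<lambda>b1 b2. b1 \<otimes>\<^sub>H\<^sub>A (\<sigma> b2 x))))"

definition CDM12 :: bool where
  "CDM12 \<longleftrightarrow>
      (\<forall>a y.
       \<psi> (a \<leftharpoonup> y) + \<rho> (a \<triangleright> y)
     = (\<psi> a \<bind> (\<lambda>a0 ap. (a0 \<leftharpoonup> y) \<otimes>\<^sub>A\<^sub>H ap))
       + (\<phi> a \<bind> (\<lambda>am a0. (a0 \<leftharpoonup> y) \<otimes>\<^sub>A\<^sub>H am))
       - (\<Delta>\<^sub>A a \<bind> (\<lambda>a1 a2. a2 \<otimes>\<^sub>A\<^sub>H (y \<triangleleft> a1)))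
       - (\<phi> a \<bind> (\<lambda>am a0. a0 \<otimes>\<^sub>A\<^sub>H (y \<cdot>\<^sub>H am)))
       + (\<rho> y \<bind> (\<lambda>ym y0. ym \<otimes>\<^sub>A\<^sub>H (a \<triangleright> y0)))
       - (\<Delta>\<^sub>H y \<bind> (\<lambda>y1 y2. (a \<leftharpoonup> y1) \<otimes>\<^sub>A\<^sub>H y2))
       + (\<rho> y \<bind> (\<lambda>ym y0. ym \<otimes>\<^sub>A\<^sub>H (y0 \<triangleleft> a)))
       - (\<rho> y \<bind> (\<lambda>ym y0. (a \<cdot>\<^sub>A ym) \<otimes>\<^sub>A\<^sub>H y0))
       + (P a \<bind> (\<lambda>a1 a2. (\<sigma> a1 y) \<otimes>\<^sub>A\<^sub>H a2))
       + (P a \<bind> (\<lambda>a1 a2. (\<sigma> a2 y) \<otimes>\<^sub>A\<^sub>H a1))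
       + (Q y \<bind> (\<lambda>y1 y2. y1 \<otimes>\<^sub>A\<^sub>H (\<theta> a y2)))
       + (Q y \<bind> (\<lambda>y1 y2. y1 \<otimes>\<^sub>A\<^sub>H (\<theta> y2 a))))"

definition CDM13 :: bool where
  "CDM13 \<longleftrightarrow>
      (\<forall>b x.
       \<psi> (x \<rightharpoonup> b) + \<rho> (x \<triangleleft> b)
     = (\<Delta>\<^sub>H x \<bind> (\<lambda>x1 x2. (x1 \<rightharpoonup> b) \<otimes>\<^sub>A\<^sub>H x2))
       + (\<rho> x \<bind> (\<lambda>xm x0. (xm \<cdot>\<^sub>A b) \<otimes>\<^sub>A\<^sub>H x0))
       + (\<Delta>\<^sub>H x \<bind> (\<lambda>x1 x2. (x2 \<rightharpoonup> b) \<otimes>\<^sub>A\<^sub>H x1))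
       + (\<gamma> x \<bind> (\<lambda>x0 xp. (xp \<cdot>\<^sub>A b) \<otimes>\<^sub>A\<^sub>H x0))
       - (\<gamma> x \<bind> (\<lambda>x0 xp. xp \<otimes>\<^sub>A\<^sub>H (b \<triangleright> x0)))
       + (\<Delta>\<^sub>A b \<bind> (\<lambda>b1 b2. b1 \<otimes>\<^sub>A\<^sub>H (x \<triangleleft> b2)))
       + (\<psi> b \<bind> (\<lambda>b0 bp. b0 \<otimes>\<^sub>A\<^sub>H (x \<cdot>\<^sub>H bp)))
       + (\<Delta>\<^sub>A b \<bind> (\<lambda>b1 b2. b1 \<otimes>\<^sub>A\<^sub>H (b2 \<triangleright> x)))
       + (\<psi> b \<bind> (\<lambda>b0 bp. b0 \<otimes>\<^sub>A\<^sub>H (bp \<cdot>\<^sub>H x)))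
       - (\<psi> b \<bind> (\<lambda>b0 bp. (x \<rightharpoonup> b0) \<otimes>\<^sub>A\<^sub>H bp))
       - (Q x \<bind> (\<lambda>x1 x2. x2 \<otimes>\<^sub>A\<^sub>H (\<theta> b x1)))
       - (P b \<bind> (\<lambda>b1 b2. (\<sigma> x b1) \<otimes>\<^sub>A\<^sub>H b2)))"

definition CDM14 :: bool where
  "CDM14 \<longleftrightarrow>
      (\<forall>a y.
       \<phi> (a \<leftharpoonup> y) + \<gamma> (a \<triangleright> y)
     = (\<Delta>\<^sub>A a \<bind> (\<lambda>a1 a2. (a1 \<triangleright> y) \<otimes>\<^sub>H\<^sub>A a2))
       + (\<phi> a \<bind> (\<lambda>am a0. (am \<cdot>\<^sub>H y) \<otimes>\<^sub>H\<^sub>A a0))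
       + (\<Delta>\<^sub>A a \<bind> (\<lambda>a1 a2. (a2 \<triangleright> y) \<otimes>\<^sub>H\<^sub>A a1))
       + (\<psi> a \<bind> (\<lambda>a0 ap. (ap \<cdot>\<^sub>H y) \<otimes>\<^sub>H\<^sub>A a0))
       - (\<psi> a \<bind> (\<lambda>a0 ap. ap \<otimes>\<^sub>H\<^sub>A (y \<rightharpoonup> a0)))
       + (\<Delta>\<^sub>H y \<bind> (\<lambda>y1 y2. y1 \<otimes>\<^sub>H\<^sub>A (a \<leftharpoonup> y2)))
       + (\<gamma> y \<bind> (\<lambda>y0 yp. y0 \<otimes>\<^sub>H\<^sub>A (a \<cdot>\<^sub>A yp)))
       + (\<Delta>\<^sub>H y \<bind> (\<lambda>y1 y2. y1 \<otimes>\<^sub>H\<^sub>A (y2 \<rightharpoonup> a)))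
       + (\<gamma> y \<bind> (\<lambda>y0 yp. y0 \<otimes>\<^sub>H\<^sub>A (yp \<cdot>\<^sub>A a)))
       - (\<gamma> y \<bind> (\<lambda>y0 yp. (a \<triangleright> y0) \<otimes>\<^sub>H\<^sub>A yp))
       - (Q y \<bind> (\<lambda>y1 y2. (\<theta> a y1) \<otimes>\<^sub>H\<^sub>A y2))
       - (P a \<bind> (\<lambda>a1 a2. a2 \<otimes>\<^sub>H\<^sub>A (\<sigma> y a1))))"

definition CDM15 :: bool where
  "CDM15 \<longleftrightarrow>
      (\<forall>a b.
       \<phi> (b \<cdot>\<^sub>A a) + \<gamma> (\<theta> b a) + \<tau> (\<psi> (b \<cdot>\<^sub>A a)) + \<tau> (\<rho> (\<theta> b a))
     = (\<phi> a \<bind> (\<lambda>am a0. am \<otimes>\<^sub>H\<^sub>A (b \<cdot>\<^sub>A a0)))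
       + (\<psi> a \<bind> (\<lambda>a0 ap. (b \<triangleright> ap) \<otimes>\<^sub>H\<^sub>A a0))
       + (\<phi> b \<bind> (\<lambda>bm b0. (bm \<triangleleft> a) \<otimes>\<^sub>H\<^sub>A b0))
       + (\<psi> b \<bind> (\<lambda>b0 bp. bp \<otimes>\<^sub>H\<^sub>A (b0 \<cdot>\<^sub>A a)))
       + (P a \<bind> (\<lambda>a1 a2. a1 \<otimes>\<^sub>H\<^sub>A (b \<leftharpoonup> a2)))
       + (P b \<bind> (\<lambda>b1 b2. b2 \<otimes>\<^sub>H\<^sub>A (b1 \<rightharpoonup> a)))
       + (\<Delta>\<^sub>A a \<bind> (\<lambda>a1 a2. (\<theta> b a2) \<otimes>\<^sub>H\<^sub>A a1))
       + (\<Delta>\<^sub>A b \<bind> (\<lambda>b1 b2. (\<theta> b1 a) \<otimes>\<^sub>H\<^sub>A b2)))"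

definition CDM16 :: bool where
  "CDM16 \<longleftrightarrow>
      (\<forall>a b.
       \<psi> (b \<cdot>\<^sub>A a) + \<rho> (\<theta> b a) + \<tau> (\<phi> (b \<cdot>\<^sub>A a)) + \<tau> (\<gamma> (\<theta> b a))
     = (\<psi> a \<bind> (\<lambda>a0 ap. a0 \<otimes>\<^sub>A\<^sub>H (b \<triangleright> ap)))
       + (\<phi> a \<bind> (\<lambda>am a0. (b \<cdot>\<^sub>A a0) \<otimes>\<^sub>A\<^sub>H am))
       + (\<psi> b \<bind> (\<lambda>b0 bp. (b0 \<cdot>\<^sub>A a) \<otimes>\<^sub>A\<^sub>H bp))
       + (\<phi> b \<bind> (\<lambda>bm b0. b0 \<otimes>\<^sub>A\<^sub>H (bm \<triangleleft> a)))
       + (\<Delta>\<^sub>A a \<bind> (\<lambda>a1 a2. a1 \<otimes>\<^sub>A\<^sub>H (\<theta> b a2)))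
       + (\<Delta>\<^sub>A b \<bind> (\<lambda>b1 b2. b2 \<otimes>\<^sub>A\<^sub>H (\<theta> b1 a)))
       + (P a \<bind> (\<lambda>a1 a2. (b \<leftharpoonup> a2) \<otimes>\<^sub>A\<^sub>H a1))
       + (P b \<bind> (\<lambda>b1 b2. (b1 \<rightharpoonup> a) \<otimes>\<^sub>A\<^sub>H b2)))"

definition CDM17 :: bool where
  "CDM17 \<longleftrightarrow>
      (\<forall>x y.
       \<rho> (y \<cdot>\<^sub>H x) + \<psi> (\<sigma> y x) + \<tau> (\<gamma> (y \<cdot>\<^sub>H x)) + \<tau> (\<phi> (\<sigma> y x))
     = (\<rho> x \<bind> (\<lambda>xm x0. xm \<otimes>\<^sub>A\<^sub>H (y \<cdot>\<^sub>H x0)))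
       + (\<gamma> x \<bind> (\<lambda>x0 xp. (y \<rightharpoonup> xp) \<otimes>\<^sub>A\<^sub>H x0))
       + (\<rho> y \<bind> (\<lambda>ym y0. (ym \<leftharpoonup> x) \<otimes>\<^sub>A\<^sub>H y0))
       + (\<gamma> y \<bind> (\<lambda>y0 yp. yp \<otimes>\<^sub>A\<^sub>H (y0 \<cdot>\<^sub>H x)))
       + (Q x \<bind> (\<lambda>x1 x2. x1 \<otimes>\<^sub>A\<^sub>H (y \<triangleleft> x2)))
       + (Q y \<bind> (\<lambda>y1 y2. y2 \<otimes>\<^sub>A\<^sub>H (y1 \<triangleright> x)))
       + (\<Delta>\<^sub>H x \<bind> (\<lambda>x1 x2. (\<sigma> y x2) \<otimes>\<^sub>A\<^sub>H x1))
       + (\<Delta>\<^sub>H y \<bind> (\<lambda>y1 y2. (\<sigma> y1 x) \<otimes>\<^sub>A\<^sub>H y2)))"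

definition CDM18 :: bool where
  "CDM18 \<longleftrightarrow>
      (\<forall>x y.
       \<gamma> (y \<cdot>\<^sub>H x) + \<phi> (\<sigma> y x) + \<tau> (\<rho> (y \<cdot>\<^sub>H x)) + \<tau> (\<psi> (\<sigma> y x))
     = (\<rho> x \<bind> (\<lambda>xm x0. (y \<cdot>\<^sub>H x0) \<otimes>\<^sub>H\<^sub>A xm))
       + (\<gamma> y \<bind> (\<lambda>y0 yp. (y0 \<cdot>\<^sub>H x) \<otimes>\<^sub>H\<^sub>A yp))
       + (\<rho> y \<bind> (\<lambda>ym y0. y0 \<otimes>\<^sub>H\<^sub>A (ym \<leftharpoonup> x)))
       + (\<gamma> x \<bind> (\<lambda>x0 xp. x0 \<otimes>\<^sub>H\<^sub>A (y \<rightharpoonup> xp)))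
       + (\<Delta>\<^sub>H x \<bind> (\<lambda>x1 x2. x1 \<otimes>\<^sub>H\<^sub>A (\<sigma> y x2)))
       + (\<Delta>\<^sub>H y \<bind> (\<lambda>y1 y2. y2 \<otimes>\<^sub>H\<^sub>A (\<sigma> y1 x)))
       + (Q x \<bind> (\<lambda>x1 x2. (y \<triangleleft> x2) \<otimes>\<^sub>H\<^sub>A x1))
       + (Q y \<bind> (\<lambda>y1 y2. (y1 \<triangleright> x) \<otimes>\<^sub>H\<^sub>A y2)))"

definition CDM19 :: bool where
  "CDM19 \<longleftrightarrow>
      (\<forall>b x.
       \<Delta>\<^sub>A (b \<leftharpoonup> x) + Q (b \<triangleright> x) + \<tau> (\<Delta>\<^sub>A (b \<leftharpoonup> x)) + \<tau> (Q (b \<triangleright> x))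
     = (\<rho> x \<bind> (\<lambda>xm x0. xm \<otimes>\<^sub>A\<^sub>A (b \<leftharpoonup> x0)))
       + (\<rho> x \<bind> (\<lambda>xm x0. (b \<leftharpoonup> x0) \<otimes>\<^sub>A\<^sub>A xm))
       + (\<Delta>\<^sub>A b \<bind> (\<lambda>b1 b2. (b1 \<leftharpoonup> x) \<otimes>\<^sub>A\<^sub>A b2))
       + (\<Delta>\<^sub>A b \<bind> (\<lambda>b1 b2. b2 \<otimes>\<^sub>A\<^sub>A (b1 \<leftharpoonup> x)))
       + (Q x \<bind> (\<lambda>x1 x2. x1 \<otimes>\<^sub>A\<^sub>A (b \<cdot>\<^sub>A x2)))
       + (Q x \<bind> (\<lambda>x1 x2. (b \<cdot>\<^sub>A x2) \<otimes>\<^sub>A\<^sub>A x1))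
       + (\<phi> b \<bind> (\<lambda>bm b0. (\<sigma> bm x) \<otimes>\<^sub>A\<^sub>A b0))
       + (\<phi> b \<bind> (\<lambda>bm b0. b0 \<otimes>\<^sub>A\<^sub>A (\<sigma> bm x))))"

definition CDM20 :: bool where
  "CDM20 \<longleftrightarrow>
      (\<forall>a y.
       \<Delta>\<^sub>A (y \<rightharpoonup> a) + Q (y \<triangleleft> a) + \<tau> (\<Delta>\<^sub>A (y \<rightharpoonup> a)) + \<tau> (Q (y \<triangleleft> a))
     = (\<Delta>\<^sub>A a \<bind> (\<lambda>a1 a2. a1 \<otimes>\<^sub>A\<^sub>A (y \<rightharpoonup> a2)))
       + (\<Delta>\<^sub>A a \<bind> (\<lambda>a1 a2. (y \<rightharpoonup> a2) \<otimes>\<^sub>A\<^sub>A a1))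
       + (\<gamma> y \<bind> (\<lambda>y0 yp. (y0 \<rightharpoonup> a) \<otimes>\<^sub>A\<^sub>A yp))
       + (\<gamma> y \<bind> (\<lambda>y0 yp. yp \<otimes>\<^sub>A\<^sub>A (y0 \<rightharpoonup> a)))
       + (\<psi> a \<bind> (\<lambda>a0 ap. a0 \<otimes>\<^sub>A\<^sub>A (\<sigma> y ap)))
       + (\<psi> a \<bind> (\<lambda>a0 ap. (\<sigma> y ap) \<otimes>\<^sub>A\<^sub>A a0))
       + (Q y \<bind> (\<lambda>y1 y2. (y1 \<cdot>\<^sub>A a) \<otimes>\<^sub>A\<^sub>A y2))
       + (Q y \<bind> (\<lambda>y1 y2. y2 \<otimes>\<^sub>A\<^sub>A (y1 \<cdot>\<^sub>A a))))"

definition CDM21 :: bool where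
  "CDM21 \<longleftrightarrow>
      (\<forall>a y.
       \<Delta>\<^sub>H (y \<triangleleft> a) + P (y \<rightharpoonup> a) + \<tau> (\<Delta>\<^sub>H (y \<triangleleft> a)) + \<tau> (P (y \<rightharpoonup> a))
     = (\<phi> a \<bind> (\<lambda>am a0. am \<otimes>\<^sub>H\<^sub>H (y \<triangleleft> a0)))
       + (\<phi> a \<bind> (\<lambda>am a0. (y \<triangleleft> a0) \<otimes>\<^sub>H\<^sub>H am))
       + (\<Delta>\<^sub>H y \<bind> (\<lambda>y1 y2. (y1 \<triangleleft> a) \<otimes>\<^sub>H\<^sub>H y2))
       + (\<Delta>\<^sub>H y \<bind> (\<lambda>y1 y2. y2 \<otimes>\<^sub>H\<^sub>H (y1 \<triangleleft> a)))
       + (P a \<bind> (\<lambda>a1 a2. a1 \<otimes>\<^sub>H\<^sub>H (y \<cdot>\<^sub>H a2)))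
       + (P a \<bind> (\<lambda>a1 a2. (y \<cdot>\<^sub>H a2) \<otimes>\<^sub>H\<^sub>H a1))
       + (\<rho> y \<bind> (\<lambda>ym y0. (\<theta> ym a) \<otimes>\<^sub>H\<^sub>H y0))
       + (\<rho> y \<bind> (\<lambda>ym y0. y0 \<otimes>\<^sub>H\<^sub>H (\<theta> ym a))))"

definition CDM22 :: bool where
  "CDM22 \<longleftrightarrow>
      (\<forall>b x.
       \<Delta>\<^sub>H (b \<triangleright> x) + P (b \<leftharpoonup> x) + \<tau> (\<Delta>\<^sub>H (b \<triangleright> x)) + \<tau> (P (b \<leftharpoonup> x))
     = (\<Delta>\<^sub>H x \<bind> (\<lambda>x1 x2. x1 \<otimes>\<^sub>H\<^sub>H (b \<triangleright> x2)))
       + (\<Delta>\<^sub>H x \<bind> (\<lambda>x1 x2. (b \<triangleright> x2) \<otimes>\<^sub>H\<^sub>H x1))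
       + (\<psi> b \<bind> (\<lambda>b0 bp. (b0 \<triangleright> x) \<otimes>\<^sub>H\<^sub>H bp))
       + (\<psi> b \<bind> (\<lambda>b0 bp. bp \<otimes>\<^sub>H\<^sub>H (b0 \<triangleright> x)))
       + (\<gamma> x \<bind> (\<lambda>x0 xp. x0 \<otimes>\<^sub>H\<^sub>H (\<theta> b xp)))
       + (\<gamma> x \<bind> (\<lambda>x0 xp. (\<theta> b xp) \<otimes>\<^sub>H\<^sub>H x0))
       + (P b \<bind> (\<lambda>b1 b2. (b1 \<cdot>\<^sub>H x) \<otimes>\<^sub>H\<^sub>H b2))
       + (P b \<bind> (\<lambda>b1 b2. b2 \<otimes>\<^sub>H\<^sub>H (b1 \<cdot>\<^sub>H x))))"

definition CDM23 :: bool where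
  "CDM23 \<longleftrightarrow>
      (\<forall>a y.
       \<phi> (y \<rightharpoonup> a) + \<tau> (\<psi> (y \<rightharpoonup> a)) + \<gamma> (y \<triangleleft> a) + \<tau> (\<rho> (y \<triangleleft> a))
     = (\<phi> a \<bind> (\<lambda>am a0. am \<otimes>\<^sub>H\<^sub>A (y \<rightharpoonup> a0)))
       + (\<Delta>\<^sub>A a \<bind> (\<lambda>a1 a2. (y \<triangleleft> a2) \<otimes>\<^sub>H\<^sub>A a1))
       + (\<psi> a \<bind> (\<lambda>a0 ap. (y \<cdot>\<^sub>H ap) \<otimes>\<^sub>H\<^sub>A a0))
       + (\<gamma> y \<bind> (\<lambda>y0 yp. (y0 \<triangleleft> a) \<otimes>\<^sub>H\<^sub>A yp))
       + (\<Delta>\<^sub>H y \<bind> (\<lambda>y1 y2. y2 \<otimes>\<^sub>H\<^sub>A (y1 \<rightharpoonup> a)))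
       + (\<rho> y \<bind> (\<lambda>ym y0. y0 \<otimes>\<^sub>H\<^sub>A (ym \<cdot>\<^sub>A a)))
       + (P a \<bind> (\<lambda>a1 a2. a1 \<otimes>\<^sub>H\<^sub>A (\<sigma> y a2)))
       + (Q y \<bind> (\<lambda>y1 y2. (\<theta> y1 a) \<otimes>\<^sub>H\<^sub>A y2)))"

definition CDM24 :: bool where
  "CDM24 \<longleftrightarrow>
      (\<forall>b x.
       \<phi> (b \<leftharpoonup> x) + \<tau> (\<psi> (b \<leftharpoonup> x)) + \<gamma> (b \<triangleright> x) + \<tau> (\<rho> (b \<triangleright> x))
     = (\<Delta>\<^sub>H x \<bind> (\<lambda>x1 x2. x1 \<otimes>\<^sub>H\<^sub>A (b \<leftharpoonup> x2)))
       + (\<gamma> x \<bind> (\<lambda>x0 xp. x0 \<otimes>\<^sub>H\<^sub>A (b \<cdot>\<^sub>A xp)))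
       + (\<rho> x \<bind> (\<lambda>xm x0. (b \<triangleright> x0) \<otimes>\<^sub>H\<^sub>A xm))
       + (\<Delta>\<^sub>A b \<bind> (\<lambda>b1 b2. (b1 \<triangleright> x) \<otimes>\<^sub>H\<^sub>A b2))
       + (\<phi> b \<bind> (\<lambda>bm b0. (bm \<cdot>\<^sub>H x) \<otimes>\<^sub>H\<^sub>A b0))
       + (\<psi> b \<bind> (\<lambda>b0 bp. bp \<otimes>\<^sub>H\<^sub>A (b0 \<leftharpoonup> x)))
       + (Q x \<bind> (\<lambda>x1 x2. (\<theta> b x2) \<otimes>\<^sub>H\<^sub>A x1))
       + (P b \<bind> (\<lambda>b1 b2. b2 \<otimes>\<^sub>H\<^sub>A (\<sigma> b1 x))))"

definition CDM25 :: bool where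
  "CDM25 \<longleftrightarrow>
      (\<forall>a y.
       \<psi> (y \<rightharpoonup> a) + \<tau> (\<phi> (y \<rightharpoonup> a)) + \<rho> (y \<triangleleft> a) + \<tau> (\<gamma> (y \<triangleleft> a))
     = (\<Delta>\<^sub>A a \<bind> (\<lambda>a1 a2. a1 \<otimes>\<^sub>A\<^sub>H (y \<triangleleft> a2)))
       + (\<psi> a \<bind> (\<lambda>a0 ap. a0 \<otimes>\<^sub>A\<^sub>H (y \<cdot>\<^sub>H ap)))
       + (\<phi> a \<bind> (\<lambda>am a0. (y \<rightharpoonup> a0) \<otimes>\<^sub>A\<^sub>H am))
       + (\<Delta>\<^sub>H y \<bind> (\<lambda>y1 y2. (y1 \<rightharpoonup> a) \<otimes>\<^sub>A\<^sub>H y2))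
       + (\<rho> y \<bind> (\<lambda>ym y0. (ym \<cdot>\<^sub>A a) \<otimes>\<^sub>A\<^sub>H y0))
       + (\<gamma> y \<bind> (\<lambda>y0 yp. yp \<otimes>\<^sub>A\<^sub>H (y0 \<triangleleft> a)))
       + (P a \<bind> (\<lambda>a1 a2. (\<sigma> y a2) \<otimes>\<^sub>A\<^sub>H a1))
       + (Q y \<bind> (\<lambda>y1 y2. y2 \<otimes>\<^sub>A\<^sub>H (\<theta> y1 a))))"

definition CDM26 :: bool where
  "CDM26 \<longleftrightarrow>
      (\<forall>b x.
       \<psi> (b \<leftharpoonup> x) + \<tau> (\<phi> (b \<leftharpoonup> x)) + \<rho> (b \<triangleright> x) + \<tau> (\<gamma> (b \<triangleright> x))
     = (\<rho> x \<bind> (\<lambda>xm x0. xm \<otimes>\<^sub>A\<^sub>H (b \<triangleright> x0)))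
       + (\<Delta>\<^sub>H x \<bind> (\<lambda>x1 x2. (b \<leftharpoonup> x2) \<otimes>\<^sub>A\<^sub>H x1))
       + (\<gamma> x \<bind> (\<lambda>x0 xp. (b \<cdot>\<^sub>A xp) \<otimes>\<^sub>A\<^sub>H x0))
       + (\<psi> b \<bind> (\<lambda>b0 bp. (b0 \<leftharpoonup> x) \<otimes>\<^sub>A\<^sub>H bp))
       + (\<Delta>\<^sub>A b \<bind> (\<lambda>b1 b2. b2 \<otimes>\<^sub>A\<^sub>H (b1 \<triangleright> x)))
       + (\<phi> b \<bind> (\<lambda>bm b0. b0 \<otimes>\<^sub>A\<^sub>H (bm \<cdot>\<^sub>H x)))
       + (Q x \<bind> (\<lambda>x1 x2. x1 \<otimes>\<^sub>A\<^sub>H (\<theta> b x2)))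
       + (P b \<bind> (\<lambda>b1 b2. (\<sigma> b1 x) \<otimes>\<^sub>A\<^sub>H b2)))"

definition CDM27 :: bool where
  "CDM27 \<longleftrightarrow>
      (\<forall>x y.
       \<Delta>\<^sub>A (\<sigma> y x) + Q (y \<cdot>\<^sub>H x) + \<tau> (\<Delta>\<^sub>A (\<sigma> y x)) + \<tau> (Q (y \<cdot>\<^sub>H x))
     = (\<rho> x \<bind> (\<lambda>xm x0. xm \<otimes>\<^sub>A\<^sub>A (\<sigma> y x0)))
       + (\<rho> x \<bind> (\<lambda>xm x0. (\<sigma> y x0) \<otimes>\<^sub>A\<^sub>A xm))
       + (Q x \<bind> (\<lambda>x1 x2. x1 \<otimes>\<^sub>A\<^sub>A (y \<rightharpoonup> x2)))
       + (Q x \<bind> (\<lambda>x1 x2. (y \<rightharpoonup> x2) \<otimes>\<^sub>A\<^sub>A x1))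
       + (\<gamma> y \<bind> (\<lambda>y0 yp. (\<sigma> y0 x) \<otimes>\<^sub>A\<^sub>A yp))
       + (\<gamma> y \<bind> (\<lambda>y0 yp. yp \<otimes>\<^sub>A\<^sub>A (\<sigma> y0 x)))
       + (Q y \<bind> (\<lambda>y1 y2. (y1 \<leftharpoonup> x) \<otimes>\<^sub>A\<^sub>A y2))
       + (Q y \<bind> (\<lambda>y1 y2. y2 \<otimes>\<^sub>A\<^sub>A (y1 \<leftharpoonup> x))))"

definition CDM28 :: bool where
  "CDM28 \<longleftrightarrow>
      (\<forall>a b.
       P (b \<cdot>\<^sub>A a) + \<Delta>\<^sub>H (\<theta> b a) + \<tau> (P (b \<cdot>\<^sub>A a)) + \<tau> (\<Delta>\<^sub>H (\<theta> b a))
     = (\<phi> a \<bind> (\<lambda>am a0. am \<otimes>\<^sub>H\<^sub>H (\<theta> b a0)))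
       + (\<phi> a \<bind> (\<lambda>am a0. (\<theta> b a0) \<otimes>\<^sub>H\<^sub>H am))
       + (P a \<bind> (\<lambda>a1 a2. a1 \<otimes>\<^sub>H\<^sub>H (b \<triangleright> a2)))
       + (P a \<bind> (\<lambda>a1 a2. (b \<triangleright> a2) \<otimes>\<^sub>H\<^sub>H a1))
       + (\<psi> b \<bind> (\<lambda>b0 bp. (\<theta> b0 a) \<otimes>\<^sub>H\<^sub>H bp))
       + (\<psi> b \<bind> (\<lambda>b0 bp. bp \<otimes>\<^sub>H\<^sub>H (\<theta> b0 a)))
       + (P b \<bind> (\<lambda>b1 b2. (b1 \<triangleleft> a) \<otimes>\<^sub>H\<^sub>H b2))
       + (P b \<bind> (\<lambda>b1 b2. b2 \<otimes>\<^sub>H\<^sub>H (b1 \<triangleleft> a))))"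

definition cocycle_double_matched_pair :: bool where
  "cocycle_double_matched_pair \<longleftrightarrow>
      CDM1
    \<and> CDM2
    \<and> CDM3
    \<and> CDM4
    \<and> CDM5
    \<and> CDM6
    \<and> CDM7
    \<and> CDM8
    \<and> CDM9
    \<and> CDM10
    \<and> CDM11
    \<and> CDM12
    \<and> CDM13
    \<and> CDM14
    \<and> CDM15
    \<and> CDM16
    \<and> CDM17
    \<and> CDM18
    \<and> CDM19
    \<and> CDM20
    \<and> CDM21
    \<and> CDM22
    \<and> CDM23
    \<and> CDM24
    \<and> CDM25
    \<and> CDM26
    \<and> CDM27
    \<and> CDM28"


subsection \<open>The structure on the direct sum\<close>

definition E_scale :: "'k \<Rightarrow> 'a \<times> 'h \<Rightarrow> 'a \<times> 'h" where
  "E_scale c = (\<lambda>(a, x). (sA c a, sH c x))"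

definition E_mult :: "'a \<times> 'h \<Rightarrow> 'a \<times> 'h \<Rightarrow> 'a \<times> 'h" where
  "E_mult = (\<lambda>(a, x) (b, y).
     (a \<cdot>\<^sub>A b + x \<rightharpoonup> b + a \<leftharpoonup> y + \<sigma> x y,
      x \<cdot>\<^sub>H y + x \<triangleleft> b + a \<triangleright> y + \<theta> a b))"

abbreviation tenE (infix "\<otimes>\<^sub>E" 67) where "u \<otimes>\<^sub>E v \<equiv> ten E_scale E_scale u v"

definition E_comult :: "'a \<times> 'h \<Rightarrow> ('k, 'a \<times> 'h, 'a \<times> 'h) tensor" where
  "E_comult = (\<lambda>(a, x).
       (\<Delta>\<^sub>A a \<bind> (\<lambda>u v. (u, 0) \<otimes>\<^sub>E (v, 0)))
     + (\<phi> a \<bind> (\<lambda>u v. (0, u) \<otimes>\<^sub>E (v, 0)))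
     + (\<psi> a \<bind> (\<lambda>u v. (u, 0) \<otimes>\<^sub>E (0, v)))
     + (P a \<bind> (\<lambda>u v. (0, u) \<otimes>\<^sub>E (0, v)))
     + (\<Delta>\<^sub>H x \<bind> (\<lambda>u v. (0, u) \<otimes>\<^sub>E (0, v)))
     + (\<rho> x \<bind> (\<lambda>u v. (u, 0) \<otimes>\<^sub>E (0, v)))
     + (\<gamma> x \<bind> (\<lambda>u v. (0, u) \<otimes>\<^sub>E (v, 0)))
     + (Q x \<bind> (\<lambda>u v. (u, 0) \<otimes>\<^sub>E (v, 0))))"

end

end

theory Submission
  imports Defs
begin

text \<open>
  Since \<open>E \<otimes> E\<close> is the direct sum of \<open>A \<otimes> A\<close>, \<open>A \<otimes> H\<close>, \<open>H \<otimes> A\<close> and \<open>H \<otimes> H\<close>, both compatibility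
  conditions of \<open>E\<close> split into four components; being bilinear, they need to be tested only on
  arguments from \<open>A\<close> and \<open>H\<close>. This gives \<open>2 \<cdot> 4 \<cdot> 4 = 32\<close> identities: four of them are
  the conditions (CBB1)-(CBB4), the other 28 are (CDM1)-(CDM28). In the same way the alternator
  identities of the product split into the identities of a cocycle cross product system, and the
  components of the coassociator are the sixteen expressions \<open>\<alpha>\<close> and \<open>\<beta>\<close>.
\<close>

section \<open>Tensor calculus\<close>

lemma linear_compose_lambda:
  assumes "Vector_Spaces.linear s1 s2 f" "Vector_Spaces.linear s2 s3 g"
  shows "Vector_Spaces.linear s1 s3 (\<lambda>u. g (f u))"
  using Vector_Spaces.linear_compose[OF assms] by (simp add: o_def)

lemma linear_ident: "vector_space s \<Longrightarrow> Vector_Spaces.linear s s (\<lambda>u. u)"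
  by (simp add: Vector_Spaces.linear_iff)

lemma bilinear_map_linear:
  assumes "bilinear_map sa sb sc F"
  shows "Vector_Spaces.linear sa sc (\<lambda>u. F u v)" "Vector_Spaces.linear sb sc (F u)"
  using assms by (simp_all add: bilinear_map_def)

lemma bilinear_map_compose:
  assumes "bilinear_map sa sb sc F" "Vector_Spaces.linear s1 sa f" "Vector_Spaces.linear s2 sb g"
  shows "bilinear_map s1 s2 sc (\<lambda>u v. F (f u) (g v))"
  unfolding bilinear_map_def
proof (intro conjI allI)
  show "Vector_Spaces.linear s1 sc (\<lambda>u. F (f u) (g v))" for v
    using assms(1) by (intro linear_compose_lambda[OF assms(2), of sc "\<lambda>u. F u (g v)"]) (simp add: bilinear_map_def)
  show "Vector_Spaces.linear s2 sc (\<lambda>v. F (f u) (g v))" for u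
    using assms(1) by (intro linear_compose_lambda[OF assms(3), of sc "F (f u)"]) (simp add: bilinear_map_def)
qed

lemma bilinear_map_swap: "bilinear_map sa sb sc F \<Longrightarrow> bilinear_map sb sa sc (\<lambda>u v. F v u)"
  by (simp add: bilinear_map_def)

lemma trilinear_map_bilinear:
  assumes "trilinear_map sa sb sc sd F"
  shows "bilinear_map sa sb sd (\<lambda>u v. F u v w)" "bilinear_map sb sc sd (\<lambda>v w. F u v w)"
  using assms by (simp_all add: bilinear_map_def trilinear_map_def)

lemma trilinear_map_compose:
  assumes "trilinear_map sa sb sc sd F" "Vector_Spaces.linear s1 sa f" "Vector_Spaces.linear s2 sb g"
    "Vector_Spaces.linear s3 sc h"
  shows "trilinear_map s1 s2 s3 sd (\<lambda>u v w. F (f u) (g v) (h w))"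
  unfolding trilinear_map_def
proof (intro conjI allI)
  show "Vector_Spaces.linear s1 sd (\<lambda>u. F (f u) (g v) (h w))" for v w
    using assms(1) by (intro linear_compose_lambda[OF assms(2), of sd "\<lambda>u. F u (g v) (h w)"]) (simp add: trilinear_map_def)
  show "Vector_Spaces.linear s2 sd (\<lambda>v. F (f u) (g v) (h w))" for u w
    using assms(1) by (intro linear_compose_lambda[OF assms(3), of sd "\<lambda>v. F (f u) v (h w)"]) (simp add: trilinear_map_def)
  show "Vector_Spaces.linear s3 sd (\<lambda>w. F (f u) (g v) (h w))" for u v
    using assms(1) by (intro linear_compose_lambda[OF assms(4), of sd "F (f u) (g v)"]) (simp add: trilinear_map_def)
qed

lemma bilinear_map_simps:
  assumes "bilinear_map sa sb sc f"
  shows "f (u + u') v = f u v + f u' v" "f u (v + v') = f u v + f u v'"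
    "f (u - u') v = f u v - f u' v" "f u (v - v') = f u v - f u v'"
    "f (- u) v = - f u v" "f u (- v) = - f u v"
    "f 0 v = 0" "f u 0 = 0"
    "f (sa c u) v = sc c (f u v)" "f u (sb c v) = sc c (f u v)"
proof -
  note * = assms[unfolded bilinear_map_def]
  show "f (u + u') v = f u v + f u' v" "f u (v + v') = f u v + f u v'"
    "f (sa c u) v = sc c (f u v)" "f u (sb c v) = sc c (f u v)"
    using * by (auto simp: Vector_Spaces.linear_iff)
  interpret l: Vector_Spaces.linear sa sc "\<lambda>u. f u v" using * by simp
  interpret r: Vector_Spaces.linear sb sc "f u" using * by simp
  show "f (u - u') v = f u v - f u' v" "f (- u) v = - f u v" "f 0 v = 0"
    "f u (v - v') = f u v - f u v'" "f u (- v) = - f u v" "f u 0 = 0"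
    by (rule l.diff l.neg l.zero r.diff r.neg r.zero)+
qed

lemma linear_simps:
  assumes "Vector_Spaces.linear sa sb f"
  shows "f (u + v) = f u + f v" "f (sa c u) = sb c (f u)" "f 0 = 0"
proof -
  interpret l: Vector_Spaces.linear sa sb f by fact
  show "f (u + v) = f u + f v" "f (sa c u) = sb c (f u)" "f 0 = 0"
    by (rule l.add l.scale l.zero)+
qed

lemma tscale_add: "tscale c (s + t) = tscale c s + tscale c t"
  by (simp add: tscale_def fun_eq_iff algebra_simps)

text \<open>At a bilinear form the evaluation is linear in each leg, and at any other function the
  default value 0 is linear as well.\<close>

lemma bilinear_ten:
  assumes "vector_space sa" "vector_space sb"
  shows "bilinear_map sa sb tscale (ten sa sb)"
  using assms vector_space_tscale
  by (auto simp: bilinear_map_def Vector_Spaces.linear_iff ten_def tscale_def fun_eq_iff)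

lemma trilinear_ten3:
  assumes "vector_space sa" "vector_space sb" "vector_space sc"
  shows "trilinear_map sa sb sc tscale (ten3 sa sb sc)"
  using assms vector_space_tscale
  by (auto simp: trilinear_map_def Vector_Spaces.linear_iff ten3_def tscale_def fun_eq_iff)

section \<open>Sweedler calculus for tensors with two legs\<close>

lemma sweedler_add: "(t + t') \<bind> F = t \<bind> F + t' \<bind> F"
  and sweedler_diff: "(t - t') \<bind> F = t \<bind> F - t' \<bind> F"
  and sweedler_uminus: "(- t) \<bind> F = - (t \<bind> F)"
  and sweedler_zero: "0 \<bind> F = 0"
  by (simp_all add: sweedler_def fun_eq_iff)

lemma sweedler_sweedler: "(t \<bind> F) \<bind> G = t \<bind> (\<lambda>u v. F u v \<bind> G)"
  by (simp add: sweedler_def)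

lemma tflip_add: "\<tau> (t + t') = \<tau> t + \<tau> t'"
  and tflip_sweedler: "\<tau> (t \<bind> F) = t \<bind> (\<lambda>u v. \<tau> (F u v))"
  and sweedler_tflip: "\<tau> t \<bind> G = t \<bind> (\<lambda>u v. G v u)"
  by (simp_all add: tflip_def sweedler_def fun_eq_iff)

lemma bilinear_map_add:
  assumes "bilinear_map sa sb tscale F" "bilinear_map sa sb tscale G"
  shows "bilinear_map sa sb tscale (\<lambda>u v. F u v + G u v)"
  using assms
  by (auto simp: bilinear_map_def Vector_Spaces.linear_iff tscale_def fun_eq_iff algebra_simps)

lemma bilinear_map_diff:
  assumes "bilinear_map sa sb tscale F" "bilinear_map sa sb tscale G"
  shows "bilinear_map sa sb tscale (\<lambda>u v. F u v - G u v)"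
  using assms
  by (auto simp: bilinear_map_def Vector_Spaces.linear_iff tscale_def fun_eq_iff algebra_simps)

lemma bilinear_map_scale:
  assumes "bilinear_map sa sb tscale F"
  shows "bilinear_map sa sb tscale (\<lambda>u v. tscale c (F u v))"
  using assms
  by (auto simp: bilinear_map_def Vector_Spaces.linear_iff tscale_def fun_eq_iff algebra_simps)

text \<open>A functional \<open>t\<close> need not be additive, so a genuine tensor is required:
  both sides are linear in \<open>t\<close> and agree on the generators
  \<open>ten sa sb u v\<close>, hence on their span.\<close>

lemma sweedler_add_right:
  fixes sa :: "'k::field \<Rightarrow> 'a::ab_group_add \<Rightarrow> 'a" and sb :: "'k \<Rightarrow> 'b::ab_group_add \<Rightarrow> 'b"
  assumes "t \<in> tensor_space sa sb" "bilinear_map sa sb tscale F" "bilinear_map sa sb tscale G"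
  shows "t \<bind> (\<lambda>u v. F u v + G u v) = t \<bind> F + t \<bind> G"
proof (rule tensor_universal(2)[where f = "\<lambda>u v. F u v + G u v" and g = "\<lambda>t. t \<bind> (\<lambda>u v. F u v + G u v)"
      and h = "\<lambda>t. t \<bind> F + t \<bind> G", OF vector_space_tscale _ _ _ _ _ assms(1)])
  show "Vector_Spaces.linear tscale tscale (\<lambda>t :: ('k, 'a, 'b) tensor. t \<bind> F + t \<bind> G)"
    by (auto simp: Vector_Spaces.linear_iff vector_space_tscale tscale_def sweedler_def fun_eq_iff algebra_simps)
qed (simp_all add: linear_sweedler sweedler_ten bilinear_map_add assms fun_eq_iff)

lemma sweedler_scale_right:
  fixes sa :: "'k::field \<Rightarrow> 'a::ab_group_add \<Rightarrow> 'a" and sb :: "'k \<Rightarrow> 'b::ab_group_add \<Rightarrow> 'b"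
  assumes "t \<in> tensor_space sa sb" "bilinear_map sa sb tscale F"
  shows "t \<bind> (\<lambda>u v. tscale c (F u v)) = tscale c (t \<bind> F)"
proof (rule tensor_universal(2)[where f = "\<lambda>u v. tscale c (F u v)" and g = "\<lambda>t. t \<bind> (\<lambda>u v. tscale c (F u v))"
      and h = "\<lambda>t. tscale c (t \<bind> F)", OF vector_space_tscale _ _ _ _ _ assms(1)])
  show "Vector_Spaces.linear tscale tscale (\<lambda>t :: ('k, 'a, 'b) tensor. tscale c (t \<bind> F))"
    by (auto simp: Vector_Spaces.linear_iff vector_space_tscale tscale_def sweedler_def fun_eq_iff algebra_simps)
qed (simp_all add: linear_sweedler sweedler_ten bilinear_map_scale assms)

lemma linear_to_tensorD:
  assumes "linear_to_tensor s sa sb f"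
  shows "f x \<in> tensor_space sa sb" "f (x + y) = f x + f y" "f (s c x) = tscale c (f x)" "f 0 = 0"
    "vector_space s"
proof -
  have f: "Vector_Spaces.linear s tscale f" "\<forall>v. f v \<in> tensor_space sa sb"
    using assms by (simp_all add: linear_to_tensor_def)
  show "f x \<in> tensor_space sa sb" "f (x + y) = f x + f y" "f (s c x) = tscale c (f x)" "f 0 = 0"
    "vector_space s"
    using f(2) linear_simps[OF f(1)] f(1) by (simp_all only: Vector_Spaces.linear_iff)
qed

lemma sweedler_tscale: "tscale c t \<bind> F = tscale c (t \<bind> F)"
  by (simp add: tscale_def sweedler_def)

text \<open>Linearity in \<open>x\<close> passes through \<open>f\<close> and the tensor, linearity
  in \<open>y\<close> through the bound function; the latter uses that \<open>f x\<close> lies in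
  the tensor space.\<close>

lemma bilinear_sweedler_left:
  assumes f: "linear_to_tensor s sa sb f" and G: "trilinear_map sa sb sc tscale G"
  shows "bilinear_map s sc tscale (\<lambda>x y. f x \<bind> (\<lambda>u v. G u v y))"
proof -
  have b: "bilinear_map sa sb tscale (\<lambda>u v. G u v y)" for y
    using G by (simp add: bilinear_map_def trilinear_map_def)
  have l: "G u v (y + y') = G u v y + G u v y'" "G u v (sc c y) = tscale c (G u v y)" for u v y y' c
    using G by (auto simp: trilinear_map_def Vector_Spaces.linear_iff)
  have "vector_space sc" using G by (simp add: trilinear_map_def Vector_Spaces.linear_iff)
  then show ?thesis
    using linear_to_tensorD[OF f]
    by (auto simp: bilinear_map_def Vector_Spaces.linear_iff vector_space_tscale l sweedler_add sweedler_tscale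
        sweedler_add_right[OF _ b b] sweedler_scale_right[OF _ b])
qed

lemma bilinear_sweedler_right:
  assumes f: "linear_to_tensor s sa sb f" and G: "trilinear_map sc sa sb tscale G"
  shows "bilinear_map sc s tscale (\<lambda>x y. f y \<bind> (\<lambda>u v. G x u v))"
proof -
  have "trilinear_map sa sb sc tscale (\<lambda>u v x. G x u v)" using G by (simp add: trilinear_map_def)
  from bilinear_map_swap[OF bilinear_sweedler_left[OF f this]] show ?thesis .
qed

text \<open>Binding with \<open>ten\<close> and the identity are both linear and agree on the
  generators. This puts an arbitrary tensor into Sweedler form.\<close>

lemma sweedler_ten_ident:
  assumes "vector_space sa" "vector_space sb" "t \<in> tensor_space sa sb"
  shows "t \<bind> ten sa sb = t"
  using tensor_universal(2)[where g = "\<lambda>t. t \<bind> ten sa sb" and h = "\<lambda>t. t", OF vector_space_tscale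
      bilinear_ten[OF assms(1,2)] linear_sweedler linear_ident[OF vector_space_tscale] _ _ assms(3)]
  by (simp add: sweedler_ten bilinear_ten assms)

text \<open>Induction over the span: on a generator the binding returns a value of \<open>F\<close>,
  and sums and scalar multiples stay in the target space.\<close>

lemma sweedler_in_tensor_space:
  fixes sa :: "'k::field \<Rightarrow> 'a::ab_group_add \<Rightarrow> 'a" and sb :: "'k \<Rightarrow> 'b::ab_group_add \<Rightarrow> 'b"
    and sc :: "'k \<Rightarrow> 'c::ab_group_add \<Rightarrow> 'c" and sd :: "'k \<Rightarrow> 'd::ab_group_add \<Rightarrow> 'd"
  assumes t: "t \<in> tensor_space sa sb" and F: "bilinear_map sa sb tscale F"
    and in_T: "\<And>u v. F u v \<in> tensor_space sc sd"
  shows "t \<bind> F \<in> tensor_space sc sd"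
proof -
  interpret S: vector_space "tscale :: 'k \<Rightarrow> ('k, 'a, 'b) tensor \<Rightarrow> _" by (rule vector_space_tscale)
  interpret vector_space "tscale :: 'k \<Rightarrow> ('k, 'c, 'd) tensor \<Rightarrow> _" by (rule vector_space_tscale)
  show ?thesis
    using t unfolding tensor_space_def
  proof (induction rule: S.span_induct_alt)
    case base
    show ?case by (subst sweedler_zero) (rule span_zero)
  next
    case (step c x y)
    then obtain u v where x: "x = ten sa sb u v" by auto
    have "F u v \<in> span (range (\<lambda>(u, v). ten sc sd u v))"
      using in_T[of u v] by (simp add: tensor_space_def)
    then show ?case
      using step.IH unfolding x sweedler_add sweedler_tscale sweedler_ten[OF F] by (intro span_add span_scale)
  qed
qed

lemma tflip_in_tensor_space:
  fixes sa :: "'k::field \<Rightarrow> 'a::ab_group_add \<Rightarrow> 'a" and sb :: "'k \<Rightarrow> 'b::ab_group_add \<Rightarrow> 'b"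
  assumes "vector_space sa" "vector_space sb" "t \<in> tensor_space sa sb"
  shows "\<tau> t \<in> tensor_space sb sa"
proof -
  \<comment> \<open>In Sweedler form the flip acts on elementary tensors only.\<close>
  have "\<tau> t = \<tau> (t \<bind> ten sa sb)" using sweedler_ten_ident[OF assms] by simp
  also have "\<dots> = t \<bind> (\<lambda>u v. ten sb sa v u)" by (simp add: tflip_sweedler tflip_ten)
  also have "\<dots> \<in> tensor_space sb sa"
  proof (rule sweedler_in_tensor_space[OF assms(3)])
    show "bilinear_map sa sb tscale (\<lambda>u v. ten sb sa v u)"
      by (rule bilinear_map_swap[OF bilinear_ten[OF assms(2,1)]])
    interpret vector_space "tscale :: 'k \<Rightarrow> ('k, 'b, 'a) tensor \<Rightarrow> _" by (rule vector_space_tscale)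
    show "ten sb sa v u \<in> tensor_space sb sa" for u v
      unfolding tensor_space_def by (rule span_base) auto
  qed
  finally show ?thesis .
qed

text \<open>
  This consequence of membership in \<open>tensor_space\<close> suffices for comparing tensors, and unlike
  membership it holds for \<open>t \<bind> (\<lambda>u v. ten sa sb (f u v) (g u v))\<close> without any linearity of \<open>f\<close> and \<open>g\<close>.
\<close>

definition tensorial ::
  "('k::field \<Rightarrow> 'a::ab_group_add \<Rightarrow> 'a) \<Rightarrow> ('k \<Rightarrow> 'b::ab_group_add \<Rightarrow> 'b) \<Rightarrow> ('k, 'a, 'b) tensor \<Rightarrow> bool" where
  "tensorial sa sb t \<longleftrightarrow> t \<bind> ten sa sb = t \<and> t (\<lambda>_ _. 0) = 0"

lemma tensorial_tensor_space:
  assumes "vector_space sa" "vector_space sb" "t \<in> tensor_space sa sb"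
  shows "tensorial sa sb t"
proof -
  \<comment> \<open>The zero function is written as a multiple by 0 so that homogeneity in the bound
    function applies; \<open>undefined\<close> is an arbitrary point of evaluation.\<close>
  have "t (\<lambda>_ _. 0) = (t \<bind> (\<lambda>_ _. tscale 0 0)) undefined"
    by (simp add: sweedler_def tscale_def)
  also have "t \<bind> (\<lambda>_ _. tscale 0 0) = tscale 0 (t \<bind> (\<lambda>_ _. 0))"
    using assms vector_space_tscale
    by (intro sweedler_scale_right[OF assms(3)])
      (auto simp: bilinear_map_def Vector_Spaces.linear_iff tscale_def)
  finally show ?thesis
    using sweedler_ten_ident[OF assms] by (simp add: tensorial_def tscale_def)
qed

lemma tensorial_sweedler_zero: "tensorial sa sb t \<Longrightarrow> t \<bind> (\<lambda>_ _. 0) = 0"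
  by (auto simp: tensorial_def sweedler_def)

lemma tensorial_arith:
  assumes "tensorial sa sb t"
  shows "tensorial sa sb t' \<Longrightarrow> tensorial sa sb (t + t')" "tensorial sa sb t' \<Longrightarrow> tensorial sa sb (t - t')"
    "tensorial sa sb (- t)"
  using assms by (simp_all add: tensorial_def sweedler_add sweedler_diff sweedler_uminus)

lemma tensorial_tflip:
  assumes "tensorial sa sb t"
  shows "tensorial sb sa (\<tau> t)"
proof -
  have "\<tau> t \<bind> ten sb sa = \<tau> (t \<bind> ten sa sb)"
    by (simp add: sweedler_tflip tflip_sweedler tflip_ten)
  then show ?thesis
    using assms by (simp add: tensorial_def tflip_def)
qed

text \<open>A second binding with \<open>ten\<close> acts on the inner elementary tensors, where it
  is the identity by \<open>sweedler_ten\<close>.\<close>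

lemma tensorial_sweedler_ten:
  assumes "vector_space sa" "vector_space sb" "t (\<lambda>_ _. 0) = 0"
  shows "tensorial sa sb (t \<bind> (\<lambda>u v. ten sa sb (f u v) (g u v)))"
proof -
  have "(t \<bind> (\<lambda>u v. ten sa sb (f u v) (g u v))) (\<lambda>_ _. 0) = 0"
    using assms(3) by (simp add: sweedler_def ten_def)
  then show ?thesis
    by (simp add: tensorial_def sweedler_sweedler sweedler_ten bilinear_ten assms)
qed

section \<open>Tensors with three legs\<close>

definition sweedler3 :: "('k, 'a, 'b, 'c) tensor3 \<Rightarrow> ('a \<Rightarrow> 'b \<Rightarrow> 'c \<Rightarrow> ('x \<Rightarrow> 'k)) \<Rightarrow> ('x \<Rightarrow> 'k)" where
  "sweedler3 t F = (\<lambda>C. t (\<lambda>u v w. F u v w C))"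

lemma sweedler3_add: "sweedler3 (t + t') F = sweedler3 t F + sweedler3 t' F"
  and sweedler3_diff: "sweedler3 (t - t') F = sweedler3 t F - sweedler3 t' F"
  and sweedler3_uminus: "sweedler3 (- t) F = - sweedler3 t F"
  and sweedler3_sweedler: "sweedler3 (s \<bind> G) F = s \<bind> (\<lambda>u v. sweedler3 (G u v) F)"
  by (simp_all add: sweedler3_def sweedler_def fun_eq_iff)

lemma sweedler3_ten3:
  assumes "trilinear_map sa sb sc tscale F"
  shows "sweedler3 (ten3 sa sb sc u v w) F = F u v w"
proof
  fix C
  have "trilinear_map sa sb sc (*) (\<lambda>u v w. F u v w C)"
    using assms linear_apply[of sa "\<lambda>u. F u _ _"] linear_apply[of sb "\<lambda>v. F _ v _"] linear_apply[of sc "\<lambda>w. F _ _ w"]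
    by (auto simp: trilinear_map_def)
  then show "sweedler3 (ten3 sa sb sc u v w) F C = F u v w C"
    by (simp add: sweedler3_def ten3_def)
qed

lemma tflip12_add: "\<tau>\<^sub>1\<^sub>2 (t + t') = \<tau>\<^sub>1\<^sub>2 t + \<tau>\<^sub>1\<^sub>2 t'"
  and tflip23_add: "\<tau>\<^sub>2\<^sub>3 (t + t') = \<tau>\<^sub>2\<^sub>3 t + \<tau>\<^sub>2\<^sub>3 t'"
  and tflip12_sweedler3: "\<tau>\<^sub>1\<^sub>2 (sweedler3 t F) = sweedler3 t (\<lambda>u v w. \<tau>\<^sub>1\<^sub>2 (F u v w))"
  and tflip23_sweedler3: "\<tau>\<^sub>2\<^sub>3 (sweedler3 t F) = sweedler3 t (\<lambda>u v w. \<tau>\<^sub>2\<^sub>3 (F u v w))"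
  and sweedler3_tflip12: "sweedler3 (\<tau>\<^sub>1\<^sub>2 t) G = sweedler3 t (\<lambda>u v w. G v u w)"
  and sweedler3_tflip23: "sweedler3 (\<tau>\<^sub>2\<^sub>3 t) G' = sweedler3 t (\<lambda>u v w. G' u w v)"
  by (simp_all add: tflip12_def tflip23_def sweedler3_def fun_eq_iff)

text \<open>The transposition is an involution. A mixed condition such as
  \<open>\<alpha>\<^sub>H\<^sub>A\<^sub>A a = - \<tau>\<^sub>1\<^sub>2
  (\<alpha>\<^sub>A\<^sub>H\<^sub>A a)\<close> is given in one orientation, while the block
  comparison for the coassociator asks for both.\<close>

lemma eq_uminus_tflip12: "s = - \<tau>\<^sub>1\<^sub>2 t \<Longrightarrow> t = - \<tau>\<^sub>1\<^sub>2 s"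
  for t :: "('k::ab_group_add, 'a, 'b, 'c) tensor3"
  by (simp add: tflip12_def fun_eq_iff)

lemma eq_uminus_tflip23: "s = - \<tau>\<^sub>2\<^sub>3 t \<Longrightarrow> t = - \<tau>\<^sub>2\<^sub>3 s"
  for t :: "('k::ab_group_add, 'a, 'b, 'c) tensor3"
  by (simp add: tflip23_def fun_eq_iff)

text \<open>Serves to equate the eight arguments of \<open>block_tensor3\<close> one by one.\<close>

lemma arg_cong8:
  "\<lbrakk>a = a'; b = b'; c = c'; d = d'; e = e'; g = g'; h = h'; i = i'\<rbrakk> \<Longrightarrow>
   f a b c d e g h i = f a' b' c' d' e' g' h' i'"
  by simp

context cross_datum
begin

section \<open>Tensors on the direct sum\<close>

lemma vs_E: "vector_space E_scale"
proof -
  interpret A: vector_space sA by (rule vs_A)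
  interpret H: vector_space sH by (rule vs_H)
  show ?thesis
    by standard (auto simp: E_scale_def A.scale_right_distrib A.scale_left_distrib
        H.scale_right_distrib H.scale_left_distrib)
qed

lemmas vs = vs_A vs_H vs_E
lemmas bil = bil_mult_A bil_mult_H bil_lact_A bil_ract_A bil_lact_H bil_ract_H bil_cocyc_H bil_cocyc_A
lemmas lin = lin_comult_A lin_comult_H lin_lcoact_A lin_rcoact_A lin_lcoact_H lin_rcoact_H lin_cyc_A lin_cyc_H
lemmas in_tensor_space = lin[THEN linear_to_tensorD(1)]
lemmas comult_add = lin[THEN linear_to_tensorD(2)]
lemmas comult_scale = lin[THEN linear_to_tensorD(3)]
lemmas comult_zero = lin[THEN linear_to_tensorD(4)]
lemmas mult_simps =
  bil[THEN bilinear_map_simps(1)] bil[THEN bilinear_map_simps(2)]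
  bil[THEN bilinear_map_simps(3)] bil[THEN bilinear_map_simps(4)]
  bil[THEN bilinear_map_simps(5)] bil[THEN bilinear_map_simps(6)]
  bil[THEN bilinear_map_simps(7)] bil[THEN bilinear_map_simps(8)]
lemmas mult_scale = bil[THEN bilinear_map_simps(9)] bil[THEN bilinear_map_simps(10)]

lemma linear_inl: "Vector_Spaces.linear sA E_scale (\<lambda>a. (a, 0))"
proof -
  interpret H: vector_space sH by (rule vs_H)
  show ?thesis using vs by (auto simp: Vector_Spaces.linear_iff E_scale_def)
qed

lemma linear_inr: "Vector_Spaces.linear sH E_scale (\<lambda>x. (0, x))"
proof -
  interpret A: vector_space sA by (rule vs_A)
  show ?thesis using vs by (auto simp: Vector_Spaces.linear_iff E_scale_def)
qed

lemma linear_fst: "Vector_Spaces.linear E_scale sA fst"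
  and linear_snd: "Vector_Spaces.linear E_scale sH snd"
  using vs by (auto simp: Vector_Spaces.linear_iff E_scale_def)

lemma bilinear_E_mult: "bilinear_map E_scale E_scale E_scale E_mult"
proof -
  interpret A: vector_space sA by (rule vs_A)
  interpret H: vector_space sH by (rule vs_H)
  show ?thesis
    using vs
    by (auto simp: bilinear_map_def Vector_Spaces.linear_iff E_scale_def E_mult_def mult_simps mult_scale
        A.scale_right_distrib H.scale_right_distrib ac_simps)
qed

lemma E_mult_pure:
  "E_mult (a, 0) (b, 0) = (a \<cdot>\<^sub>A b, \<theta> a b)" "E_mult (a, 0) (0, y) = (a \<leftharpoonup> y, a \<triangleright> y)"
  "E_mult (0, x) (b, 0) = (x \<rightharpoonup> b, x \<triangleleft> b)" "E_mult (0, x) (0, y) = (\<sigma> x y, x \<cdot>\<^sub>H y)"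
  by (simp_all add: E_mult_def mult_simps)

section \<open>Block decomposition of tensors on the direct sum\<close>

lemmas bil_tenE = bilinear_ten[OF vs_E vs_E]
lemmas tenE_simps = bil_tenE[THEN bilinear_map_simps(1)] bil_tenE[THEN bilinear_map_simps(2)]
  bil_tenE[THEN bilinear_map_simps(7)] bil_tenE[THEN bilinear_map_simps(8)]

text \<open>On genuine tensors this is the canonical map from the direct sum of the four tensor
  products to the tensor square of E, induced by the inclusions of A and H.\<close>

definition block_tensor ::
  "('k, 'a, 'a) tensor \<Rightarrow> ('k, 'a, 'h) tensor \<Rightarrow> ('k, 'h, 'a) tensor \<Rightarrow> ('k, 'h, 'h) tensor \<Rightarrow>
   ('k, 'a \<times> 'h, 'a \<times> 'h) tensor" where
  "block_tensor tAA tAH tHA tHH = (tAA \<bind> (\<lambda>u v. (u, 0) \<otimes>\<^sub>E (v, 0))) + (tAH \<bind> (\<lambda>u v. (u, 0) \<otimes>\<^sub>E (0, v)))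
     + (tHA \<bind> (\<lambda>u v. (0, u) \<otimes>\<^sub>E (v, 0))) + (tHH \<bind> (\<lambda>u v. (0, u) \<otimes>\<^sub>E (0, v)))"

lemma block_tensor_add: "block_tensor t1 t2 t3 t4 + block_tensor s1 s2 s3 s4 = block_tensor (t1 + s1) (t2 + s2) (t3 + s3) (t4 + s4)"
  and block_tensor_diff: "block_tensor t1 t2 t3 t4 - block_tensor s1 s2 s3 s4 = block_tensor (t1 - s1) (t2 - s2) (t3 - s3) (t4 - s4)"
  by (simp_all add: block_tensor_def sweedler_add sweedler_diff)

lemma tflip_block_tensor: "\<tau> (block_tensor t1 t2 t3 t4) = block_tensor (\<tau> t1) (\<tau> t3) (\<tau> t2) (\<tau> t4)"
  by (simp add: block_tensor_def tflip_add tflip_sweedler tflip_ten sweedler_tflip ac_simps)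

lemma E_comult_eq:
  "E_comult (a, x) = block_tensor (\<Delta>\<^sub>A a + Q x) (\<psi> a + \<rho> x) (\<phi> a + \<gamma> x) (P a + \<Delta>\<^sub>H x)"
  by (simp add: E_comult_def block_tensor_def sweedler_add ac_simps)

lemma E_comult_pure:
  "E_comult (a, 0) = block_tensor (\<Delta>\<^sub>A a) (\<psi> a) (\<phi> a) (P a)" "E_comult (0, x) = block_tensor (Q x) (\<rho> x) (\<gamma> x) (\<Delta>\<^sub>H x)"
  by (simp_all add: E_comult_eq comult_zero)

lemma sweedler_block_tensor:
  assumes "bilinear_map E_scale E_scale tscale G"
  shows "block_tensor t1 t2 t3 t4 \<bind> G = t1 \<bind> (\<lambda>u v. G (u, 0) (v, 0)) + t2 \<bind> (\<lambda>u v. G (u, 0) (0, v))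
    + t3 \<bind> (\<lambda>u v. G (0, u) (v, 0)) + t4 \<bind> (\<lambda>u v. G (0, u) (0, v))"
  by (simp add: block_tensor_def sweedler_add sweedler_sweedler sweedler_ten[OF assms])

text \<open>Each block is recovered by projecting both legs with \<open>fst\<close> or
  \<open>snd\<close>: the other three blocks then have a zero leg and vanish, and the chosen one is
  reproduced. \<open>tensorial\<close> supplies exactly these two facts.\<close>

lemma block_tensor_eq_iff:
  assumes "tensorial sA sA t1" "tensorial sA sH t2" "tensorial sH sA t3" "tensorial sH sH t4"
    and "tensorial sA sA s1" "tensorial sA sH s2" "tensorial sH sA s3" "tensorial sH sH s4"
  shows "block_tensor t1 t2 t3 t4 = block_tensor s1 s2 s3 s4 \<longleftrightarrow> t1 = s1 \<and> t2 = s2 \<and> t3 = s3 \<and> t4 = s4"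
proof -
  have "block_tensor t1 t2 t3 t4 \<bind> (\<lambda>u v. ten sA sA (fst u) (fst v)) = t1"
    "block_tensor t1 t2 t3 t4 \<bind> (\<lambda>u v. ten sA sH (fst u) (snd v)) = t2"
    "block_tensor t1 t2 t3 t4 \<bind> (\<lambda>u v. ten sH sA (snd u) (fst v)) = t3"
    "block_tensor t1 t2 t3 t4 \<bind> (\<lambda>u v. ten sH sH (snd u) (snd v)) = t4"
    if t: "tensorial sA sA t1" "tensorial sA sH t2" "tensorial sH sA t3" "tensorial sH sH t4" for t1 t2 t3 t4
  proof -
    note b = bilinear_ten[OF vs(1) vs(1)] bilinear_ten[OF vs(1) vs(2)] bilinear_ten[OF vs(2) vs(1)]
      bilinear_ten[OF vs(2) vs(2)]
    show "block_tensor t1 t2 t3 t4 \<bind> (\<lambda>u v. ten sA sA (fst u) (fst v)) = t1"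
      "block_tensor t1 t2 t3 t4 \<bind> (\<lambda>u v. ten sA sH (fst u) (snd v)) = t2"
      "block_tensor t1 t2 t3 t4 \<bind> (\<lambda>u v. ten sH sA (snd u) (fst v)) = t3"
      "block_tensor t1 t2 t3 t4 \<bind> (\<lambda>u v. ten sH sH (snd u) (snd v)) = t4"
      using t
      by (simp_all add: t[THEN tensorial_sweedler_zero] sweedler_block_tensor bilinear_map_compose[OF b(1) linear_fst linear_fst]
          bilinear_map_compose[OF b(2) linear_fst linear_snd] bilinear_map_compose[OF b(3) linear_snd linear_fst]
          bilinear_map_compose[OF b(4) linear_snd linear_snd]
          b[THEN bilinear_map_simps(7)] b[THEN bilinear_map_simps(8)])
        (simp_all add: tensorial_def)
  qed
  from this[OF assms(1-4)] this[OF assms(5-8)] show ?thesis by metis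
qed

text \<open>The 2 by 2 matrix of an endomorphism of E; the first index is the target summand and the
  second the source, with 1 for A and 2 for H.\<close>

definition block_map ::
  "('a \<times> 'h \<Rightarrow> 'a \<times> 'h) \<Rightarrow> ('a \<Rightarrow> 'a) \<Rightarrow> ('h \<Rightarrow> 'a) \<Rightarrow> ('a \<Rightarrow> 'h) \<Rightarrow> ('h \<Rightarrow> 'h) \<Rightarrow> bool" where
  "block_map f f11 f12 f21 f22 \<longleftrightarrow> Vector_Spaces.linear E_scale E_scale f \<and>
     Vector_Spaces.linear sA sA f11 \<and> Vector_Spaces.linear sH sA f12 \<and>
     Vector_Spaces.linear sA sH f21 \<and> Vector_Spaces.linear sH sH f22 \<and>
     (\<forall>u. f (u, 0) = (f11 u, f21 u)) \<and> (\<forall>v. f (0, v) = (f12 v, f22 v))"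

text \<open>Right and left multiplication by pure elements are the operators that the compatibility
  conditions apply to one leg; the structure maps of the product are their matrix entries.\<close>

lemma block_map_E_mult:
  "block_map (\<lambda>u. E_mult u (b, 0)) (\<lambda>u. u \<cdot>\<^sub>A b) (\<lambda>u. u \<rightharpoonup> b) (\<lambda>u. \<theta> u b) (\<lambda>u. u \<triangleleft> b)"
  "block_map (\<lambda>u. E_mult u (0, y)) (\<lambda>u. u \<leftharpoonup> y) (\<lambda>u. \<sigma> u y) (\<lambda>u. u \<triangleright> y) (\<lambda>u. u \<cdot>\<^sub>H y)"
  "block_map (\<lambda>u. E_mult (b, 0) u) (\<lambda>u. b \<cdot>\<^sub>A u) (\<lambda>u. b \<leftharpoonup> u) (\<lambda>u. \<theta> b u) (\<lambda>u. b \<triangleright> u)"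
  "block_map (\<lambda>u. E_mult (0, y) u) (\<lambda>u. y \<rightharpoonup> u) (\<lambda>u. \<sigma> y u) (\<lambda>u. y \<triangleleft> u) (\<lambda>u. y \<cdot>\<^sub>H u)"
  by (auto simp: block_map_def E_mult_pure intro!: bilinear_map_linear[OF bilinear_E_mult] bil[THEN bilinear_map_linear(1)]
      bil[THEN bilinear_map_linear(2)])

text \<open>Matrix multiplication on the first leg. Distributing the binding over the two rows of
  the matrix needs genuine tensors, hence the membership hypotheses.\<close>

lemma block_tensor_map_fst:
  assumes f: "block_map f f11 f12 f21 f22"
    and t: "t1 \<in> tensor_space sA sA" "t2 \<in> tensor_space sA sH" "t3 \<in> tensor_space sH sA" "t4 \<in> tensor_space sH sH"
  shows "block_tensor t1 t2 t3 t4 \<bind> (\<lambda>u v. f u \<otimes>\<^sub>E v) =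
    block_tensor (t1 \<bind> (\<lambda>u v. f11 u \<otimes>\<^sub>A\<^sub>A v) + t3 \<bind> (\<lambda>u v. f12 u \<otimes>\<^sub>A\<^sub>A v))
      (t2 \<bind> (\<lambda>u v. f11 u \<otimes>\<^sub>A\<^sub>H v) + t4 \<bind> (\<lambda>u v. f12 u \<otimes>\<^sub>A\<^sub>H v))
      (t1 \<bind> (\<lambda>u v. f21 u \<otimes>\<^sub>H\<^sub>A v) + t3 \<bind> (\<lambda>u v. f22 u \<otimes>\<^sub>H\<^sub>A v))
      (t2 \<bind> (\<lambda>u v. f21 u \<otimes>\<^sub>H\<^sub>H v) + t4 \<bind> (\<lambda>u v. f22 u \<otimes>\<^sub>H\<^sub>H v))"
proof -
  note f = f[unfolded block_map_def]
  have b: "bilinear_map E_scale E_scale tscale (\<lambda>u v. f u \<otimes>\<^sub>E v)"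
    using f by (intro bilinear_map_compose[OF bil_tenE _ linear_ident[OF vs_E]]) simp
  \<comment> \<open>The image of a pure leg has both components in general; splitting it makes every
    summand land in a single block.\<close>
  have "(p, q) \<otimes>\<^sub>E v = (p, 0) \<otimes>\<^sub>E v + (0, q) \<otimes>\<^sub>E v" for p q v
    by (simp flip: tenE_simps)
  note split = this[of "f11 _" "f21 _"] this[of "f12 _" "f22 _"]
  note B = bilinear_map_compose[OF bil_tenE _ linear_inl] bilinear_map_compose[OF bil_tenE _ linear_inr]
  note C = sweedler_ten[OF bilinear_map_compose[OF bil_tenE linear_inl linear_inl]]
    sweedler_ten[OF bilinear_map_compose[OF bil_tenE linear_inl linear_inr]]
    sweedler_ten[OF bilinear_map_compose[OF bil_tenE linear_inr linear_inl]]
    sweedler_ten[OF bilinear_map_compose[OF bil_tenE linear_inr linear_inr]]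
  have l: "Vector_Spaces.linear sA E_scale (\<lambda>u. (f11 u, 0))" "Vector_Spaces.linear sA E_scale (\<lambda>u. (0, f21 u))"
    "Vector_Spaces.linear sH E_scale (\<lambda>u. (f12 u, 0))" "Vector_Spaces.linear sH E_scale (\<lambda>u. (0, f22 u))"
    using f by (simp_all add: linear_compose_lambda[OF _ linear_inl] linear_compose_lambda[OF _ linear_inr])
  have "block_tensor t1 t2 t3 t4 \<bind> (\<lambda>u v. f u \<otimes>\<^sub>E v) =
      (t1 \<bind> (\<lambda>u v. (f11 u, 0) \<otimes>\<^sub>E (v, 0)) + t1 \<bind> (\<lambda>u v. (0, f21 u) \<otimes>\<^sub>E (v, 0)))
    + (t2 \<bind> (\<lambda>u v. (f11 u, 0) \<otimes>\<^sub>E (0, v)) + t2 \<bind> (\<lambda>u v. (0, f21 u) \<otimes>\<^sub>E (0, v)))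
    + (t3 \<bind> (\<lambda>u v. (f12 u, 0) \<otimes>\<^sub>E (v, 0)) + t3 \<bind> (\<lambda>u v. (0, f22 u) \<otimes>\<^sub>E (v, 0)))
    + (t4 \<bind> (\<lambda>u v. (f12 u, 0) \<otimes>\<^sub>E (0, v)) + t4 \<bind> (\<lambda>u v. (0, f22 u) \<otimes>\<^sub>E (0, v)))"
    unfolding sweedler_block_tensor[OF b] using f
    by (simp only: split sweedler_add_right[OF t(1) B(1)[OF l(1)] B(1)[OF l(2)]]
        sweedler_add_right[OF t(2) B(2)[OF l(1)] B(2)[OF l(2)]]
        sweedler_add_right[OF t(3) B(1)[OF l(3)] B(1)[OF l(4)]]
        sweedler_add_right[OF t(4) B(2)[OF l(3)] B(2)[OF l(4)]])
  then show ?thesis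
    by (simp add: block_tensor_def sweedler_add sweedler_sweedler C ac_simps)
qed

text \<open>The three remaining placements of \<open>f\<close> follow from
  \<open>block_tensor_map_fst\<close> by flipping the given tensor (\<open>?swap\<close>), the
  result (\<open>?snd1\<close>), or both (\<open>?snd2\<close>).\<close>

lemma block_tensor_map:
  assumes f: "block_map f f11 f12 f21 f22"
    and t: "t1 \<in> tensor_space sA sA" "t2 \<in> tensor_space sA sH" "t3 \<in> tensor_space sH sA" "t4 \<in> tensor_space sH sH"
  shows "block_tensor t1 t2 t3 t4 \<bind> (\<lambda>u v. f v \<otimes>\<^sub>E u) =
    block_tensor (t1 \<bind> (\<lambda>u v. f11 v \<otimes>\<^sub>A\<^sub>A u) + t2 \<bind> (\<lambda>u v. f12 v \<otimes>\<^sub>A\<^sub>A u))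
      (t3 \<bind> (\<lambda>u v. f11 v \<otimes>\<^sub>A\<^sub>H u) + t4 \<bind> (\<lambda>u v. f12 v \<otimes>\<^sub>A\<^sub>H u))
      (t1 \<bind> (\<lambda>u v. f21 v \<otimes>\<^sub>H\<^sub>A u) + t2 \<bind> (\<lambda>u v. f22 v \<otimes>\<^sub>H\<^sub>A u))
      (t3 \<bind> (\<lambda>u v. f21 v \<otimes>\<^sub>H\<^sub>H u) + t4 \<bind> (\<lambda>u v. f22 v \<otimes>\<^sub>H\<^sub>H u))" (is ?swap)
    and "block_tensor t1 t2 t3 t4 \<bind> (\<lambda>u v. v \<otimes>\<^sub>E f u) =
    block_tensor (t1 \<bind> (\<lambda>u v. v \<otimes>\<^sub>A\<^sub>A f11 u) + t3 \<bind> (\<lambda>u v. v \<otimes>\<^sub>A\<^sub>A f12 u))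
      (t1 \<bind> (\<lambda>u v. v \<otimes>\<^sub>A\<^sub>H f21 u) + t3 \<bind> (\<lambda>u v. v \<otimes>\<^sub>A\<^sub>H f22 u))
      (t2 \<bind> (\<lambda>u v. v \<otimes>\<^sub>H\<^sub>A f11 u) + t4 \<bind> (\<lambda>u v. v \<otimes>\<^sub>H\<^sub>A f12 u))
      (t2 \<bind> (\<lambda>u v. v \<otimes>\<^sub>H\<^sub>H f21 u) + t4 \<bind> (\<lambda>u v. v \<otimes>\<^sub>H\<^sub>H f22 u))" (is ?snd1)
    and "block_tensor t1 t2 t3 t4 \<bind> (\<lambda>u v. u \<otimes>\<^sub>E f v) =
    block_tensor (t1 \<bind> (\<lambda>u v. u \<otimes>\<^sub>A\<^sub>A f11 v) + t2 \<bind> (\<lambda>u v. u \<otimes>\<^sub>A\<^sub>A f12 v))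
      (t1 \<bind> (\<lambda>u v. u \<otimes>\<^sub>A\<^sub>H f21 v) + t2 \<bind> (\<lambda>u v. u \<otimes>\<^sub>A\<^sub>H f22 v))
      (t3 \<bind> (\<lambda>u v. u \<otimes>\<^sub>H\<^sub>A f11 v) + t4 \<bind> (\<lambda>u v. u \<otimes>\<^sub>H\<^sub>A f12 v))
      (t3 \<bind> (\<lambda>u v. u \<otimes>\<^sub>H\<^sub>H f21 v) + t4 \<bind> (\<lambda>u v. u \<otimes>\<^sub>H\<^sub>H f22 v))" (is ?snd2)
proof -
  note flip = tflip_in_tensor_space[OF vs(1) vs(1)] tflip_in_tensor_space[OF vs(1) vs(2)]
    tflip_in_tensor_space[OF vs(2) vs(1)] tflip_in_tensor_space[OF vs(2) vs(2)]
  show swap: ?swap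
    using block_tensor_map_fst[OF f flip(1)[OF t(1)] flip(3)[OF t(3)] flip(2)[OF t(2)] flip(4)[OF t(4)]]
    by (simp add: sweedler_tflip flip: tflip_block_tensor)
  show ?snd1
    using arg_cong[OF block_tensor_map_fst[OF f t], of \<tau>]
    by (simp add: tflip_block_tensor tflip_add tflip_sweedler tflip_ten)
  show ?snd2
    using arg_cong[OF swap, of \<tau>]
    by (simp add: tflip_block_tensor tflip_add tflip_sweedler tflip_ten)
qed

section \<open>The compatibility conditions\<close>

definition E_compat1 :: "'a \<times> 'h \<Rightarrow> 'a \<times> 'h \<Rightarrow> bool" where
  "E_compat1 u w \<longleftrightarrow> E_comult (E_mult u w) =
         (E_comult u \<bind> (\<lambda>u1 u2. E_mult u1 w \<otimes>\<^sub>E u2))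
       + (E_comult u \<bind> (\<lambda>u1 u2. E_mult u2 w \<otimes>\<^sub>E u1))
       - (E_comult u \<bind> (\<lambda>u1 u2. u2 \<otimes>\<^sub>E E_mult w u1))
       + (E_comult w \<bind> (\<lambda>w1 w2. w1 \<otimes>\<^sub>E E_mult u w2))
       + (E_comult w \<bind> (\<lambda>w1 w2. w1 \<otimes>\<^sub>E E_mult w2 u))
       - (E_comult w \<bind> (\<lambda>w1 w2. E_mult u w1 \<otimes>\<^sub>E w2))"

definition E_compat2 :: "'a \<times> 'h \<Rightarrow> 'a \<times> 'h \<Rightarrow> bool" where
  "E_compat2 u w \<longleftrightarrow> E_comult (E_mult w u) + \<tau> (E_comult (E_mult w u)) =
         (E_comult u \<bind> (\<lambda>u1 u2. u1 \<otimes>\<^sub>E E_mult w u2))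
       + (E_comult u \<bind> (\<lambda>u1 u2. E_mult w u2 \<otimes>\<^sub>E u1))
       + (E_comult w \<bind> (\<lambda>w1 w2. E_mult w1 u \<otimes>\<^sub>E w2))
       + (E_comult w \<bind> (\<lambda>w1 w2. w2 \<otimes>\<^sub>E E_mult w1 u))"

lemmas in_A = lin_comult_A[THEN linear_to_tensorD(1)] lin_rcoact_A[THEN linear_to_tensorD(1)]
  lin_lcoact_A[THEN linear_to_tensorD(1)] lin_cyc_A[THEN linear_to_tensorD(1)]
lemmas in_H = lin_cyc_H[THEN linear_to_tensorD(1)] lin_lcoact_H[THEN linear_to_tensorD(1)]
  lin_rcoact_H[THEN linear_to_tensorD(1)] lin_comult_H[THEN linear_to_tensorD(1)]

text \<open>Sixteen rules: four placements of the multiplied leg times four multiplications by a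
  pure element, for the coproduct of an element of A.\<close>

lemmas block_tensor_map_A =
  block_map_E_mult[THEN block_tensor_map_fst, OF in_A]
  block_map_E_mult[THEN block_tensor_map(1), OF in_A]
  block_map_E_mult[THEN block_tensor_map(2), OF in_A]
  block_map_E_mult[THEN block_tensor_map(3), OF in_A]

lemmas block_tensor_map_H =
  block_map_E_mult[THEN block_tensor_map_fst, OF in_H]
  block_map_E_mult[THEN block_tensor_map(1), OF in_H]
  block_map_E_mult[THEN block_tensor_map(2), OF in_H]
  block_map_E_mult[THEN block_tensor_map(3), OF in_H]

lemma tensorial_comult:
  "tensorial sA sA (\<Delta>\<^sub>A a)" "tensorial sA sH (\<psi> a)" "tensorial sH sA (\<phi> a)" "tensorial sH sH (P a)"
  "tensorial sA sA (Q x)" "tensorial sA sH (\<rho> x)" "tensorial sH sA (\<gamma> x)" "tensorial sH sH (\<Delta>\<^sub>H x)"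
  by (simp_all add: tensorial_tensor_space vs in_tensor_space)

text \<open>The last group supplies \<open>t (\<lambda>_ _. 0) = 0\<close>, the side condition of
  \<open>tensorial_sweedler_ten\<close>.\<close>

lemmas tensorial_intros = tensorial_comult tensorial_arith tensorial_tflip
  tensorial_sweedler_ten[OF vs(1) vs(1)] tensorial_sweedler_ten[OF vs(1) vs(2)]
  tensorial_sweedler_ten[OF vs(2) vs(1)] tensorial_sweedler_ten[OF vs(2) vs(2)]
  tensorial_comult[unfolded tensorial_def, THEN conjunct2]

text \<open>
  \<open>E_comult_eq\<close> also matches pure arguments, so these are unfolded by \<open>E_comult_pure\<close> beforehand.
\<close>

lemmas compat_blocks = E_comult_eq block_tensor_map_A block_tensor_map_H block_tensor_add block_tensor_diff tflip_block_tensor tflip_add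

text \<open>Both sides become block tensors. Their AA, AH, HA and HH blocks, in this order, are the
  four named conditions up to the order of the summands; the other pairs of pure arguments work in
  the same way.\<close>

lemma E_compat1_AA: "(\<forall>a b. E_compat1 (a, 0) (b, 0)) \<longleftrightarrow> CBB1 \<and> CDM2 \<and> CDM1 \<and> CDM9"
  unfolding CBB1_def CDM2_def CDM1_def CDM9_def all_conj_distrib[symmetric]
  unfolding E_compat1_def E_mult_pure E_comult_pure
  unfolding compat_blocks
  by (intro all_cong1, subst block_tensor_eq_iff, (intro tensorial_intros)+,
      simp only: diff_conv_add_uminus minus_add_distrib ac_simps)

lemma E_compat1_AH: "(\<forall>a y. E_compat1 (a, 0) (0, y)) \<longleftrightarrow> CDM6 \<and> CDM12 \<and> CDM14 \<and> CDM7"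
  unfolding CDM6_def CDM12_def CDM14_def CDM7_def all_conj_distrib[symmetric]
  unfolding E_compat1_def E_mult_pure E_comult_pure
  unfolding compat_blocks
  by (intro all_cong1, subst block_tensor_eq_iff, (intro tensorial_intros)+,
      simp only: diff_conv_add_uminus minus_add_distrib ac_simps)

lemma E_compat1_HA: "(\<forall>b x. E_compat1 (0, x) (b, 0)) \<longleftrightarrow> CDM5 \<and> CDM13 \<and> CDM11 \<and> CDM8"
  unfolding CDM5_def CDM13_def CDM11_def CDM8_def all_conj_distrib[symmetric]
  unfolding E_compat1_def E_mult_pure E_comult_pure
  unfolding compat_blocks
  by (intro all_cong1, subst block_tensor_eq_iff, (intro tensorial_intros)+,
      simp only: diff_conv_add_uminus minus_add_distrib ac_simps)

lemma E_compat1_HH: "(\<forall>x y. E_compat1 (0, x) (0, y)) \<longleftrightarrow> CDM10 \<and> CDM3 \<and> CDM4 \<and> CBB3"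
  unfolding CDM10_def CDM3_def CDM4_def CBB3_def all_conj_distrib[symmetric]
  unfolding E_compat1_def E_mult_pure E_comult_pure
  unfolding compat_blocks
  by (intro all_cong1, subst block_tensor_eq_iff, (intro tensorial_intros)+,
      simp only: diff_conv_add_uminus minus_add_distrib ac_simps)

text \<open>The added flip exchanges the AH and HA blocks, by \<open>tflip_block_tensor\<close>;
  this is the origin of the flipped coactions in the mixed identities.\<close>

lemma E_compat2_AA: "(\<forall>a b. E_compat2 (a, 0) (b, 0)) \<longleftrightarrow> CBB2 \<and> CDM16 \<and> CDM15 \<and> CDM28"
  unfolding CBB2_def CDM16_def CDM15_def CDM28_def all_conj_distrib[symmetric]
  unfolding E_compat2_def E_mult_pure E_comult_pure
  unfolding compat_blocks
  by (intro all_cong1, subst block_tensor_eq_iff, (intro tensorial_intros)+,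
      simp only: diff_conv_add_uminus minus_add_distrib ac_simps)

lemma E_compat2_AH: "(\<forall>a y. E_compat2 (a, 0) (0, y)) \<longleftrightarrow> CDM20 \<and> CDM25 \<and> CDM23 \<and> CDM21"
  unfolding CDM20_def CDM25_def CDM23_def CDM21_def all_conj_distrib[symmetric]
  unfolding E_compat2_def E_mult_pure E_comult_pure
  unfolding compat_blocks
  by (intro all_cong1, subst block_tensor_eq_iff, (intro tensorial_intros)+,
      simp only: diff_conv_add_uminus minus_add_distrib ac_simps)

lemma E_compat2_HA: "(\<forall>b x. E_compat2 (0, x) (b, 0)) \<longleftrightarrow> CDM19 \<and> CDM26 \<and> CDM24 \<and> CDM22"
  unfolding CDM19_def CDM26_def CDM24_def CDM22_def all_conj_distrib[symmetric]
  unfolding E_compat2_def E_mult_pure E_comult_pure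
  unfolding compat_blocks
  by (intro all_cong1, subst block_tensor_eq_iff, (intro tensorial_intros)+,
      simp only: diff_conv_add_uminus minus_add_distrib ac_simps)

lemma E_compat2_HH: "(\<forall>x y. E_compat2 (0, x) (0, y)) \<longleftrightarrow> CDM27 \<and> CDM17 \<and> CDM18 \<and> CBB4"
  unfolding CDM27_def CDM17_def CDM18_def CBB4_def all_conj_distrib[symmetric]
  unfolding E_compat2_def E_mult_pure E_comult_pure
  unfolding compat_blocks
  by (intro all_cong1, subst block_tensor_eq_iff, (intro tensorial_intros)+,
      simp only: diff_conv_add_uminus minus_add_distrib ac_simps)

section \<open>Linearity of the comultiplication of E and reduction to pure arguments\<close>

lemma block_tensor_in_tensor_space:
  assumes "t1 \<in> tensor_space sA sA" "t2 \<in> tensor_space sA sH" "t3 \<in> tensor_space sH sA" "t4 \<in> tensor_space sH sH"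
  shows "block_tensor t1 t2 t3 t4 \<in> tensor_space E_scale E_scale"
proof -
  interpret vector_space "tscale :: 'k \<Rightarrow> ('k, 'a \<times> 'h, 'a \<times> 'h) tensor \<Rightarrow> _" by (rule vector_space_tscale)
  have add: "s + t \<in> tensor_space E_scale E_scale"
    if "s \<in> tensor_space E_scale E_scale" "t \<in> tensor_space E_scale E_scale" for s t
    using that span_add unfolding tensor_space_def by blast
  have base: "u \<otimes>\<^sub>E v \<in> tensor_space E_scale E_scale" for u v
    unfolding tensor_space_def by (rule span_base) auto
  note b = bilinear_map_compose[OF bil_tenE]
  show ?thesis
    unfolding block_tensor_def
    by (intro add sweedler_in_tensor_space[OF assms(1) b[OF linear_inl linear_inl] base]
        sweedler_in_tensor_space[OF assms(2) b[OF linear_inl linear_inr] base]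
        sweedler_in_tensor_space[OF assms(3) b[OF linear_inr linear_inl] base]
        sweedler_in_tensor_space[OF assms(4) b[OF linear_inr linear_inr] base])
qed

lemma E_comult_split: "E_comult (a, x) = E_comult (a, 0) + E_comult (0, x)"
  by (simp add: E_comult_eq block_tensor_add comult_zero)

lemma block_tensor_scale: "tscale c (block_tensor t1 t2 t3 t4) = block_tensor (tscale c t1) (tscale c t2) (tscale c t3) (tscale c t4)"
  by (simp add: block_tensor_def sweedler_tscale) (simp add: tscale_def fun_eq_iff algebra_simps)

lemma lin_E_comult: "linear_to_tensor E_scale E_scale E_scale E_comult"
  unfolding linear_to_tensor_def Vector_Spaces.linear_iff
proof (intro conjI allI)
  show "E_comult (u + v) = E_comult u + E_comult v" for u v
    by (cases u; cases v) (simp add: E_comult_eq comult_add block_tensor_add ac_simps)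
  show "E_comult (E_scale c u) = tscale c (E_comult u)" for c u
  proof (cases u)
    case (Pair a x)
    have "E_scale c (a, x) = (sA c a, sH c x)" by (simp add: E_scale_def)
    then show ?thesis
      by (simp add: Pair E_comult_eq comult_scale block_tensor_scale tscale_add)
  qed
  show "E_comult u \<in> tensor_space E_scale E_scale" for u
  proof (cases u)
    case (Pair a x)
    interpret vector_space "tscale :: 'k \<Rightarrow> ('k, 'a \<times> 'h, 'a \<times> 'h) tensor \<Rightarrow> _" by (rule vector_space_tscale)
    show ?thesis
      using span_add block_tensor_in_tensor_space[OF in_A] block_tensor_in_tensor_space[OF in_H]
      unfolding Pair E_comult_split[of a x] E_comult_pure tensor_space_def by blast
  qed
qed (rule vs_E vector_space_tscale)+

text \<open>A bilinear map on E is the sum of its four values on pure components.\<close>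

lemma bilinear_eq_iff_pure:
  assumes X: "bilinear_map E_scale E_scale s X" and Y: "bilinear_map E_scale E_scale s Y"
  shows "(\<forall>u w. X u w = Y u w) \<longleftrightarrow> (\<forall>a b. X (a, 0) (b, 0) = Y (a, 0) (b, 0)) \<and> (\<forall>a y. X (a, 0) (0, y) = Y (a, 0) (0, y))
    \<and> (\<forall>b x. X (0, x) (b, 0) = Y (0, x) (b, 0)) \<and> (\<forall>x y. X (0, x) (0, y) = Y (0, x) (0, y))"
    (is "_ \<longleftrightarrow> ?pure")
proof
  assume pure: ?pure
  show "\<forall>u w. X u w = Y u w"
  proof (intro allI)
    fix u w :: "'a \<times> 'h"
    have *: "Z (a, x) (b, y) = Z (a, 0) (b, 0) + Z (a, 0) (0, y) + Z (0, x) (b, 0) + Z (0, x) (0, y)"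
      if "bilinear_map E_scale E_scale s Z" for Z a x b y
      using bilinear_map_simps(1)[OF that, of "(a, 0)" "(0, x)" "(b, y)"]
        bilinear_map_simps(2)[OF that, of _ "(b, 0)" "(0, y)"] by simp
    obtain a x b y where "u = (a, x)" "w = (b, y)" by (cases u; cases w)
    then show "X u w = Y u w"
      using pure by (simp add: *[OF X, of a x b y] *[OF Y, of a x b y])
  qed
qed simp

lemma bilinear_map_comult_left:
  assumes "trilinear_map E_scale E_scale E_scale tscale G"
  shows "bilinear_map E_scale E_scale tscale (\<lambda>u w. E_comult u \<bind> (\<lambda>u1 u2. G u1 u2 w))"
    "bilinear_map E_scale E_scale tscale (\<lambda>w u. E_comult u \<bind> (\<lambda>u1 u2. G u1 u2 w))"
  using bilinear_sweedler_left[OF lin_E_comult assms] bilinear_map_swap by blast+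

text \<open>With the legs of one factor as \<open>u1\<close>, \<open>u2\<close> and the other factor
  as \<open>w\<close>, these are all the bound functions in the two compatibility conditions.
  Trilinearity makes each term bilinear in the pair of factors.\<close>

lemma trilinear_tenE_mult:
  "trilinear_map E_scale E_scale E_scale tscale (\<lambda>u1 u2 w. E_mult u1 w \<otimes>\<^sub>E u2)"
  "trilinear_map E_scale E_scale E_scale tscale (\<lambda>u1 u2 w. E_mult u2 w \<otimes>\<^sub>E u1)"
  "trilinear_map E_scale E_scale E_scale tscale (\<lambda>u1 u2 w. E_mult w u1 \<otimes>\<^sub>E u2)"
  "trilinear_map E_scale E_scale E_scale tscale (\<lambda>u1 u2 w. E_mult w u2 \<otimes>\<^sub>E u1)"
  "trilinear_map E_scale E_scale E_scale tscale (\<lambda>u1 u2 w. u1 \<otimes>\<^sub>E E_mult u2 w)"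
  "trilinear_map E_scale E_scale E_scale tscale (\<lambda>u1 u2 w. u2 \<otimes>\<^sub>E E_mult u1 w)"
  "trilinear_map E_scale E_scale E_scale tscale (\<lambda>u1 u2 w. u1 \<otimes>\<^sub>E E_mult w u2)"
  "trilinear_map E_scale E_scale E_scale tscale (\<lambda>u1 u2 w. u2 \<otimes>\<^sub>E E_mult w u1)"
  using vs_E vector_space_tscale
  by (simp_all add: trilinear_map_def Vector_Spaces.linear_iff bilinear_map_simps[OF bilinear_E_mult]
      bilinear_map_simps[OF bil_tenE])

lemma bilinear_comult_mult:
  "bilinear_map E_scale E_scale tscale (\<lambda>u w. E_comult (E_mult u w))"
  using linear_compose_lambda bilinear_E_mult lin_E_comult
  unfolding bilinear_map_def linear_to_tensor_def by blast

lemma linear_tflip: "Vector_Spaces.linear tscale tscale \<tau>"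
  by (auto simp: Vector_Spaces.linear_iff vector_space_tscale tflip_def tscale_def fun_eq_iff)

lemmas E_bilinear = bilinear_map_add bilinear_map_diff bilinear_comult_mult
  trilinear_tenE_mult[THEN bilinear_map_comult_left(1)] trilinear_tenE_mult[THEN bilinear_map_comult_left(2)]

lemma E_compat1_iff:
  "(\<forall>u w. E_compat1 u w) \<longleftrightarrow> (\<forall>a b. E_compat1 (a, 0) (b, 0)) \<and> (\<forall>a y. E_compat1 (a, 0) (0, y))
    \<and> (\<forall>b x. E_compat1 (0, x) (b, 0)) \<and> (\<forall>x y. E_compat1 (0, x) (0, y))"
  unfolding E_compat1_def by (rule bilinear_eq_iff_pure[where s = tscale]) (intro E_bilinear)+

lemma E_compat2_iff:
  "(\<forall>u w. E_compat2 u w) \<longleftrightarrow> (\<forall>a b. E_compat2 (a, 0) (b, 0)) \<and> (\<forall>a y. E_compat2 (a, 0) (0, y))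
    \<and> (\<forall>b x. E_compat2 (0, x) (b, 0)) \<and> (\<forall>x y. E_compat2 (0, x) (0, y))"
proof -
  have flip: "bilinear_map E_scale E_scale tscale (\<lambda>u w. \<tau> (E_comult (E_mult w u)))"
    using linear_compose_lambda[OF _ linear_tflip] bilinear_comult_mult unfolding bilinear_map_def by blast
  show ?thesis
    unfolding E_compat2_def
    by (rule bilinear_eq_iff_pure[where s = tscale])
      (intro E_bilinear flip bilinear_map_swap[OF bilinear_comult_mult])+
qed

section \<open>The algebra and the coalgebra on the direct sum\<close>

lemma additive3_eq_zeroI:
  fixes L :: "'a \<times> 'h \<Rightarrow> 'a \<times> 'h \<Rightarrow> 'a \<times> 'h \<Rightarrow> 'z::ab_group_add"
  assumes add: "\<And>u u' v w. L (u + u') v w = L u v w + L u' v w"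
    "\<And>u v v' w. L u (v + v') w = L u v w + L u v' w" "\<And>u v w w'. L u v (w + w') = L u v w + L u v w'"
    and pure: "\<And>a b c. L (a, 0) (b, 0) (c, 0) = 0" "\<And>a b z. L (a, 0) (b, 0) (0, z) = 0"
    "\<And>a y c. L (a, 0) (0, y) (c, 0) = 0" "\<And>a y z. L (a, 0) (0, y) (0, z) = 0"
    "\<And>x b c. L (0, x) (b, 0) (c, 0) = 0" "\<And>x b z. L (0, x) (b, 0) (0, z) = 0"
    "\<And>x y c. L (0, x) (0, y) (c, 0) = 0" "\<And>x y z. L (0, x) (0, y) (0, z) = 0"
  shows "L u v w = 0"
proof -
  \<comment> \<open>Each argument is split into its components; additivity then leaves the eight
    values on pure triples.\<close>
  obtain a x b y c z where u: "u = (a, 0) + (0, x)" "v = (b, 0) + (0, y)" "w = (c, 0) + (0, z)"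
    by (metis add_Pair add.right_neutral add.left_neutral surj_pair)
  show ?thesis unfolding u add pure by simp
qed

lemma E_mult_eq: "E_mult (a, x) (b, y) = (a \<cdot>\<^sub>A b + x \<rightharpoonup> b + a \<leftharpoonup> y + \<sigma> x y, x \<cdot>\<^sub>H y + x \<triangleleft> b + a \<triangleright> y + \<theta> a b)"
  by (simp add: E_mult_def)

text \<open>The left alternator is symmetric in its first two arguments and the right one in its
  last two, so up to symmetry each has four mixed types of pure triples. With two components per
  type they give the sixteen conditions CP1 to CP16; the types AAA and HHH give the two cocycle
  algebras.\<close>

lemma alternative_E:
  assumes "cocycle_cross_product_system"
  shows "alternative_algebra E_scale E_mult"
  unfolding alternative_algebra_def
proof (intro conjI allI)
  \<comment> \<open>Sums inside arguments are expanded by \<open>mult_simps\<close>, as they are in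
    the components of the alternators below.\<close>
  note cp = assms[unfolded cocycle_cross_product_system_def cocycle_alternative_algebra_A_def
    cocycle_alternative_algebra_H_def cocycle_on_A_def cocycle_on_H_def CP1_def CP2_def CP3_def CP4_def CP5_def CP6_def
    CP7_def CP8_def CP9_def CP10_def CP11_def CP12_def CP13_def CP14_def CP15_def CP16_def mult_simps]
  note s = bilinear_map_simps[OF bilinear_E_mult]
  show "E_mult (E_mult u v) w - E_mult u (E_mult v w) + E_mult (E_mult v u) w - E_mult v (E_mult u w) = 0" for u v w
    by (rule additive3_eq_zeroI[of "\<lambda>u v w. E_mult (E_mult u v) w - E_mult u (E_mult v w) + E_mult (E_mult v u) w - E_mult v (E_mult u w)"];
       (simp add: s; fail | insert cp; simp add: E_mult_eq mult_simps zero_prod_def; simp add: algebra_simps; fail))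
  show "E_mult (E_mult u v) w - E_mult u (E_mult v w) + E_mult (E_mult u w) v - E_mult u (E_mult w v) = 0" for u v w
    by (rule additive3_eq_zeroI[of "\<lambda>u v w. E_mult (E_mult u v) w - E_mult u (E_mult v w) + E_mult (E_mult u w) v - E_mult u (E_mult w v)"];
       (simp add: s; fail | insert cp; simp add: E_mult_eq mult_simps zero_prod_def; simp add: algebra_simps; fail))
qed (rule vs_E bilinear_E_mult)+

section \<open>The coassociator of E and its eight blocks\<close>

abbreviation ten3E :: "'a \<times> 'h \<Rightarrow> 'a \<times> 'h \<Rightarrow> 'a \<times> 'h \<Rightarrow> ('k, 'a \<times> 'h, 'a \<times> 'h, 'a \<times> 'h) tensor3" where
  "ten3E \<equiv> ten3 E_scale E_scale E_scale"

text \<open>The analogue of \<open>block_tensor\<close> for three legs, with the blocks in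
  lexicographic order.\<close>

definition block_tensor3 where
  "block_tensor3 tAAA tAAH tAHA tAHH tHAA tHAH tHHA tHHH =
     sweedler3 tAAA (\<lambda>u v w. ten3E (u, 0) (v, 0) (w, 0)) + sweedler3 tAAH (\<lambda>u v w. ten3E (u, 0) (v, 0) (0, w))
   + sweedler3 tAHA (\<lambda>u v w. ten3E (u, 0) (0, v) (w, 0)) + sweedler3 tAHH (\<lambda>u v w. ten3E (u, 0) (0, v) (0, w))
   + sweedler3 tHAA (\<lambda>u v w. ten3E (0, u) (v, 0) (w, 0)) + sweedler3 tHAH (\<lambda>u v w. ten3E (0, u) (v, 0) (0, w))
   + sweedler3 tHHA (\<lambda>u v w. ten3E (0, u) (0, v) (w, 0)) + sweedler3 tHHH (\<lambda>u v w. ten3E (0, u) (0, v) (0, w))"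

lemma tflip12_block_tensor3: "\<tau>\<^sub>1\<^sub>2 (block_tensor3 t1 t2 t3 t4 t5 t6 t7 t8) =
    block_tensor3 (\<tau>\<^sub>1\<^sub>2 t1) (\<tau>\<^sub>1\<^sub>2 t2) (\<tau>\<^sub>1\<^sub>2 t5) (\<tau>\<^sub>1\<^sub>2 t6) (\<tau>\<^sub>1\<^sub>2 t3) (\<tau>\<^sub>1\<^sub>2 t4) (\<tau>\<^sub>1\<^sub>2 t7) (\<tau>\<^sub>1\<^sub>2 t8)"
  by (simp add: block_tensor3_def tflip12_add tflip12_sweedler3 tflip12_ten3 sweedler3_tflip12 ac_simps)

lemma tflip23_block_tensor3: "\<tau>\<^sub>2\<^sub>3 (block_tensor3 t1 t2 t3 t4 t5 t6 t7 t8) =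
    block_tensor3 (\<tau>\<^sub>2\<^sub>3 t1) (\<tau>\<^sub>2\<^sub>3 t3) (\<tau>\<^sub>2\<^sub>3 t2) (\<tau>\<^sub>2\<^sub>3 t4) (\<tau>\<^sub>2\<^sub>3 t5) (\<tau>\<^sub>2\<^sub>3 t7) (\<tau>\<^sub>2\<^sub>3 t6) (\<tau>\<^sub>2\<^sub>3 t8)"
  by (simp add: block_tensor3_def tflip23_add tflip23_sweedler3 tflip23_ten3 sweedler3_tflip23 ac_simps)

lemma uminus_block_tensor3: "- block_tensor3 t1 t2 t3 t4 t5 t6 t7 t8 = block_tensor3 (- t1) (- t2) (- t3) (- t4) (- t5) (- t6) (- t7) (- t8)"
  by (simp add: block_tensor3_def sweedler3_uminus algebra_simps)

lemma trilinear_ten3E: "trilinear_map E_scale E_scale E_scale tscale ten3E"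
  by (rule trilinear_ten3[OF vs_E vs_E vs_E])

lemmas trilinear_ten3E_pure =
  trilinear_map_compose[OF trilinear_ten3E linear_inl linear_inl linear_inl]
  trilinear_map_compose[OF trilinear_ten3E linear_inl linear_inl linear_inr]
  trilinear_map_compose[OF trilinear_ten3E linear_inl linear_inr linear_inl]
  trilinear_map_compose[OF trilinear_ten3E linear_inl linear_inr linear_inr]
  trilinear_map_compose[OF trilinear_ten3E linear_inr linear_inl linear_inl]
  trilinear_map_compose[OF trilinear_ten3E linear_inr linear_inl linear_inr]
  trilinear_map_compose[OF trilinear_ten3E linear_inr linear_inr linear_inl]
  trilinear_map_compose[OF trilinear_ten3E linear_inr linear_inr linear_inr]

lemmas bilinear_ten3E = trilinear_ten3E[THEN trilinear_map_bilinear(1)] trilinear_ten3E[THEN trilinear_map_bilinear(2)]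

text \<open>The first eight rules distribute an outer binding over the sum of inner ones; the rest
  discharge the bilinearity hypotheses that this requires.\<close>

lemmas nested_sweedler_simps =
  in_A(1)[THEN sweedler_add_right] in_A(2)[THEN sweedler_add_right] in_A(3)[THEN sweedler_add_right] in_A(4)[THEN sweedler_add_right]
  in_H(1)[THEN sweedler_add_right] in_H(2)[THEN sweedler_add_right] in_H(3)[THEN sweedler_add_right] in_H(4)[THEN sweedler_add_right]
  bilinear_map_add lin[THEN bilinear_sweedler_left] lin[THEN bilinear_sweedler_right] trilinear_ten3E_pure

text \<open>The outer coproduct opens into four blocks with pure legs, so the inner one opens into
  four blocks again. Each half of the coassociator thus has sixteen terms; sorted by the types of
  the three legs, two from each half form one block.\<close>

lemma coassociator_E_A:
  "coassociator E_scale E_comult (a, 0) = block_tensor3 (\<alpha>\<^sub>A\<^sub>A\<^sub>A a) (\<alpha>\<^sub>A\<^sub>A\<^sub>H a) (\<alpha>\<^sub>A\<^sub>H\<^sub>A a) (\<alpha>\<^sub>A\<^sub>H\<^sub>H a)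
     (\<alpha>\<^sub>H\<^sub>A\<^sub>A a) (\<alpha>\<^sub>H\<^sub>A\<^sub>H a) (\<alpha>\<^sub>H\<^sub>H\<^sub>A a) (\<alpha>\<^sub>H\<^sub>H\<^sub>H a)"
  unfolding coassociator_def E_comult_pure
    sweedler_block_tensor[OF bilinear_sweedler_left[OF lin_E_comult trilinear_ten3E]]
    sweedler_block_tensor[OF bilinear_sweedler_right[OF lin_E_comult trilinear_ten3E]]
    E_comult_pure sweedler_block_tensor[OF bilinear_ten3E(1)] sweedler_block_tensor[OF bilinear_ten3E(2)]
  by (simp only: nested_sweedler_simps)
    (simp add: block_tensor3_def \<alpha>\<^sub>A\<^sub>A\<^sub>A_def \<alpha>\<^sub>A\<^sub>A\<^sub>H_def \<alpha>\<^sub>A\<^sub>H\<^sub>A_def \<alpha>\<^sub>A\<^sub>H\<^sub>H_def \<alpha>\<^sub>H\<^sub>A\<^sub>A_def \<alpha>\<^sub>H\<^sub>A\<^sub>H_def \<alpha>\<^sub>H\<^sub>H\<^sub>A_def \<alpha>\<^sub>H\<^sub>H\<^sub>H_def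
    sweedler3_add sweedler3_diff sweedler3_sweedler trilinear_ten3E_pure[THEN sweedler3_ten3])

lemma coassociator_E_H:
  "coassociator E_scale E_comult (0, x) = block_tensor3 (\<beta>\<^sub>A\<^sub>A\<^sub>A x) (\<beta>\<^sub>A\<^sub>A\<^sub>H x) (\<beta>\<^sub>A\<^sub>H\<^sub>A x) (\<beta>\<^sub>A\<^sub>H\<^sub>H x)
     (\<beta>\<^sub>H\<^sub>A\<^sub>A x) (\<beta>\<^sub>H\<^sub>A\<^sub>H x) (\<beta>\<^sub>H\<^sub>H\<^sub>A x) (\<beta>\<^sub>H\<^sub>H\<^sub>H x)"
  unfolding coassociator_def E_comult_pure
    sweedler_block_tensor[OF bilinear_sweedler_left[OF lin_E_comult trilinear_ten3E]]
    sweedler_block_tensor[OF bilinear_sweedler_right[OF lin_E_comult trilinear_ten3E]]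
    E_comult_pure sweedler_block_tensor[OF bilinear_ten3E(1)] sweedler_block_tensor[OF bilinear_ten3E(2)]
  by (simp only: nested_sweedler_simps)
    (simp add: block_tensor3_def \<beta>\<^sub>A\<^sub>A\<^sub>A_def \<beta>\<^sub>A\<^sub>A\<^sub>H_def \<beta>\<^sub>A\<^sub>H\<^sub>A_def \<beta>\<^sub>A\<^sub>H\<^sub>H_def \<beta>\<^sub>H\<^sub>A\<^sub>A_def \<beta>\<^sub>H\<^sub>A\<^sub>H_def \<beta>\<^sub>H\<^sub>H\<^sub>A_def \<beta>\<^sub>H\<^sub>H\<^sub>H_def
    sweedler3_add sweedler3_diff sweedler3_sweedler trilinear_ten3E_pure[THEN sweedler3_ten3])

text \<open>In both halves the element enters only through the outermost tensor, in which binding is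
  additive.\<close>

lemma coassociator_E_split:
  "coassociator E_scale E_comult (a, x) =
    coassociator E_scale E_comult (a, 0) + coassociator E_scale E_comult (0, x)"
  unfolding coassociator_def E_comult_split[of a x] sweedler_add by simp

text \<open>A transposition permutes the eight blocks, so each block equation is one of the cycle
  conditions, possibly reversed by \<open>eq_uminus_tflip12\<close> or
  \<open>eq_uminus_tflip23\<close>. Pure elements suffice by additivity.\<close>

lemma alternative_coalgebra_E:
  assumes "cycle_cross_coproduct_system"
  shows "alternative_coalgebra E_scale E_comult"
  unfolding alternative_coalgebra_def
proof (intro conjI allI)
  note cycle = assms[unfolded cycle_cross_coproduct_system_def cycle_alternative_coalgebra_A_def
      cycle_alternative_coalgebra_H_def cycle_on_A_def cycle_on_H_def]
  have pure12_A: "coassociator E_scale E_comult (a, 0) = - \<tau>\<^sub>1\<^sub>2 (coassociator E_scale E_comult (a, 0))" for a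
    unfolding coassociator_E_A tflip12_block_tensor3 uminus_block_tensor3
    using cycle
    by (elim conjE allE[where x = a], intro arg_cong8[where f = block_tensor3])
      (assumption | rule eq_uminus_tflip12, assumption)+
  have pure12_H: "coassociator E_scale E_comult (0, x) = - \<tau>\<^sub>1\<^sub>2 (coassociator E_scale E_comult (0, x))" for x
    unfolding coassociator_E_H tflip12_block_tensor3 uminus_block_tensor3
    using cycle
    by (elim conjE allE[where x = x], intro arg_cong8[where f = block_tensor3])
      (assumption | rule eq_uminus_tflip12, assumption)+
  have pure23_A: "coassociator E_scale E_comult (a, 0) = - \<tau>\<^sub>2\<^sub>3 (coassociator E_scale E_comult (a, 0))" for a
    unfolding coassociator_E_A tflip23_block_tensor3 uminus_block_tensor3
    using cycle
    by (elim conjE allE[where x = a], intro arg_cong8[where f = block_tensor3])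
      (assumption | rule eq_uminus_tflip23, assumption)+
  have pure23_H: "coassociator E_scale E_comult (0, x) = - \<tau>\<^sub>2\<^sub>3 (coassociator E_scale E_comult (0, x))" for x
    unfolding coassociator_E_H tflip23_block_tensor3 uminus_block_tensor3
    using cycle
    by (elim conjE allE[where x = x], intro arg_cong8[where f = block_tensor3])
      (assumption | rule eq_uminus_tflip23, assumption)+
  fix u :: "'a \<times> 'h"
  obtain a x where u: "u = (a, x)" by (cases u)
  show "coassociator E_scale E_comult u = - \<tau>\<^sub>1\<^sub>2 (coassociator E_scale E_comult u)"
    unfolding u coassociator_E_split[of a x] tflip12_add minus_add_distrib
    by (rule arg_cong2[where f = "(+)", OF pure12_A pure12_H])
  show "coassociator E_scale E_comult u = - \<tau>\<^sub>2\<^sub>3 (coassociator E_scale E_comult u)"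
    unfolding u coassociator_E_split[of a x] tflip23_add minus_add_distrib
    by (rule arg_cong2[where f = "(+)", OF pure23_A pure23_H])
qed (rule vs_E lin_E_comult)+

end

theorem theorem4p16:
  fixes D :: "('k::field_char_0, 'a::ab_group_add, 'h::ab_group_add) cross_data"
  assumes "cross_datum D"
    and "cross_datum.cocycle_braided_alternative_bialgebra_A D"
    and "cross_datum.cocycle_braided_alternative_bialgebra_H D"
    and "cross_datum.cocycle_cross_product_system D"
    and "cross_datum.cycle_cross_coproduct_system D"
  shows "alternative_bialgebra (cross_datum.E_scale D) (cross_datum.E_mult D) (cross_datum.E_comult D)
     \<longleftrightarrow> cross_datum.cocycle_double_matched_pair D"
proof -
  interpret cross_datum D by fact
  have "CBB1" "CBB2" "CBB3" "CBB4"
    using assms(2,3) by (simp_all add: cocycle_braided_alternative_bialgebra_A_def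
        cocycle_braided_alternative_bialgebra_H_def)
  \<comment> \<open>The two conditions amount to 32 identities; with CBB1 to CBB4 known, the
    remaining 28 are the matched pair conditions.\<close>
  then have "(\<forall>u w. E_compat1 u w) \<and> (\<forall>u w. E_compat2 u w) \<longleftrightarrow> cocycle_double_matched_pair"
    unfolding E_compat1_iff E_compat2_iff E_compat1_AA E_compat1_AH E_compat1_HA E_compat1_HH
      E_compat2_AA E_compat2_AH E_compat2_HA E_compat2_HH cocycle_double_matched_pair_def
    by argo
  \<comment> \<open>The algebra and coalgebra axioms of E already hold, so being a bialgebra comes
    down to the two compatibility conditions.\<close>
  then show ?thesis
    using alternative_E[OF assms(4)] alternative_coalgebra_E[OF assms(5)]
    by (simp only: alternative_bialgebra_def E_compat1_def E_compat2_def simp_thms)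
qed

end
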